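(* Let $1\le p<n$ be integers. The polynomials $D_I^{(k)}$ with $I^{(k)}\in\tilde{\mathcal I}_{\mathrm{pbw}}$ form a sagbi basis of the semi-infinite Plücker algebra $\tilde{\mathcal P}$ with respect to the monomial order $<_{\mathrm{pbw}}$.
   Context: Notation: $\mathbb N_0=\{0,1,2,\dots\}$, and $[a,b]$ denotes the set of integers $x$ with $a\le x\le b$. Fix integers $1\le p<n$. For an integer $a$, "$a \bmod n$" denotes the representative of $a$ modulo $n$ lying in $[1,n]$; $\bmod$ is performed after addition and subtraction. Semi-infinite Plücker algebra. Consider variables $z_{i,j}^{(k)}$ with $i\in[1,p]$, $j\in[1,n]$, $k\in\mathbb N_0$. Let $z_{i,j}(t)=\sum_{k\ge 0} z_{i,j}^{(k)}t^k$ and let $Z(t)$ be the $p\times n$ matrix with entries $z_{i,j}(t)$. For a $p$-tuple $I=(\alpha_1,\dots,\alpha_p)$ of integers in $[1,n]$ let $Z_I(t)$ be the $p\times p$ matrix whose $j$th column is the $\alpha_j$th column of $Z(t)$; let $D_I(t)=\det Z_I(t)$ and let $D_I^{(k)}$ be the coefficient of $t^k$ in $D_I(t)$. $\tilde{\mathcal P}$ is the subalgebra of $\mathbb C[\{z_{i,j}^{(k)}\}]$ generated by all $D_I^{(k)}$. Sagbi bases. For a monomial order $<$, $\mathrm{in}_<(f)$ is the $<$-maximal term of $f$ (with its coefficient), and for a subalgebra $A$ of a polynomial ring, $\mathrm{in}_<A$ is the linear span of all $\mathrm{in}_<(f)$, $f\in A$. A (possibly infinite) generating set $\{s_k\}$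 of $A$ is a sagbi basis of $A$ with respect to $<$ if the set $\{\mathrm{in}_<(s_k)\}$ generates the algebra $\mathrm{in}_<A$. Given an ordering $x_1,x_2,\dots$ of the variables, the degree reverse lexicographic order is: $\prod x_i^{a_i}<\prod x_i^{b_i}$ iff $\sum a_i<\sum b_i$, or $\sum a_i=\sum b_i$ and the last non-zero entry of $a-b$ is positive. The order $<_{\mathrm{pbw}}$ is the degree reverse lexicographic order on $\mathbb C[\{z_{i,j}^{(k)}\}]$ given by ordering the $z_{i,j}^{(k)}$ first by $k$ increasingly, then by $i$ increasingly, and for given $k$ and $i$ cyclically in $j$ starting with $j=kp+i\bmod n$, i.e. with $c=(kp+i\bmod n)$, as $z_{i,c}^{(k)},z_{i,c+1}^{(k)},\dots,z_{i,n}^{(k)},z_{i,1}^{(k)},\dots,z_{i,c-1}^{(k)}$. PBW tuples. A tuple $(\alpha_1,\dots,\alpha_p)$ of integers in $[1,n]$ is a PBW tuple if the $\alpha_j$ are pairwise distinct, $\alpha_j\le p$ implies $\alpha_j=j$, and $\alpha_j>\alpha_k>p$ implies $j<k$. $\tilde{\mathcal I}_{\mathrm{pbw}}$ is the set of symbols $I^{(k)}$ with $I=(\alpha_1,\dots,\alpha_p)$ a $p$-tuple in $[1,n]$ and $k\in\mathbb N_0$ such that $(\alpha_1-k\bmod n,\dots,\alpha_p-k\bmod n)$ is a PBW tuple. *)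

theory Defs
  imports
    Complex_Main
    "HOL-Library.FuncSet"
    "HOL-Library.Poly_Mapping"
    "HOL-Computational_Algebra.Formal_Power_Series"
    "Jordan_Normal_Form.Determinant"
begin

section \<open>Complex polynomials and sagbi bases\<close>

text \<open>
  A monomial in variables from \<open>'v\<close> is its finitely supported exponent function;
  a polynomial is a finitely supported assignment of coefficients to monomials, with the
  convolution product of \<^theory>\<open>HOL-Library.Poly_Mapping\<close>.
\<close>

type_synonym 'v monom = "'v \<Rightarrow>\<^sub>0 nat"
type_synonym 'v cpoly = "'v monom \<Rightarrow>\<^sub>0 complex"

definition pvar :: "'v \<Rightarrow> 'v cpoly"
  where "pvar v = Poly_Mapping.single (Poly_Mapping.single v 1) 1"

definition cpoly_scale :: "complex \<Rightarrow> 'v cpoly \<Rightarrow> 'v cpoly"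
  where "cpoly_scale c f = Poly_Mapping.single 0 c * f"

global_interpretation cpoly: vector_space "cpoly_scale :: complex \<Rightarrow> 'v cpoly \<Rightarrow> 'v cpoly"
  by unfold_locales
    (simp_all add: cpoly_scale_def algebra_simps single_add mult_single flip: mult.assoc)

definition is_subalgebra :: "'v cpoly set \<Rightarrow> bool"
  where "is_subalgebra A \<longleftrightarrow>
    cpoly.subspace A \<and> 1 \<in> A \<and> (\<forall>f\<in>A. \<forall>g\<in>A. f * g \<in> A)"

definition generated_algebra :: "'v cpoly set \<Rightarrow> 'v cpoly set"
  where "generated_algebra S = is_subalgebra hull S"

text \<open>
  In the following, \<open>lt m m'\<close> is the strict monomial order, to be read as
  \<open>m < m'\<close>. It only has to be total on the monomials that occur in the polynomials under
  consideration.
\<close>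

definition initial_monom :: "('v monom \<Rightarrow> 'v monom \<Rightarrow> bool) \<Rightarrow> 'v cpoly \<Rightarrow> 'v monom"
  where "initial_monom lt f =
    (THE m. m \<in> Poly_Mapping.keys f \<and> (\<forall>m'\<in>Poly_Mapping.keys f. m' \<noteq> m \<longrightarrow> lt m' m))"

definition initial_term :: "('v monom \<Rightarrow> 'v monom \<Rightarrow> bool) \<Rightarrow> 'v cpoly \<Rightarrow> 'v cpoly"
  where "initial_term lt f =
    (if f = 0 then 0
     else Poly_Mapping.single (initial_monom lt f) (Poly_Mapping.lookup f (initial_monom lt f)))"

definition initial_algebra ::
    "('v monom \<Rightarrow> 'v monom \<Rightarrow> bool) \<Rightarrow> 'v cpoly set \<Rightarrow> 'v cpoly set"
  where "initial_algebra lt A = cpoly.span (initial_term lt ` A)"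

definition sagbi_basis ::
    "('v monom \<Rightarrow> 'v monom \<Rightarrow> bool) \<Rightarrow> 'v cpoly set \<Rightarrow> 'v cpoly set \<Rightarrow> bool"
  where "sagbi_basis lt A S \<longleftrightarrow>
    generated_algebra S = A \<and> generated_algebra (initial_term lt ` S) = initial_algebra lt A"

definition monom_degree :: "'v monom \<Rightarrow> nat"
  where "monom_degree m = (\<Sum>v\<in>Poly_Mapping.keys m. Poly_Mapping.lookup m v)"

text \<open>
  \<open>before v w\<close> says that \<open>v\<close> precedes \<open>w\<close> in the ordering of the variables.  The
  variable \<open>v\<close> below is the last one at which the exponents differ.
\<close>

definition degrevlex :: "('v \<Rightarrow> 'v \<Rightarrow> bool) \<Rightarrow> 'v monom \<Rightarrow> 'v monom \<Rightarrow> bool"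
  where "degrevlex before a b \<longleftrightarrow>
    monom_degree a < monom_degree b \<or>
    monom_degree a = monom_degree b \<and>
      (\<exists>v. Poly_Mapping.lookup a v > Poly_Mapping.lookup b v \<and>
           (\<forall>w. before v w \<longrightarrow> Poly_Mapping.lookup a w = Poly_Mapping.lookup b w))"


section \<open>The semi-infinite Pluecker algebra\<close>

text \<open>
  The triple \<open>(i, j, k)\<close> stands for the variable $z_{i,j}^{(k)}$, with \<open>i\<close> and \<open>j\<close>
  counted from 1.  The index type also contains triples with \<open>i\<close> outside \<open>{1..p}\<close> or
  \<open>j\<close> outside \<open>{1..n}\<close>; they do not occur in any element of the Pluecker algebra.
\<close>

type_synonym zindex = "nat \<times> nat \<times> nat"

definition Z_matrix :: "nat \<Rightarrow> nat \<Rightarrow> zindex cpoly fps mat"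
  where "Z_matrix p n = mat p n (\<lambda>(r, c). Abs_fps (\<lambda>k. pvar (r + 1, c + 1, k)))"

text \<open>
  A \<open>p\<close>-tuple \<open>I\<close> is a function on \<open>{1..p}\<close>.  Rows and columns of a
  \<^typ>\<open>'a mat\<close> are counted from 0.
\<close>

definition Z_minor_matrix :: "nat \<Rightarrow> nat \<Rightarrow> (nat \<Rightarrow> nat) \<Rightarrow> zindex cpoly fps mat"
  where "Z_minor_matrix p n I =
    mat_of_cols p (map (\<lambda>j. col (Z_matrix p n) (I j - 1)) [1..<p + 1])"

definition D :: "nat \<Rightarrow> nat \<Rightarrow> (nat \<Rightarrow> nat) \<Rightarrow> nat \<Rightarrow> zindex cpoly"
  where "D p n I k = fps_nth (det (Z_minor_matrix p n I)) k"

definition tuples :: "nat \<Rightarrow> nat \<Rightarrow> (nat \<Rightarrow> nat) set"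
  where "tuples p n = {1..p} \<rightarrow>\<^sub>E {1..n}"

definition pluecker_algebra :: "nat \<Rightarrow> nat \<Rightarrow> zindex cpoly set"
  where "pluecker_algebra p n = generated_algebra {D p n I k | I k. I \<in> tuples p n}"


section \<open>The PBW order and PBW tuples\<close>

text \<open>The representative of \<open>a\<close> modulo \<open>n\<close> in \<open>{1..n}\<close> (for \<open>n > 0\<close>).\<close>

definition mod1 :: "int \<Rightarrow> nat \<Rightarrow> nat"
  where "mod1 a n = nat ((a - 1) mod int n) + 1"

text \<open>
  The place of \<open>j\<close>, counted from 0, in the list \<open>c, c + 1, \<dots>, n, 1, \<dots>, c - 1\<close>.
\<close>

definition cyclic_pos :: "nat \<Rightarrow> nat \<Rightarrow> nat \<Rightarrow> nat"
  where "cyclic_pos n c j = (if c \<le> j then j - c else j + n - c)"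

definition pbw_before :: "nat \<Rightarrow> nat \<Rightarrow> zindex \<Rightarrow> zindex \<Rightarrow> bool"
  where "pbw_before p n = (\<lambda>(i, j, k) (i', j', k').
    k < k' \<or> k = k' \<and> (i < i' \<or> i = i' \<and>
      (let c = mod1 (int (k * p + i)) n in cyclic_pos n c j < cyclic_pos n c j')))"

definition pbw_less :: "nat \<Rightarrow> nat \<Rightarrow> zindex monom \<Rightarrow> zindex monom \<Rightarrow> bool"
  where "pbw_less p n = degrevlex (pbw_before p n)"

definition pbw_tuple :: "nat \<Rightarrow> nat \<Rightarrow> (nat \<Rightarrow> nat) \<Rightarrow> bool"
  where "pbw_tuple p n \<alpha> \<longleftrightarrow>
    (\<forall>j\<in>{1..p}. \<alpha> j \<in> {1..n}) \<and>
    inj_on \<alpha> {1..p} \<and>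
    (\<forall>j\<in>{1..p}. \<alpha> j \<le> p \<longrightarrow> \<alpha> j = j) \<and>
    (\<forall>j\<in>{1..p}. \<forall>k\<in>{1..p}. \<alpha> j > \<alpha> k \<and> \<alpha> k > p \<longrightarrow> j < k)"

definition pbw_symbols :: "nat \<Rightarrow> nat \<Rightarrow> ((nat \<Rightarrow> nat) \<times> nat) set"
  where "pbw_symbols p n =
    {(I, k). I \<in> tuples p n \<and> pbw_tuple p n (\<lambda>j. mod1 (int (I j) - int k) n)}"

end

theory Submission
  imports Defs
begin

text \<open>
  Write a symbol as a pair \<open>(A, k)\<close> of a \<open>p\<close>-subset of \<open>{1..n}\<close> and a level. Symbols form a
  distributive lattice: extending the increasing enumeration of \<open>A\<close> by
  \<open>a (i + p) = a i + n\<close> and shifting it by \<open>k\<close>, they are compared pointwise. Exchange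
  relations straighten every product of the \<open>D\<close> into a combination of products over chains with
  the same number of factors and the same total level.

  The initial monomials of the PBW generators are the antichains of maximal elements of the order
  ideals in this lattice. The largest ideal of a chain is generated by the union of all the
  antichains of the chain, so it can be read off the product of their monomials; peeling it off
  repeatedly recovers the chain. Hence the products of PBW generators indexed by chains have
  pairwise distinct initial monomials. They are linearly independent and equally many as the chains,
  so in each degree they form a basis of the Pluecker algebra, which computes its initial algebra.
\<close>

section \<open>Spans, generated algebras and leading monomials\<close>

text \<open>A symbol \<open>(A, k)\<close> is best seen as the staircase x |-> k + p -
  \<open>count_le A x\<close>, which falls from k + p at x = 0 to k at x = n in steps of at most 1.
  The lattice order is the pointwise order of staircases, and a point (r, d) lies under the
  staircase of \<open>(B, l)\<close> iff \<open>count_le B d\<close> + r \<le> l + p. As the steps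
  are at most 1, a staircase above the corner of the first element of a run of consecutive numbers
  is above the corners of the whole run. So only elements a of A with a - 1 outside A yield maximal
  elements; such a corner, at height r, becomes the variable in row r at offset a - 1.

  The obstacle in straightening is that a coefficient of a product of two series mixes all
  distributions of the total level. An incomparable pair of levels k \<le> l offers at least l - k
  more exchangeable columns than the p + 1 that a Pluecker relation consumes. Each extra column pays
  for one factor of a differential operator, and each factor removes one unwanted level.\<close>

lemma cpoly_scale_mult_left: "cpoly_scale c f * g = cpoly_scale c (f * g)"
  by (simp add: cpoly_scale_def mult.assoc)

lemma cpoly_scale_mult_right: "f * cpoly_scale c g = cpoly_scale c (f * g)"
  by (simp add: cpoly_scale_def mult.left_commute)

lemma lookup_cpoly_scale:
  "Poly_Mapping.lookup (cpoly_scale c f) m = c * Poly_Mapping.lookup f m"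
proof -
  have "cpoly_scale c f = Poly_Mapping.map ((*) c) f"
    by (simp add: cpoly_scale_def mult_map_scale_conv_mult)
  then show ?thesis
    by (simp add: Poly_Mapping.map.rep_eq when_def)
qed

lemma cpoly_scale_single: "cpoly_scale c (Poly_Mapping.single m a) = Poly_Mapping.single m (c * a)"
  by (simp add: cpoly_scale_def mult_single)

lemma cpoly_scale_of_int: "cpoly_scale (of_int z) f = of_int z * f"
  by (simp add: cpoly_scale_def)

lemma span_of_int_mult:
  "f \<in> cpoly.span X \<Longrightarrow> of_int z * f \<in> cpoly.span X"
  by (metis cpoly.span_scale cpoly_scale_of_int)

lemma cpoly_span_mult:
  assumes "f \<in> cpoly.span X" "g \<in> cpoly.span Y"
    and "\<And>x y. x \<in> X \<Longrightarrow> y \<in> Y \<Longrightarrow> x * y \<in> cpoly.span W"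
  shows "f * g \<in> cpoly.span W"
proof -
  have left: "f * y \<in> cpoly.span W" if "y \<in> Y" for y
    using assms(1)
  proof (induction rule: cpoly.span_induct_alt)
    case base
    show ?case by (simp add: cpoly.span_zero)
  next
    case (step c x z)
    then show ?case
      using assms(3)[OF step(1) that]
      by (simp add: distrib_right cpoly_scale_mult_left cpoly.span_add cpoly.span_scale)
  qed
  show ?thesis
    using assms(2)
  proof (induction rule: cpoly.span_induct_alt)
    case base
    show ?case by (simp add: cpoly.span_zero)
  next
    case (step c x z)
    then show ?case
      using left[OF step(1)]
      by (simp add: distrib_left cpoly_scale_mult_right cpoly.span_add cpoly.span_scale)
  qed
qed

section \<open>Subalgebras and spans of products\<close>

lemma is_subalgebra_Inter: "\<forall>A\<in>\<A>. is_subalgebra A \<Longrightarrow> is_subalgebra (\<Inter>\<A>)"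
  by (auto simp: is_subalgebra_def intro: cpoly.subspace_Inter)

lemma is_subalgebra_generated: "is_subalgebra (generated_algebra S)"
  unfolding generated_algebra_def by (rule hull_in) (simp add: is_subalgebra_Inter)

lemma subset_generated: "S \<subseteq> generated_algebra S"
  unfolding generated_algebra_def by (rule hull_subset)

lemma generated_subset: "S \<subseteq> A \<Longrightarrow> is_subalgebra A \<Longrightarrow> generated_algebra S \<subseteq> A"
  unfolding generated_algebra_def by (rule hull_minimal)

lemma span_subset_subalgebra: "is_subalgebra A \<Longrightarrow> X \<subseteq> A \<Longrightarrow> cpoly.span X \<subseteq> A"
  by (auto simp: is_subalgebra_def cpoly.span_minimal)

lemma subalgebra_prod_mset:
  assumes "is_subalgebra A" "\<And>x. x \<in># w \<Longrightarrow> F x \<in> A"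
  shows "(\<Prod>x\<in>#w. F x) \<in> A"
  using assms(2) by (induction w) (use assms(1) in \<open>auto simp: is_subalgebra_def\<close>)

lemma generated_algebra_eq_span:
  "generated_algebra (F ` T) = cpoly.span ((\<lambda>w. \<Prod>x\<in>#w. F x) ` {w. set_mset w \<subseteq> T})"
    (is "_ = cpoly.span ?X")
proof
  have "is_subalgebra (cpoly.span ?X)"
    unfolding is_subalgebra_def
  proof (intro conjI ballI)
    show "1 \<in> cpoly.span ?X"
      by (rule cpoly.span_base) (rule image_eqI[of _ _ "{#}"], auto)
    fix f g
    assume "f \<in> cpoly.span ?X" "g \<in> cpoly.span ?X"
    then show "f * g \<in> cpoly.span ?X"
    proof (rule cpoly_span_mult)
      fix x y
      assume "x \<in> ?X" "y \<in> ?X"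
      then obtain v w where "x = (\<Prod>x\<in>#v. F x)" "y = (\<Prod>x\<in>#w. F x)"
        "set_mset v \<subseteq> T" "set_mset w \<subseteq> T"
        by auto
      then show "x * y \<in> cpoly.span ?X"
        by (intro cpoly.span_base image_eqI[of _ _ "v + w"]) auto
    qed
  qed simp
  moreover have "F ` T \<subseteq> cpoly.span ?X"
  proof
    fix y
    assume "y \<in> F ` T"
    then obtain x where "x \<in> T" "y = F x"
      by auto
    then show "y \<in> cpoly.span ?X"
      by (intro cpoly.span_base image_eqI[of _ _ "{#x#}"]) auto
  qed
  ultimately show "generated_algebra (F ` T) \<subseteq> cpoly.span ?X"
    by (rule generated_subset[rotated])
  have "?X \<subseteq> generated_algebra (F ` T)"
    using subset_generated[of "F ` T"]
    by (auto intro!: subalgebra_prod_mset is_subalgebra_generated)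
  then show "cpoly.span ?X \<subseteq> generated_algebra (F ` T)"
    by (intro span_subset_subalgebra is_subalgebra_generated)
qed

text \<open>Dimension count: the span of \<open>C\<close> has dimension at most
  \<open>card C\<close>, so an independent set of that size inside it is already a basis. This takes
  the place of an explicit expansion of standard products into PBW products.\<close>

lemma span_eq_if_independent_card:
  assumes "finite C" "cpoly.independent B" "B \<subseteq> cpoly.span C" "card C \<le> card B"
  shows "C \<subseteq> cpoly.span B"
proof
  fix c
  assume c: "c \<in> C"
  have fB: "finite B"
    using cpoly.independent_span_bound[OF assms(1,2,3)] by simp
  show "c \<in> cpoly.span B"
  proof (rule ccontr)
    assume nc: "c \<notin> cpoly.span B"
    then have "cpoly.independent (insert c B)"
      using assms(2) by (rule cpoly.independent_insertI)
    moreover have "insert c B \<subseteq> cpoly.span C"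
      using assms(3) c cpoly.span_base by auto
    ultimately have "card (insert c B) \<le> card C"
      using cpoly.independent_span_bound[OF assms(1)] by blast
    moreover have "c \<notin> B"
      using nc cpoly.span_base by auto
    ultimately show False
      using fB assms(4) by simp
  qed
qed

section \<open>Leading monomials\<close>

lemma in_keys_multE:
  assumes "a \<in> Poly_Mapping.keys (f * g)"
  obtains b c where "a = b + c" "b \<in> Poly_Mapping.keys f" "c \<in> Poly_Mapping.keys g"
  using subsetD[OF keys_mult assms] by blast

lemma in_keys_addE:
  assumes "a \<in> Poly_Mapping.keys (f + g)"
  obtains "a \<in> Poly_Mapping.keys f" | "a \<in> Poly_Mapping.keys g"
  using subsetD[OF Poly_Mapping.keys_add assms] by blast

text \<open>Transitivity and totality are relative to \<open>M\<close>, because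
  \<open>pbw_before\<close> need not separate triples that lie outside the grid of actual
  variables.\<close>

locale monomial_order =
  fixes lt :: "'v monom \<Rightarrow> 'v monom \<Rightarrow> bool" and M :: "'v monom set"
  assumes irrefl: "\<not> lt a a"
    and trans: "a \<in> M \<Longrightarrow> b \<in> M \<Longrightarrow> c \<in> M \<Longrightarrow> lt a b \<Longrightarrow> lt b c \<Longrightarrow> lt a c"
    and total: "a \<in> M \<Longrightarrow> b \<in> M \<Longrightarrow> a \<noteq> b \<Longrightarrow> lt a b \<or> lt b a"
    and add_mono: "lt a b \<Longrightarrow> lt (a + c) (b + c)"
    and zero_closed: "0 \<in> M"
    and add_closed: "a \<in> M \<Longrightarrow> b \<in> M \<Longrightarrow> a + b \<in> M"
begin

definition lead :: "'v cpoly \<Rightarrow> 'v monom \<Rightarrow> bool" where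
  "lead f m \<longleftrightarrow> Poly_Mapping.keys f \<subseteq> M \<and> m \<in> Poly_Mapping.keys f \<and>
    (\<forall>m'\<in>Poly_Mapping.keys f. m' \<noteq> m \<longrightarrow> lt m' m)"

lemma lead_in_M: "lead f m \<Longrightarrow> m \<in> M"
  by (auto simp: lead_def)

lemma lead_lookup: "lead f m \<Longrightarrow> Poly_Mapping.lookup f m \<noteq> 0"
  by (simp add: lead_def in_keys_iff)

lemma lead_nonzero: "lead f m \<Longrightarrow> f \<noteq> 0"
  using lead_lookup by fastforce

lemma lead_unique: "lead f m \<Longrightarrow> lead f m' \<Longrightarrow> m = m'"
  unfolding lead_def by (metis irrefl subsetD trans)

lemma initial_term_lead:
  assumes "lead f m"
  shows "initial_term lt f = Poly_Mapping.single m (Poly_Mapping.lookup f m)"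
proof -
  have "initial_monom lt f = m"
    unfolding initial_monom_def
    by (rule the_equality) (use assms lead_unique in \<open>auto simp: lead_def\<close>)
  then show ?thesis
    using lead_nonzero[OF assms] by (simp add: initial_term_def)
qed

lemma lead_one: "lead 1 0"
  by (simp add: lead_def zero_closed)

lemma add_strict_mono:
  assumes "a \<in> M" "b \<in> M" "c \<in> M" "d \<in> M" "lt a b" "lt c d"
  shows "lt (a + c) (b + d)"
  using add_mono[OF assms(5), of c] add_mono[OF assms(6), of b] assms
  by (metis add.commute add_closed trans)

lemma lead_mult:
  assumes "lead f m" "lead g m'"
  shows "lead (f * g) (m + m')" (is ?lead)
    and "Poly_Mapping.lookup (f * g) (m + m') = Poly_Mapping.lookup f m * Poly_Mapping.lookup g m'" (is ?coeff)
proof -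
  define f1 where "f1 = f - Poly_Mapping.single m (Poly_Mapping.lookup f m)"
  define g1 where "g1 = g - Poly_Mapping.single m' (Poly_Mapping.lookup g m')"
  have f1: "a \<in> M \<and> lt a m" if "a \<in> Poly_Mapping.keys f1" for a
    using that assms(1)
    by (cases "a = m") (auto simp: f1_def lead_def in_keys_iff lookup_minus lookup_single_not_eq subset_iff)
  have g1: "a \<in> M \<and> lt a m'" if "a \<in> Poly_Mapping.keys g1" for a
    using that assms(2)
    by (cases "a = m'") (auto simp: g1_def lead_def in_keys_iff lookup_minus lookup_single_not_eq subset_iff)
  note mM = lead_in_M[OF assms(1)] lead_in_M[OF assms(2)]
  define r where "r = Poly_Mapping.single m (Poly_Mapping.lookup f m) * g1
    + f1 * Poly_Mapping.single m' (Poly_Mapping.lookup g m') + f1 * g1"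
  have eq: "f * g = Poly_Mapping.single (m + m') (Poly_Mapping.lookup f m * Poly_Mapping.lookup g m') + r"
    by (simp add: r_def f1_def g1_def algebra_simps mult_single)
  have r: "a \<in> M \<and> lt a (m + m')" if a: "a \<in> Poly_Mapping.keys r" for a
  proof -
    consider "a \<in> Poly_Mapping.keys (Poly_Mapping.single m (Poly_Mapping.lookup f m) * g1)"
      | "a \<in> Poly_Mapping.keys (f1 * Poly_Mapping.single m' (Poly_Mapping.lookup g m'))"
      | "a \<in> Poly_Mapping.keys (f1 * g1)"
      using a unfolding r_def by (elim in_keys_addE) auto
    then show ?thesis
    proof cases
      case 1
      then obtain b c where "a = b + c" "b = m" "c \<in> Poly_Mapping.keys g1"
        by (elim in_keys_multE) (simp split: if_splits)
      then show ?thesis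
        using g1 mM add_mono[of c m' m] add_closed by (auto simp: add.commute)
    next
      case 2
      then obtain b c where "a = b + c" "b \<in> Poly_Mapping.keys f1" "c = m'"
        by (elim in_keys_multE) (simp split: if_splits)
      then show ?thesis
        using f1 mM add_mono[of b m m'] add_closed by auto
    next
      case 3
      then obtain b c where "a = b + c" "b \<in> Poly_Mapping.keys f1" "c \<in> Poly_Mapping.keys g1"
        by (elim in_keys_multE)
      then show ?thesis
        using f1 g1 mM add_strict_mono add_closed by auto
    qed
  qed
  then have "Poly_Mapping.lookup r (m + m') = 0"
    using irrefl by (metis in_keys_iff)
  then show c: ?coeff
    by (simp add: eq lookup_add)
  have "Poly_Mapping.keys (f * g) \<subseteq> insert (m + m') (Poly_Mapping.keys r)"
  proof
    fix a
    assume "a \<in> Poly_Mapping.keys (f * g)"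
    then show "a \<in> insert (m + m') (Poly_Mapping.keys r)"
      unfolding eq by (elim in_keys_addE) (auto split: if_splits)
  qed
  then show ?lead
    unfolding lead_def
    using r c lead_lookup[OF assms(1)] lead_lookup[OF assms(2)] mM add_closed
    by (auto simp: in_keys_iff)
qed

lemma initial_term_mult:
  assumes "lead f m" "lead g m'"
  shows "initial_term lt (f * g) = initial_term lt f * initial_term lt g"
  by (simp add: initial_term_lead[OF assms(1)] initial_term_lead[OF assms(2)]
      initial_term_lead[OF lead_mult(1)[OF assms]] lead_mult(2)[OF assms] mult_single)

lemma lead_prod_mset:
  assumes "\<And>x. x \<in># w \<Longrightarrow> lead (F x) (\<mu> x)"
  shows "lead (\<Prod>x\<in>#w. F x) (\<Sum>x\<in>#w. \<mu> x)"
  using assms by (induction w) (auto simp: lead_one lead_mult)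

lemma lead_scale:
  assumes "lead f m" "c \<noteq> 0"
  shows "lead (cpoly_scale c f) m"
  using assms by (auto simp: lead_def in_keys_iff lookup_cpoly_scale subset_iff)

lemma lead_add:
  assumes "lead f m" "lead g m'" "lt m m'"
  shows "lead (f + g) m'"
proof -
  have keys_f: "a \<in> M \<and> lt a m'" if "a \<in> Poly_Mapping.keys f" for a
    using that assms(1,3) trans[of a m m'] lead_in_M[OF assms(1)] lead_in_M[OF assms(2)]
    unfolding lead_def by (cases "a = m") auto
  then have "m' \<notin> Poly_Mapping.keys f"
    using irrefl by blast
  then show ?thesis
    using assms(1,2) keys_f Poly_Mapping.keys_add[of f g] unfolding lead_def
    by (auto simp: in_keys_iff lookup_add subset_iff)
qed

text \<open>Distinct leading monomials cannot cancel, so the largest of them survives.\<close>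

lemma lead_sum:
  assumes "finite W" "W \<noteq> {}" "inj_on \<mu> W"
    and "\<And>w. w \<in> W \<Longrightarrow> lead (E w) (\<mu> w)" "\<And>w. w \<in> W \<Longrightarrow> c w \<noteq> 0"
  shows "\<exists>w\<in>W. lead (\<Sum>w\<in>W. cpoly_scale (c w) (E w)) (\<mu> w)"
  using assms
proof (induction W rule: finite_ne_induct)
  case (singleton x)
  then show ?case by (auto intro: lead_scale)
next
  case (insert x W)
  let ?f = "cpoly_scale (c x) (E x)" and ?g = "\<Sum>w\<in>W. cpoly_scale (c w) (E w)"
  obtain w where w: "w \<in> W" "lead ?g (\<mu> w)"
    using insert by (auto simp: inj_on_def)
  have x: "lead ?f (\<mu> x)"
    using insert by (auto intro: lead_scale)
  have "\<mu> x \<noteq> \<mu> w"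
    using insert w(1) by (auto simp: inj_on_def)
  then consider "lt (\<mu> x) (\<mu> w)" | "lt (\<mu> w) (\<mu> x)"
    using total lead_in_M w(2) x by blast
  then show ?case
  proof cases
    case 1
    then have "lead (?f + ?g) (\<mu> w)"
      using lead_add[OF x w(2)] by blast
    then show ?thesis
      using insert w by auto
  next
    case 2
    then have "lead (?f + ?g) (\<mu> x)"
      using lead_add[OF w(2) x] by (simp add: add.commute)
    then show ?thesis
      using insert w by auto
  qed
qed

lemma independent_if_distinct_leads:
  assumes "finite W" "inj_on \<mu> W" "\<And>w. w \<in> W \<Longrightarrow> lead (E w) (\<mu> w)"
  shows "inj_on E W" "cpoly.independent (E ` W)"
proof -
  show inj: "inj_on E W"
    using assms(2,3) lead_unique unfolding inj_on_def by metis
  have zero: "c w = 0" if "(\<Sum>w\<in>W. cpoly_scale (c w) (E w)) = 0" "w \<in> W" for c w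
  proof (rule ccontr)
    assume cw: "c w \<noteq> 0"
    define W' where "W' = {w\<in>W. c w \<noteq> 0}"
    have "(\<Sum>w\<in>W'. cpoly_scale (c w) (E w)) = (\<Sum>w\<in>W. cpoly_scale (c w) (E w))"
      by (rule sum.mono_neutral_left) (use assms(1) in \<open>auto simp: W'_def\<close>)
    then have "(\<Sum>w\<in>W'. cpoly_scale (c w) (E w)) = 0"
      using that by simp
    moreover have "\<exists>w\<in>W'. lead (\<Sum>w\<in>W'. cpoly_scale (c w) (E w)) (\<mu> w)"
      by (rule lead_sum)
        (use assms that(2) cw in \<open>auto simp: W'_def inj_on_def\<close>)
    ultimately show False
      using lead_nonzero by auto
  qed
  show "cpoly.independent (E ` W)"
  proof (rule cpoly.independent_if_scalars_zero)
    fix u x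
    assume "(\<Sum>x\<in>E ` W. cpoly_scale (u x) x) = 0" "x \<in> E ` W"
    then show "u x = 0"
      using zero[of "u \<circ> E"] inj by (auto simp: sum.reindex)
  qed (use assms(1) in simp)
qed

text \<open>By \<open>lead_sum\<close> every nonzero element of \<open>A\<close> takes its leading
  monomial from a product over \<open>W\<close>. Its initial term is then a scalar multiple of a
  product of initial terms of generators.\<close>

lemma sagbi_basis_if_spanning_leads:
  fixes G :: "'s \<Rightarrow> 'v cpoly" and \<gamma> :: "'s \<Rightarrow> 'v monom"
  assumes lead: "\<And>s. s \<in> T \<Longrightarrow> lead (G s) (\<gamma> s)"
    and sub: "G ` T \<subseteq> A" and alg: "is_subalgebra A"
    and W: "\<And>w. w \<in> W \<Longrightarrow> set_mset w \<subseteq> T"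
    and inj: "inj_on (\<lambda>w. \<Sum>s\<in>#w. \<gamma> s) W"
    and span: "A \<subseteq> cpoly.span ((\<lambda>w. \<Prod>s\<in>#w. G s) ` W)"
  shows "sagbi_basis lt A (G ` T)"
proof -
  let ?E = "\<lambda>w. \<Prod>s\<in>#w. G s" and ?\<mu> = "\<lambda>w. \<Sum>s\<in>#w. \<gamma> s"
  have leadE: "lead (?E w) (?\<mu> w)" if "w \<in> W" for w
    using W[OF that] by (intro lead_prod_mset lead) auto
  have leadA: "f = 0 \<or> (\<exists>w\<in>W. lead f (?\<mu> w))" if "f \<in> A" for f
  proof (cases "f = 0")
    case False
    have "f \<in> cpoly.span (?E ` W)"
      using span that by auto
    then obtain S u where S: "finite S" "S \<subseteq> ?E ` W" and f: "f = (\<Sum>a\<in>S. cpoly_scale (u a) a)"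
      unfolding cpoly.span_explicit by blast
    obtain W0 where W0: "finite W0" "W0 \<subseteq> W" "S = ?E ` W0"
      using finite_subset_image[OF S] by auto
    have injE: "inj_on ?E W0"
      by (rule independent_if_distinct_leads(1)[OF W0(1), of ?\<mu>])
        (use W0 inj leadE in \<open>auto intro: inj_on_subset\<close>)
    define W1 where "W1 = {w\<in>W0. u (?E w) \<noteq> 0}"
    have "f = (\<Sum>w\<in>W0. cpoly_scale (u (?E w)) (?E w))"
      unfolding f W0(3) using sum.reindex[OF injE] by simp
    also have "\<dots> = (\<Sum>w\<in>W1. cpoly_scale (u (?E w)) (?E w))"
      by (rule sum.mono_neutral_right) (use W0 in \<open>auto simp: W1_def\<close>)
    finally have f1: "f = (\<Sum>w\<in>W1. cpoly_scale (u (?E w)) (?E w))" .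
    have W1: "finite W1" "W1 \<subseteq> W"
      using W0 by (auto simp: W1_def)
    have "W1 \<noteq> {}"
    proof
      assume "W1 = {}"
      with f1 show False
        using False by (simp only: sum.empty)
    qed
    have "\<exists>w\<in>W1. lead (\<Sum>w\<in>W1. cpoly_scale (u (?E w)) (?E w)) (?\<mu> w)"
    proof (rule lead_sum[OF W1(1) \<open>W1 \<noteq> {}\<close> inj_on_subset[OF inj W1(2)]])
      fix w
      assume "w \<in> W1"
      then show "lead (?E w) (?\<mu> w)" "u (?E w) \<noteq> 0"
        using leadE W1(2) by (auto simp only: W1_def mem_Collect_eq)
    qed
    then have "\<exists>w\<in>W1. lead f (?\<mu> w)"
      by (simp only: f1[symmetric])
    then show ?thesis
      using W1(2) by blast
  qed simp
  have subE: "?E ` W \<subseteq> generated_algebra (G ` T)"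
    using W subset_generated[of "G ` T"]
    by (intro image_subsetI subalgebra_prod_mset is_subalgebra_generated) blast
  have gen: "generated_algebra (G ` T) = A"
    using span span_subset_subalgebra[OF is_subalgebra_generated subE] generated_subset[OF sub alg]
    by blast
  let ?I = "initial_term lt"
  have "is_subalgebra (cpoly.span (?I ` A))"
    unfolding is_subalgebra_def
  proof (intro conjI ballI)
    have "1 \<in> A"
      using alg by (simp add: is_subalgebra_def)
    moreover have "?I 1 = 1"
      using initial_term_lead[OF lead_one] by simp
    ultimately show "1 \<in> cpoly.span (?I ` A)"
      by (metis cpoly.span_base imageI)
    fix f g
    assume "f \<in> cpoly.span (?I ` A)" "g \<in> cpoly.span (?I ` A)"
    then show "f * g \<in> cpoly.span (?I ` A)"
    proof (rule cpoly_span_mult)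
      fix x y
      assume "x \<in> ?I ` A" "y \<in> ?I ` A"
      then obtain f g where fg: "x = ?I f" "y = ?I g" "f \<in> A" "g \<in> A"
        by auto
      show "x * y \<in> cpoly.span (?I ` A)"
      proof (cases "f = 0 \<or> g = 0")
        case True
        then have "x * y = 0"
          using fg by (auto simp: initial_term_def)
        then show ?thesis
          by (simp add: cpoly.span_zero)
      next
        case False
        then have "x * y = ?I (f * g)"
          using leadA fg initial_term_mult by metis
        moreover have "f * g \<in> A"
          using alg fg by (auto simp: is_subalgebra_def)
        ultimately show ?thesis
          by (auto intro: cpoly.span_base)
      qed
    qed
  qed simp
  then have "generated_algebra (?I ` G ` T) \<subseteq> cpoly.span (?I ` A)"
    using sub by (intro generated_subset) (auto intro!: cpoly.span_base)
  moreover have "cpoly.span (?I ` A) \<subseteq> generated_algebra (?I ` G ` T)"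
  proof (rule span_subset_subalgebra[OF is_subalgebra_generated], rule image_subsetI)
    fix f
    assume "f \<in> A"
    then consider "f = 0" | w where "w \<in> W" "lead f (?\<mu> w)"
      using leadA by blast
    then show "?I f \<in> generated_algebra (?I ` G ` T)"
    proof cases
      case 1
      then have "?I f = 0"
        by (simp add: initial_term_def)
      then show ?thesis
        using is_subalgebra_generated[of "?I ` G ` T"]
        by (simp only: is_subalgebra_def cpoly.subspace_0)
    next
      case 2
      have "(\<Prod>s\<in>#w. ?I (G s)) \<in> generated_algebra (?I ` G ` T)"
        using W[OF 2(1)] subset_generated[of "?I ` G ` T"]
        by (intro subalgebra_prod_mset is_subalgebra_generated) blast
      \<comment> \<open>\<open>c\<close> is a product of leading coefficients; it is divided out
        below.\<close>
      moreover have "\<exists>c. c \<noteq> 0 \<and> (\<Prod>s\<in>#w. ?I (G s)) = Poly_Mapping.single (?\<mu> w) c"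
        using W[OF 2(1)]
      proof (induction w)
        case empty
        then show ?case
          by (intro exI[of _ 1]) simp
      next
        case (add s w)
        then obtain c where "c \<noteq> 0" "(\<Prod>s\<in>#w. ?I (G s)) = Poly_Mapping.single (?\<mu> w) c"
          by auto
        then show ?case
          using initial_term_lead[OF lead, of s] lead_lookup[OF lead, of s] add(2)
          by (intro exI[of _ "Poly_Mapping.lookup (G s) (\<gamma> s) * c"]) (auto simp: mult_single)
      qed
      then obtain c where "c \<noteq> 0" "(\<Prod>s\<in>#w. ?I (G s)) = Poly_Mapping.single (?\<mu> w) c"
        by blast
      moreover have "?I f = cpoly_scale (Poly_Mapping.lookup f (?\<mu> w) / c) (Poly_Mapping.single (?\<mu> w) c)"
        using initial_term_lead[OF 2(2)] \<open>c \<noteq> 0\<close> by (simp add: cpoly_scale_single)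
      ultimately show ?thesis
        using is_subalgebra_generated[of "?I ` G ` T"]
        by (simp only: is_subalgebra_def cpoly.subspace_scale)
    qed
  qed
  ultimately show ?thesis
    unfolding sagbi_basis_def initial_algebra_def using gen by blast
qed

end

section \<open>An exchange relation for determinants of power series\<close>

text \<open>The operator \<open>\<Prod>c\<leftarrow>cs. (t d/dt - c)\<close>.\<close>

definition theta_shift :: "int list \<Rightarrow> 'a::comm_ring_1 fps \<Rightarrow> 'a fps" where
  "theta_shift cs f = Abs_fps (\<lambda>k. of_int (\<Prod>c\<leftarrow>cs. int k - c) * fps_nth f k)"

lemma theta_shift_nth: "fps_nth (theta_shift cs f) k = of_int (\<Prod>c\<leftarrow>cs. int k - c) * fps_nth f k"
  by (simp add: theta_shift_def)

lemma theta_shift_Nil: "theta_shift [] f = f"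
  by (simp add: fps_eq_iff theta_shift_nth)

lemma theta_shift_Cons: "theta_shift (c # cs) f = theta_shift cs (theta_shift [c] f)"
  by (simp add: fps_eq_iff theta_shift_nth mult_ac)

lemma theta_shift_add: "theta_shift cs (f + g) = theta_shift cs f + theta_shift cs g"
  by (simp add: fps_eq_iff theta_shift_nth distrib_left)

lemma theta_shift_zero: "theta_shift cs 0 = 0"
  by (simp add: fps_eq_iff theta_shift_nth)

lemma theta_shift_sum: "theta_shift cs (sum f A) = (\<Sum>x\<in>A. theta_shift cs (f x))"
  by (induction A rule: infinite_finite_induct) (simp_all add: theta_shift_zero theta_shift_add)

lemma theta_shift_single: "theta_shift [c] f = fps_X * fps_deriv f - of_int c * f"
proof -
  have "fps_nth (of_int c * f) k = of_int c * fps_nth f k" for k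
    by (simp flip: fps_of_int)
  moreover have "fps_nth (fps_X * fps_deriv f) k = of_nat k * fps_nth f k" for k
    by (cases k) simp_all
  ultimately show ?thesis
    by (simp add: fps_eq_iff theta_shift_nth left_diff_distrib)
qed

lemma fps_X_deriv_prod:
  fixes u :: "'i \<Rightarrow> 'a::comm_ring_1 fps"
  assumes "finite J"
  shows "fps_X * fps_deriv (\<Prod>i\<in>J. u i) =
    (\<Sum>j\<in>J. \<Prod>i\<in>J. if i = j then fps_X * fps_deriv (u i) else u i)"
  using assms
proof (induction J)
  case (insert x J)
  let ?F = "\<lambda>j i. if i = j then fps_X * fps_deriv (u i) else u i"
  have "(\<Sum>j\<in>J. \<Prod>i\<in>insert x J. ?F j i) = u x * (\<Sum>j\<in>J. \<Prod>i\<in>J. ?F j i)"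
    unfolding sum_distrib_left by (rule sum.cong) (use insert in auto)
  moreover have "(\<Prod>i\<in>J. ?F x i) = prod u J"
    by (rule prod.cong) (use insert in auto)
  then have "(\<Prod>i\<in>insert x J. ?F x i) = fps_X * fps_deriv (u x) * prod u J"
    using insert by simp
  moreover have "fps_X * fps_deriv (prod u (insert x J))
      = fps_X * fps_deriv (u x) * prod u J + u x * (fps_X * fps_deriv (prod u J))"
    using insert(1,2) by (simp add: algebra_simps)
  ultimately show ?case
    by (simp only: sum.insert[OF insert(1,2)] insert.IH)
qed simp

text \<open>Leibniz rule for the derivation t d/dt. The scalar \<open>c\<close> is absorbed by the
  term that differentiates \<open>f\<close>, so every other term differentiates exactly one factor
  \<open>u i\<close>.\<close>

lemma theta_shift_single_mult_prod:
  fixes u :: "'i \<Rightarrow> 'a::comm_ring_1 fps"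
  assumes "finite J"
  shows "theta_shift [c] (f * (\<Prod>i\<in>J. u i)) = theta_shift [c] f * (\<Prod>i\<in>J. u i) +
    (\<Sum>j\<in>J. f * (\<Prod>i\<in>J. if i = j then fps_X * fps_deriv (u i) else u i))"
proof -
  have "fps_X * fps_deriv (f * prod u J) = fps_X * fps_deriv f * prod u J + f * (fps_X * fps_deriv (prod u J))"
    by (simp add: algebra_simps)
  then show ?thesis
    unfolding theta_shift_single fps_X_deriv_prod[OF assms] sum_distrib_left[symmetric]
    by (simp add: algebra_simps)
qed

section \<open>Determinants with coinciding rows\<close>

lemma sum_permutations_identical_rows:
  fixes M :: "nat \<Rightarrow> nat \<Rightarrow> 'a::comm_ring_1"
  assumes "i < N" "j < N" "i \<noteq> j" "M i = M j"
  shows "(\<Sum>\<sigma> | \<sigma> permutes {0..<N}. signof \<sigma> * (\<Prod>k=0..<N. M k (\<sigma> k))) = 0"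
proof -
  let ?A = "mat N N (\<lambda>(i, j). M i j)"
  have "det ?A = (\<Sum>\<sigma> | \<sigma> permutes {0..<N}. signof \<sigma> * (\<Prod>k=0..<N. M k (\<sigma> k)))"
    by (auto simp: det_def permutes_in_image intro!: sum.cong prod.cong)
  moreover have "det ?A = 0"
    by (rule det_identical_rows[of _ N i j]) (use assms in \<open>auto simp: row_def\<close>)
  ultimately show ?thesis
    by simp
qed

text \<open>
  Each operator in \<open>cs\<close> alters at most one of the first \<open>N1\<close> rows, so that two equal rows
  survive in every term of the Leibniz rule.
\<close>

lemma sum_permutations_theta_shift:
  fixes u w :: "nat \<Rightarrow> nat \<Rightarrow> 'a::comm_ring_1 fps"
  assumes "N1 \<le> N" "length cs < card {j\<in>{0..<N1}. \<exists>j'\<in>{N1..<N}. u j = w j'}"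
  shows "(\<Sum>\<sigma> | \<sigma> permutes {0..<N}. signof \<sigma> *
    (theta_shift cs (f * (\<Prod>j=0..<N1. u j (\<sigma> j))) * (\<Prod>j=N1..<N. w j (\<sigma> j)))) = 0"
  using assms(2)
proof (induction cs arbitrary: f u)
  case Nil
  then have "{j\<in>{0..<N1}. \<exists>j'\<in>{N1..<N}. u j = w j'} \<noteq> {}"
    by (metis card.empty less_nat_zero_code)
  then obtain j j' where j: "j < N1" "N1 \<le> j'" "j' < N" "u j = w j'"
    by auto
  define M where "M k = (if k < N1 then u k else w k)" for k
  have "(\<Sum>\<sigma> | \<sigma> permutes {0..<N}. signof \<sigma> * (\<Prod>k=0..<N. M k (\<sigma> k))) = 0"
    by (rule sum_permutations_identical_rows[of j _ j']) (use j in \<open>auto simp: M_def\<close>)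
  moreover have "(\<Prod>k=0..<N. M k (\<sigma> k)) = (\<Prod>j=0..<N1. u j (\<sigma> j)) * (\<Prod>j=N1..<N. w j (\<sigma> j))" for \<sigma>
  proof -
    have "(\<Prod>k=0..<N. M k (\<sigma> k)) = (\<Prod>k=0..<N1. M k (\<sigma> k)) * (\<Prod>k=N1..<N. M k (\<sigma> k))"
      by (rule prod.atLeastLessThan_concat[symmetric]) (use assms(1) in auto)
    also have "(\<Prod>k=0..<N1. M k (\<sigma> k)) = (\<Prod>j=0..<N1. u j (\<sigma> j))"
      by (rule prod.cong) (auto simp: M_def)
    also have "(\<Prod>k=N1..<N. M k (\<sigma> k)) = (\<Prod>j=N1..<N. w j (\<sigma> j))"
      by (rule prod.cong) (auto simp: M_def)
    finally show ?thesis .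
  qed
  ultimately have "(\<Sum>\<sigma> | \<sigma> permutes {0..<N}. signof \<sigma> *
      ((\<Prod>j=0..<N1. u j (\<sigma> j)) * (\<Prod>j=N1..<N. w j (\<sigma> j)))) = 0"
    by simp
  then have "f * (\<Sum>\<sigma> | \<sigma> permutes {0..<N}. signof \<sigma> *
      ((\<Prod>j=0..<N1. u j (\<sigma> j)) * (\<Prod>j=N1..<N. w j (\<sigma> j)))) = 0"
    by simp
  then show ?case
    by (simp add: theta_shift_Nil sum_distrib_left mult_ac)
next
  case (Cons c cs)
  let ?S = "\<lambda>f u. \<Sum>\<sigma> | \<sigma> permutes {0..<N}. signof \<sigma> *
    (theta_shift cs (f * (\<Prod>j=0..<N1. u j (\<sigma> j))) * (\<Prod>j=N1..<N. w j (\<sigma> j)))"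
  define v where "v l j x = (if j = l then fps_X * fps_deriv (u j x) else u j x)" for l j x
  let ?E = "\<lambda>u. {j\<in>{0..<N1}. \<exists>j'\<in>{N1..<N}. u j = w j'}"
  have v: "?S f (v l) = 0" for l
  proof (rule Cons.IH)
    have "?E u \<subseteq> insert l (?E (v l))"
    proof
      fix j
      assume j: "j \<in> ?E u"
      have "v l j = u j" if "j \<noteq> l"
        using that by (simp add: v_def fun_eq_iff)
      then show "j \<in> insert l (?E (v l))"
        using j by auto
    qed
    then have "card (?E u) \<le> card (insert l (?E (v l)))"
      by (intro card_mono) auto
    also have "\<dots> \<le> Suc (card (?E (v l)))"
      by (simp add: card_insert_if)
    finally show "length cs < card (?E (v l))"
      using Cons.prems by simp
  qed
  have u: "?S (theta_shift [c] f) u = 0"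
    using Cons.prems by (intro Cons.IH) auto
  have "theta_shift (c # cs) (f * (\<Prod>j=0..<N1. u j (\<sigma> j)))
      = theta_shift cs (theta_shift [c] f * (\<Prod>j=0..<N1. u j (\<sigma> j)))
        + (\<Sum>l=0..<N1. theta_shift cs (f * (\<Prod>j=0..<N1. v l j (\<sigma> j))))" for \<sigma>
    by (simp only: theta_shift_Cons[of c cs] theta_shift_single_mult_prod[OF finite_atLeastLessThan] theta_shift_add theta_shift_sum v_def)
  then have "(\<Sum>\<sigma> | \<sigma> permutes {0..<N}. signof \<sigma> *
    (theta_shift (c # cs) (f * (\<Prod>j=0..<N1. u j (\<sigma> j))) * (\<Prod>j=N1..<N. w j (\<sigma> j))))
    = ?S (theta_shift [c] f) u + (\<Sum>l=0..<N1. ?S f (v l))"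
    by (subst sum.swap) (simp add: distrib_left distrib_right sum.distrib sum_distrib_left sum_distrib_right)
  then show ?case
    by (simp add: u v)
qed

text \<open>Transposed: the tuple indexes the rows, so that the row lemmas on determinants apply
  directly to permuted or repeated entries of a tuple.\<close>

definition minor :: "nat \<Rightarrow> (nat \<Rightarrow> nat \<Rightarrow> 'a::comm_ring_1) \<Rightarrow> (nat \<Rightarrow> nat) \<Rightarrow> 'a" where
  "minor p z J = det (mat p p (\<lambda>(j, i). z i (J j)))"

lemma minor_eq_sum:
  "minor p z J = (\<Sum>\<pi> | \<pi> permutes {0..<p}. signof \<pi> * (\<Prod>j=0..<p. z (\<pi> j) (J j)))"
  unfolding minor_def by (auto simp: det_def permutes_in_image intro!: sum.cong prod.cong)

lemma minor_cong: "(\<And>j. j < p \<Longrightarrow> J j = J' j) \<Longrightarrow> minor p z J = minor p z J'"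
proof -
  assume J: "\<And>j. j < p \<Longrightarrow> J j = J' j"
  have "(\<Prod>j=0..<p. z (\<pi> j) (J j)) = (\<Prod>j=0..<p. z (\<pi> j) (J' j))" for \<pi>
    by (rule prod.cong) (auto simp: J)
  then show ?thesis
    by (simp add: minor_eq_sum)
qed

lemma minor_permute:
  assumes "\<sigma> permutes {0..<p}"
  shows "minor p z (\<lambda>j. J (\<sigma> j)) = signof \<sigma> * minor p z J"
proof -
  have "mat p p (\<lambda>(j, i). z i (J (\<sigma> j))) = mat p p (\<lambda>(j, i). mat p p (\<lambda>(j, i). z i (J j)) $$ (\<sigma> j, i))"
    using assms permutes_in_image by (intro eq_matI) fastforce+
  then show ?thesis
    unfolding minor_def using det_permute_rows[OF mat_carrier assms, of "\<lambda>(j, i). z i (J j)"] by simp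
qed

lemma minor_not_inj:
  assumes "\<not> inj_on J {0..<p}"
  shows "minor p z J = 0"
proof -
  obtain i j where "i < p" "j < p" "i \<noteq> j" "J i = J j"
    using assms by (auto simp: inj_on_def)
  then show ?thesis
    unfolding minor_def by (intro det_identical_rows[of _ p i j]) (auto simp: row_def)
qed

text \<open>Leibniz expansion of both minors turns the sum over \<sigma> into N by N determinants,
  one for each pair \<pi>, \<pi>'. Their rows carry N labels among the p row indices of
  \<open>z\<close>, without repetition inside either block. Hence at least N - p labels occur in
  both blocks, more than the operators in \<open>cs\<close> can spoil.\<close>

lemma minor_exchange:
  fixes z :: "nat \<Rightarrow> nat \<Rightarrow> 'a::comm_ring_1 fps"
  assumes "a \<le> p" "b \<le> p" "N = p - a + b" "length cs + p < N"
  shows "(\<Sum>\<sigma> | \<sigma> permutes {0..<N}. signof \<sigma> *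
    (theta_shift cs (minor p z (\<lambda>j. if j < a then \<alpha> j else \<tau> (\<sigma> (j - a)))) *
     minor p z (\<lambda>j. if j < b then \<tau> (\<sigma> (p - a + j)) else \<beta> j))) = 0"
proof -
  define N1 where "N1 = p - a"
  have N1: "N1 \<le> N"
    using assms by (simp add: N1_def)
  let ?P = "{\<pi>. \<pi> permutes {0..<p}}"
  \<comment> \<open>\<open>F\<close> and \<open>G\<close> collect the entries that are not
    exchanged. \<open>F\<close> stays under the operator as the factor \<open>f\<close> of
    \<open>sum_permutations_theta_shift\<close>; \<open>G\<close> belongs to the second minor, on
    which no operator acts, and is a constant factor.\<close>
  define F where "F \<pi> = signof \<pi> * (\<Prod>j=0..<a. z (\<pi> j) (\<alpha> j))" for \<pi> :: "nat \<Rightarrow> nat"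
  define G where "G \<pi> = signof \<pi> * (\<Prod>j=b..<p. z (\<pi> j) (\<beta> j))" for \<pi> :: "nat \<Rightarrow> nat"
  define u where "u \<pi> j x = z (\<pi> (a + j)) (\<tau> x)" for \<pi> :: "nat \<Rightarrow> nat" and j x
  define w where "w \<pi> j x = z (\<pi> (j - N1)) (\<tau> x)" for \<pi> :: "nat \<Rightarrow> nat" and j x
  have left: "minor p z (\<lambda>j. if j < a then \<alpha> j else \<tau> (\<sigma> (j - a)))
      = (\<Sum>\<pi>\<in>?P. F \<pi> * (\<Prod>j=0..<N1. u \<pi> j (\<sigma> j)))" for \<sigma>
    unfolding minor_eq_sum
  proof (rule sum.cong[OF refl])
    fix \<pi>
    let ?J = "\<lambda>j. if j < a then \<alpha> j else \<tau> (\<sigma> (j - a))"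
    have "(\<Prod>j=0..<p. z (\<pi> j) (?J j)) = (\<Prod>j=0..<a. z (\<pi> j) (?J j)) * (\<Prod>j=a..<p. z (\<pi> j) (?J j))"
      by (rule prod.atLeastLessThan_concat[symmetric]) (use assms in auto)
    moreover have "(\<Prod>j=a..<p. z (\<pi> j) (?J j)) = (\<Prod>j=0..<N1. u \<pi> j (\<sigma> j))"
      by (rule prod.reindex_bij_witness[of _ "\<lambda>j. a + j" "\<lambda>j. j - a"])
        (use assms in \<open>auto simp: N1_def u_def\<close>)
    ultimately show "signof \<pi> * (\<Prod>j=0..<p. z (\<pi> j) (?J j)) = F \<pi> * (\<Prod>j=0..<N1. u \<pi> j (\<sigma> j))"
      by (simp add: F_def mult.assoc)
  qed
  have right: "minor p z (\<lambda>j. if j < b then \<tau> (\<sigma> (p - a + j)) else \<beta> j)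
      = (\<Sum>\<pi>\<in>?P. G \<pi> * (\<Prod>j=N1..<N. w \<pi> j (\<sigma> j)))" for \<sigma>
    unfolding minor_eq_sum
  proof (rule sum.cong[OF refl])
    fix \<pi>
    let ?J = "\<lambda>j. if j < b then \<tau> (\<sigma> (p - a + j)) else \<beta> j"
    have "(\<Prod>j=0..<p. z (\<pi> j) (?J j)) = (\<Prod>j=0..<b. z (\<pi> j) (?J j)) * (\<Prod>j=b..<p. z (\<pi> j) (?J j))"
      by (rule prod.atLeastLessThan_concat[symmetric]) (use assms in auto)
    moreover have "(\<Prod>j=0..<b. z (\<pi> j) (?J j)) = (\<Prod>j=N1..<N. w \<pi> j (\<sigma> j))"
      by (rule prod.reindex_bij_witness[of _ "\<lambda>j. j - N1" "\<lambda>j. N1 + j"])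
        (use assms in \<open>auto simp: N1_def w_def\<close>)
    ultimately show "signof \<pi> * (\<Prod>j=0..<p. z (\<pi> j) (?J j)) = G \<pi> * (\<Prod>j=N1..<N. w \<pi> j (\<sigma> j))"
      by (simp add: G_def mult_ac)
  qed
  have zero: "(\<Sum>\<sigma> | \<sigma> permutes {0..<N}. signof \<sigma> *
      (theta_shift cs (F \<pi> * (\<Prod>j=0..<N1. u \<pi> j (\<sigma> j))) * (\<Prod>j=N1..<N. w \<pi>' j (\<sigma> j)))) = 0"
    if \<pi>: "\<pi> permutes {0..<p}" "\<pi>' permutes {0..<p}" for \<pi> \<pi>'
  proof (rule sum_permutations_theta_shift[OF N1])
    let ?R = "(\<lambda>j. \<pi> (a + j)) ` {0..<N1}" and ?R' = "(\<lambda>j. \<pi>' (j - N1)) ` {N1..<N}"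
    let ?E = "{j\<in>{0..<N1}. \<exists>j'\<in>{N1..<N}. u \<pi> j = w \<pi>' j'}"
    have inj: "inj_on (\<lambda>j. \<pi> (a + j)) {0..<N1}" "inj_on (\<lambda>j. \<pi>' (j - N1)) {N1..<N}"
      by (auto intro!: inj_onI dest!: injD[OF permutes_inj[OF \<pi>(1)]] injD[OF permutes_inj[OF \<pi>(2)]])
    have lt: "\<pi> x < p" "\<pi>' x < p" if "x < p" for x
      using that permutes_in_image[OF \<pi>(1), of x] permutes_in_image[OF \<pi>(2), of x] by simp_all
    have "?R \<subseteq> {0..<p}" "?R' \<subseteq> {0..<p}"
      using assms(1-3) by (auto simp: N1_def intro!: lt)
    then have "card (?R \<union> ?R') \<le> card {0..<p}"
      by (intro card_mono) auto
    moreover have "card ?R + card ?R' = card (?R \<union> ?R') + card (?R \<inter> ?R')"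
      by (rule card_Un_Int) auto
    moreover have "card ?R + card ?R' = N"
      using inj N1 by (simp add: card_image)
    ultimately have "length cs < card (?R \<inter> ?R')"
      using assms(4) by simp
    also have "card (?R \<inter> ?R') \<le> card ((\<lambda>j. \<pi> (a + j)) ` ?E)"
    proof (intro card_mono subsetI)
      fix r
      assume "r \<in> ?R \<inter> ?R'"
      then obtain j j' where j: "j < N1" "r = \<pi> (a + j)" "j' \<in> {N1..<N}" "r = \<pi>' (j' - N1)"
        by auto
      then have "u \<pi> j = w \<pi>' j'"
        by (simp add: u_def w_def fun_eq_iff)
      then have "j \<in> ?E"
        using j by auto
      then show "r \<in> (\<lambda>j. \<pi> (a + j)) ` ?E"
        using j(2) by (rule image_eqI[rotated])
    qed simp
    also have "\<dots> \<le> card ?E"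
      by (rule card_image_le) simp
    finally show "length cs < card ?E" .
  qed
  have "(\<Sum>\<sigma> | \<sigma> permutes {0..<N}. signof \<sigma> *
    (theta_shift cs (minor p z (\<lambda>j. if j < a then \<alpha> j else \<tau> (\<sigma> (j - a)))) *
     minor p z (\<lambda>j. if j < b then \<tau> (\<sigma> (p - a + j)) else \<beta> j)))
    = (\<Sum>\<sigma> | \<sigma> permutes {0..<N}. \<Sum>\<pi>\<in>?P. \<Sum>\<pi>'\<in>?P. G \<pi>' * (signof \<sigma> *
      (theta_shift cs (F \<pi> * (\<Prod>j=0..<N1. u \<pi> j (\<sigma> j))) * (\<Prod>j=N1..<N. w \<pi>' j (\<sigma> j)))))"
    unfolding left right theta_shift_sum sum_product
    by (simp add: sum_distrib_left mult_ac)
  also have "\<dots> = (\<Sum>\<pi>\<in>?P. \<Sum>\<pi>'\<in>?P. \<Sum>\<sigma> | \<sigma> permutes {0..<N}. G \<pi>' * (signof \<sigma> *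
      (theta_shift cs (F \<pi> * (\<Prod>j=0..<N1. u \<pi> j (\<sigma> j))) * (\<Prod>j=N1..<N. w \<pi>' j (\<sigma> j)))))"
    by (subst sum.swap) (intro sum.cong refl sum.swap)
  also have "\<dots> = 0"
  proof (rule sum.neutral, rule ballI, rule sum.neutral, rule ballI)
    fix \<pi> \<pi>'
    assume "\<pi> \<in> ?P" "\<pi>' \<in> ?P"
    then show "(\<Sum>\<sigma> | \<sigma> permutes {0..<N}. G \<pi>' * (signof \<sigma> *
        (theta_shift cs (F \<pi> * (\<Prod>j=0..<N1. u \<pi> j (\<sigma> j))) * (\<Prod>j=N1..<N. w \<pi>' j (\<sigma> j))))) = 0"
      unfolding sum_distrib_left[symmetric] by (simp only: zero mem_Collect_eq mult_zero_right)
  qed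
  finally show ?thesis .
qed

section \<open>Straightening\<close>

definition psubsets :: "nat \<Rightarrow> nat \<Rightarrow> nat set set" where
  "psubsets p n = {A. A \<subseteq> {1..n} \<and> card A = p}"

definition count_le :: "nat set \<Rightarrow> nat \<Rightarrow> nat" where
  "count_le A x = card {a\<in>A. a \<le> x}"

definition nth_elem :: "nat set \<Rightarrow> nat \<Rightarrow> nat" where
  "nth_elem A j = sorted_list_of_set A ! j"

lemma psubsetsD:
  assumes "A \<in> psubsets p n"
  shows "A \<subseteq> {1..n}" "card A = p" "finite A"
  using assms finite_subset[of A "{1..n}"] by (auto simp: psubsets_def)

lemma bij_betw_nth_elem:
  assumes "finite A"
  shows "bij_betw (nth_elem A) {0..<card A} A"
proof -
  have "bij_betw ((!) (sorted_list_of_set A)) {..<length (sorted_list_of_set A)} (set (sorted_list_of_set A))"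
    by (rule bij_betw_nth) auto
  then show ?thesis
    using assms by (simp add: nth_elem_def[abs_def] atLeast0LessThan)
qed

lemma nth_elem_less:
  assumes "finite A" "i < j" "j < card A"
  shows "nth_elem A i < nth_elem A j"
  unfolding nth_elem_def
  by (rule sorted_wrt_nth_less[OF strict_sorted_list_of_set]) (use assms in auto)

text \<open>The Galois connection between a subset's enumeration and its counting function:
  pointwise bounds on the former become opposite bounds on the latter.\<close>

lemma nth_elem_le_iff:
  assumes "finite A" "j < card A"
  shows "nth_elem A j \<le> x \<longleftrightarrow> j < count_le A x"
proof -
  define S where "S = {i\<in>{0..<card A}. nth_elem A i \<le> x}"
  have "{a\<in>nth_elem A ` {0..<card A}. a \<le> x} = nth_elem A ` S"
    by (auto simp: S_def)
  then have "{a\<in>A. a \<le> x} = nth_elem A ` S"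
    by (simp only: bij_betw_imp_surj_on[OF bij_betw_nth_elem[OF assms(1)]])
  moreover have "inj_on (nth_elem A) S"
    using bij_betw_imp_inj_on[OF bij_betw_nth_elem[OF assms(1)]] by (rule inj_on_subset) (auto simp: S_def)
  ultimately have card: "count_le A x = card S"
    by (simp only: count_le_def card_image)
  have mono: "nth_elem A i \<le> nth_elem A j'" if "i \<le> j'" "j' < card A" for i j'
    using nth_elem_less[OF assms(1), of i j'] that by (cases "i = j'") auto
  show ?thesis
  proof
    assume "nth_elem A j \<le> x"
    then have "{0..j} \<subseteq> S"
      using mono[of _ j] assms(2) by (fastforce simp: S_def)
    then have "card {0..j} \<le> card S"
      by (rule card_mono[rotated]) (simp add: S_def)
    then show "j < count_le A x"
      by (simp add: card)
  next
    assume j: "j < count_le A x"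
    show "nth_elem A j \<le> x"
    proof (rule ccontr)
      assume "\<not> nth_elem A j \<le> x"
      then have "S \<subseteq> {0..<j}"
      proof (intro subsetI)
        fix i
        assume "i \<in> S"
        then have "\<not> j \<le> i"
          using mono[of j i] \<open>\<not> nth_elem A j \<le> x\<close> by (auto simp: S_def)
        then show "i \<in> {0..<j}"
          by simp
      qed
      then have "card S \<le> j"
        using card_mono[of "{0..<j}" S] by simp
      then show False
        using j card by simp
    qed
  qed
qed

lemma count_le_le_card: "finite A \<Longrightarrow> count_le A x \<le> card A"
  unfolding count_le_def by (rule card_mono) auto

lemma sum_nth_elem: "finite A \<Longrightarrow> (\<Sum>j=0..<card A. nth_elem A j) = \<Sum>A"
  using sum.reindex_bij_betw[OF bij_betw_nth_elem, of A "\<lambda>a. a"] by simp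

lemma sum_psubset_le:
  assumes "A \<in> psubsets p n"
  shows "\<Sum>A \<le> p * n"
proof -
  have "\<Sum>A \<le> of_nat (card A) * n"
    by (rule sum_bounded_above) (use psubsetsD(1)[OF assms] in auto)
  then show ?thesis
    using psubsetsD(2)[OF assms] by simp
qed

text \<open>In an exchange the pooled columns are permuted within their own index set
  \<open>S\<close>. The map \<open>f\<close> carries \<open>S\<close> to positions in the tuple, and
  transport along an injection preserves the sign.\<close>

lemma minor_permute_on:
  assumes f: "inj_on f S" "f ` S \<subseteq> {0..<p}" and S: "finite S" and \<sigma>: "\<sigma> permutes S"
    and J: "\<And>x. x \<in> S \<Longrightarrow> J' (f x) = J (f (\<sigma> x))"
      "\<And>j. j < p \<Longrightarrow> j \<notin> f ` S \<Longrightarrow> J' j = J j"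
  shows "minor p z J' = signof \<sigma> * minor p z J"
proof -
  let ?\<rho> = "map_permutation S f \<sigma>"
  have "?\<rho> permutes f ` S"
    by (rule map_permutation_permutes[OF _ \<sigma>]) (simp add: bij_betw_def f)
  then have \<rho>: "?\<rho> permutes {0..<p}"
    using f(2) by (rule permutes_subset)
  have "J' j = J (?\<rho> j)" if "j < p" for j
  proof (cases "j \<in> f ` S")
    case True
    then obtain x where "x \<in> S" "j = f x"
      by auto
    then show ?thesis
      using J(1) f(1) by (simp add: map_permutation_def restrict_id_def)
  next
    case False
    then show ?thesis
      using J(2)[OF that] by (simp add: map_permutation_def restrict_id_def)
  qed
  then have "minor p z J' = minor p z (\<lambda>j. J (?\<rho> j))"
    by (rule minor_cong)
  then show ?thesis
    using minor_permute[OF \<rho>] sign_map_permutation[OF f(1) \<sigma> S] by metis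
qed

lemma minor_sort:
  assumes "inj_on J {0..<p}" "J ` {0..<p} = A"
  obtains \<sigma> where "minor p z J = signof \<sigma> * minor p z (nth_elem A)"
proof -
  have A: "finite A" "card A = p"
    using assms card_image[OF assms(1)] by auto
  have bij: "bij_betw (nth_elem A) {0..<p} A" "bij_betw J {0..<p} A"
    using bij_betw_nth_elem[OF A(1)] A assms by (auto simp: bij_betw_def)
  define \<sigma> where "\<sigma> j = (if j < p then inv_into {0..<p} (nth_elem A) (J j) else j)" for j
  have "bij_betw (inv_into {0..<p} (nth_elem A) \<circ> J) {0..<p} {0..<p}"
    by (rule bij_betw_trans[OF bij(2) bij_betw_inv_into[OF bij(1)]])
  then have "bij_betw \<sigma> {0..<p} {0..<p}"
    by (rule bij_betw_cong[THEN iffD1, rotated]) (simp add: \<sigma>_def)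
  then have \<sigma>: "\<sigma> permutes {0..<p}"
    by (rule bij_imp_permutes) (simp add: \<sigma>_def)
  have "J j = nth_elem A (\<sigma> j)" if "j < p" for j
  proof -
    have "J j \<in> A"
      using that assms(2) by auto
    then show ?thesis
      using that bij(1) by (simp add: \<sigma>_def bij_betw_inv_into_right)
  qed
  then have "minor p z J = minor p z (\<lambda>j. nth_elem A (\<sigma> j))"
    by (rule minor_cong)
  then show ?thesis
    using that minor_permute[OF \<sigma>] by metis
qed

text \<open>Permutations that keep the pooled columns in their two blocks act on each minor
  separately and thus reproduce the original product up to sign.\<close>

lemma permutes_split:
  fixes \<sigma> :: "nat \<Rightarrow> nat"
  assumes \<sigma>: "\<sigma> permutes {0..<N}" and "N1 \<le> N" and stab: "\<And>j. j < N1 \<Longrightarrow> \<sigma> j < N1"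
  obtains \<sigma>1 \<sigma>2 where "\<sigma>1 permutes {0..<N1}" "\<sigma>2 permutes {N1..<N}" "sign \<sigma> = sign \<sigma>1 * sign \<sigma>2"
    "\<And>j. j < N1 \<Longrightarrow> \<sigma> j = \<sigma>1 j" "\<And>j. N1 \<le> j \<Longrightarrow> j < N \<Longrightarrow> \<sigma> j = \<sigma>2 j"
proof -
  note inj = permutes_inj[OF \<sigma>]
  have im1: "\<sigma> ` {0..<N1} = {0..<N1}"
  proof (rule endo_inj_surj)
    show "\<sigma> ` {0..<N1} \<subseteq> {0..<N1}"
      using stab by auto
    show "inj_on \<sigma> {0..<N1}"
      using inj by (rule inj_on_subset) simp
  qed simp
  have "{0..<N} = {0..<N1} \<union> {N1..<N}"
    using assms(2) by auto
  then have diff: "{N1..<N} = {0..<N} - {0..<N1}"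
    by auto
  have im2: "\<sigma> ` {N1..<N} = {N1..<N}"
    unfolding diff image_set_diff[OF inj] by (simp only: im1 permutes_image[OF \<sigma>])
  define \<sigma>1 where "\<sigma>1 j = (if j < N1 then \<sigma> j else j)" for j
  define \<sigma>2 where "\<sigma>2 j = (if N1 \<le> j \<and> j < N then \<sigma> j else j)" for j
  have "bij_betw \<sigma>1 {0..<N1} {0..<N1}"
    using im1 inj_on_subset[OF inj subset_UNIV, of "{0..<N1}"]
    by (intro bij_betw_cong[THEN iffD1, of _ \<sigma> \<sigma>1]) (auto simp: bij_betw_def \<sigma>1_def)
  then have p1: "\<sigma>1 permutes {0..<N1}"
    by (rule bij_imp_permutes) (simp add: \<sigma>1_def)
  have "bij_betw \<sigma>2 {N1..<N} {N1..<N}"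
    using im2 inj_on_subset[OF inj subset_UNIV, of "{N1..<N}"]
    by (intro bij_betw_cong[THEN iffD1, of _ \<sigma> \<sigma>2]) (auto simp: bij_betw_def \<sigma>2_def)
  then have p2: "\<sigma>2 permutes {N1..<N}"
    by (rule bij_imp_permutes) (auto simp: \<sigma>2_def)
  have "\<sigma> = \<sigma>1 \<circ> \<sigma>2"
  proof
    fix j
    consider "j < N1" | "N1 \<le> j" "j < N" | "N \<le> j"
      by linarith
    then show "\<sigma> j = (\<sigma>1 \<circ> \<sigma>2) j"
    proof cases
      case 2
      then have "\<sigma> j \<in> {N1..<N}"
        using im2 by (metis atLeastLessThan_iff imageI)
      then show ?thesis
        using 2 by (simp add: \<sigma>1_def \<sigma>2_def)
    next
      case 3
      then show ?thesis
        using assms(2) permutes_not_in[OF \<sigma>, of j] by (simp add: \<sigma>1_def \<sigma>2_def)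
    qed (simp add: \<sigma>1_def \<sigma>2_def)
  qed
  then have "sign \<sigma> = sign \<sigma>1 * sign \<sigma>2"
    using p1 p2 by (metis finite_atLeastLessThan permutation_permutes sign_compose)
  then show ?thesis
    by (rule that[OF p1 p2]) (simp_all add: \<sigma>1_def \<sigma>2_def)
qed

text \<open>A permutation that does not preserve the first block brings in as many small columns as
  it takes large ones out.\<close>

lemma sum_permuted_less:
  fixes \<tau> :: "nat \<Rightarrow> nat"
  assumes \<sigma>: "\<sigma> permutes {0..<N}" and "N1 \<le> N"
    and \<tau>: "\<And>j. j < N1 \<Longrightarrow> x < \<tau> j" "\<And>j. N1 \<le> j \<Longrightarrow> j < N \<Longrightarrow> \<tau> j \<le> x"
    and i: "i < N1" "\<not> \<sigma> i < N1"
  shows "(\<Sum>j=0..<N1. \<tau> (\<sigma> j)) < (\<Sum>j=0..<N1. \<tau> j)"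
proof -
  define L where "L = {0..<N1}"
  define Q where "Q = \<sigma> ` L"
  have fin: "finite L" "finite Q"
    by (auto simp: L_def Q_def)
  have inj: "inj_on \<sigma> L"
    using permutes_inj[OF \<sigma>] by (rule inj_on_subset) simp
  have QN: "Q \<subseteq> {0..<N}"
    using permutes_in_image[OF \<sigma>] assms(2) unfolding Q_def L_def by fastforce
  have cards: "card (Q - L) = card (L - Q)"
    using card_image[OF inj] fin card_Diff_subset_Int[of Q L] card_Diff_subset_Int[of L Q]
    by (simp add: Q_def[symmetric] Int_commute)
  have "\<sigma> i \<in> Q - L"
    using i by (auto simp: Q_def L_def)
  then have pos: "card (Q - L) > 0"
    using fin by (metis card_gt_0_iff empty_iff finite_Diff)
  have "sum \<tau> (Q - L) \<le> of_nat (card (Q - L)) * x"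
    by (rule sum_bounded_above) (use QN \<tau>(2) in \<open>auto simp: L_def\<close>)
  also have "\<dots> < card (L - Q) * (x + 1)"
    using cards pos by simp
  also have "\<dots> \<le> sum \<tau> (L - Q)"
    using sum_bounded_below[of "L - Q" "x + 1" \<tau>] \<tau>(1) by (force simp: L_def)
  finally have "sum \<tau> (Q \<inter> L) + sum \<tau> (Q - L) < sum \<tau> (L \<inter> Q) + sum \<tau> (L - Q)"
    by (simp add: Int_commute)
  then have "sum \<tau> Q < sum \<tau> L"
    using sum.Int_Diff[OF fin(1), of \<tau> Q] sum.Int_Diff[OF fin(2), of \<tau> L] by simp
  then show ?thesis
    using sum.reindex[OF inj, of \<tau>] by (simp add: Q_def L_def)
qed

section \<open>Coefficients of minors with sorted columns\<close>

definition column_series :: "nat \<Rightarrow> nat \<Rightarrow> zindex cpoly fps" where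
  "column_series i c = Abs_fps (\<lambda>k. pvar (i + 1, c, k))"

definition sorted_D :: "nat \<Rightarrow> nat set \<times> nat \<Rightarrow> zindex cpoly" where
  "sorted_D p s = fps_nth (minor p column_series (nth_elem (fst s))) (snd s)"

lemma D_eq_minor:
  assumes "I \<in> tuples p n"
  shows "D p n I k = fps_nth (minor p column_series (\<lambda>j. I (j + 1))) k"
proof -
  have "Z_minor_matrix p n I = transpose_mat (mat p p (\<lambda>(j, i). column_series i (I (j + 1))))"
  proof (rule eq_matI)
    fix i j
    assume "i < dim_row (transpose_mat (mat p p (\<lambda>(j, i). column_series i (I (j + 1)))))"
      "j < dim_col (transpose_mat (mat p p (\<lambda>(j, i). column_series i (I (j + 1)))))"
    then have ij: "i < p" "j < p"
      by auto
    then have "1 \<le> I (j + 1)" "I (j + 1) \<le> n"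
      using assms PiE_mem[of I "{1..p}" "\<lambda>_. {1..n}" "j + 1"] by (auto simp: tuples_def)
    then show "Z_minor_matrix p n I $$ (i, j) =
        transpose_mat (mat p p (\<lambda>(j, i). column_series i (I (j + 1)))) $$ (i, j)"
      using ij by (auto simp: Z_minor_matrix_def mat_of_cols_def Z_matrix_def column_series_def
          simp del: upt_Suc)
  qed (auto simp: Z_minor_matrix_def)
  then show ?thesis
    by (simp add: D_def minor_def det_transpose[OF mat_carrier])
qed

lemma fps_nth_of_int_mult: "fps_nth (of_int z * f) k = of_int z * fps_nth f k"
  by (simp flip: fps_of_int)

lemma minor_coeff_cases:
  assumes "\<And>j. j < p \<Longrightarrow> J j \<in> {1..n}"
  obtains "minor p column_series J = 0"
  | \<sigma> :: "nat \<Rightarrow> nat" where "inj_on J {0..<p}" "J ` {0..<p} \<in> psubsets p n"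
      "\<And>k. fps_nth (minor p column_series J) k = of_int (sign \<sigma>) * sorted_D p (J ` {0..<p}, k)"
proof (cases "inj_on J {0..<p}")
  case True
  have ps: "J ` {0..<p} \<in> psubsets p n"
    using assms card_image[OF True] by (auto simp: psubsets_def)
  obtain \<sigma> where "minor p column_series J = signof \<sigma> * minor p column_series (nth_elem (J ` {0..<p}))"
    using minor_sort[OF True refl] .
  then show ?thesis
    using that(2)[OF True ps, of \<sigma>] by (simp add: sorted_D_def fps_nth_of_int_mult)
qed (use that minor_not_inj in blast)

text \<open>
  An exchange moves the factors of an incomparable pair further apart at constant total weight,
  which increases this convex function of the weight.
\<close>

definition potential :: "nat \<Rightarrow> nat \<Rightarrow> nat set \<times> nat \<Rightarrow> int" where
  "potential p n s = (int ((p * n + 1) * snd s + \<Sum>(fst s)))\<^sup>2"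

text \<open>The difference of the two sides is 2 (y' - y) (y' - x).\<close>

lemma sum_squares_less:
  fixes x :: int
  assumes "x' + y' = x + y" "y < y'" "x < y'"
  shows "x\<^sup>2 + y\<^sup>2 < x'\<^sup>2 + y'\<^sup>2"
proof -
  have x': "x' = x + y - y'"
    using assms(1) by simp
  have "x'\<^sup>2 + y'\<^sup>2 - (x\<^sup>2 + y\<^sup>2) = 2 * ((y' - y) * (y' - x))"
    unfolding x' by (simp add: power2_eq_square algebra_simps)
  moreover have "0 < (y' - y) * (y' - x)"
    using assms(2,3) by (intro mult_pos_pos) auto
  ultimately show ?thesis
    by linarith
qed

text \<open>The level dominates: it outweighs any change of the column sum, which is at most \<open>p * n\<close>.\<close>

lemma weight_less:
  assumes "k < l" "\<Sum>A \<le> p * n"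
  shows "int ((p * n + 1) * k + \<Sum>A) < int ((p * n + 1) * l + \<Sum>B)"
proof -
  have "(p * n + 1) * k + \<Sum>A < (p * n + 1) * (k + 1)"
    using assms(2) by simp
  also have "\<dots> \<le> (p * n + 1) * l"
    using assms(1) by (intro mult_le_mono) auto
  finally show ?thesis
    by linarith
qed

text \<open>
  In the exchange relation, the operator with \<open>cs = [k + 1..l]\<close> kills all terms whose level lies in
  \<open>{k + 1..l}\<close>. The remaining ones either have more distant levels, or levels \<open>k\<close> and \<open>l\<close>
  and a first factor of smaller column sum, or are multiples of the given product.
\<close>

lemma straighten_pair:
  assumes A: "A \<in> psubsets p n" and B: "B \<in> psubsets p n" and kl: "k \<le> l"
    and x: "count_le A x + (l - k) < count_le B x" and tie: "k = l \<Longrightarrow> \<Sum>A \<le> \<Sum>B"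
  shows "sorted_D p (A, k) * sorted_D p (B, l) \<in> cpoly.span {sorted_D p s * sorted_D p t | s t.
    fst s \<in> psubsets p n \<and> fst t \<in> psubsets p n \<and> snd s + snd t = k + l \<and>
    potential p n (A, k) + potential p n (B, l) < potential p n s + potential p n t}"
    (is "_ \<in> cpoly.span ?V")
proof -
  define a where "a = count_le A x"
  define b where "b = count_le B x"
  define N1 where "N1 = p - a"
  define N where "N = p - a + b"
  define K where "K = k + l"
  \<comment> \<open>The pooled columns: the elements of \<open>A\<close> above \<open>x\<close>,
    followed by the elements of \<open>B\<close> up to \<open>x\<close>. For the identity
    permutation the exchange gives back the original pair.\<close>
  define \<tau> where "\<tau> j = (if j < N1 then nth_elem A (a + j) else nth_elem B (j - N1))" for j
  define I where "I \<sigma> j = (if j < a then nth_elem A j else \<tau> (\<sigma> (j - a)))" for \<sigma> :: "nat \<Rightarrow> nat" and j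
  define J where "J \<sigma> j = (if j < b then \<tau> (\<sigma> (p - a + j)) else nth_elem B j)" for \<sigma> :: "nat \<Rightarrow> nat" and j
  define cs where "cs = map int [k + 1..<l + 1]"
  define wt where "wt k' = (\<Prod>c\<leftarrow>cs. int k' - c)" for k'
  let ?m = "minor p column_series"
  let ?P = "{\<sigma>. \<sigma> permutes {0..<N}}"
  define Stab where "Stab = {\<sigma>\<in>?P. \<forall>j<N1. \<sigma> j < N1}"
  \<comment> \<open>The share of \<sigma> in the coefficient of t^K with level k' in the first
    factor. The operator acts on that factor alone and appears as the weight
    \<open>wt k'\<close>.\<close>
  define T where "T \<sigma> k' = of_int (sign \<sigma> * wt k') * (fps_nth (?m (I \<sigma>)) k' * fps_nth (?m (J \<sigma>)) (K - k'))"
    for \<sigma> k'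
  note fA = psubsetsD[OF A] and fB = psubsetsD[OF B]
  have ab: "a \<le> p" "b \<le> p" "a + (l - k) < b"
    using count_le_le_card[OF fA(3)] count_le_le_card[OF fB(3)] fA(2) fB(2) x by (auto simp: a_def b_def)
  have N: "N1 \<le> N" "N - N1 = b" "N = N1 + b" "a + N1 = p"
    using ab by (auto simp: N_def N1_def)
  have elA: "nth_elem A j \<in> {1..n}" if "j < p" for j
    using that bij_betw_apply[OF bij_betw_nth_elem[OF fA(3)], of j] fA(1,2) by auto
  have elB: "nth_elem B j \<in> {1..n}" if "j < p" for j
    using that bij_betw_apply[OF bij_betw_nth_elem[OF fB(3)], of j] fB(1,2) by auto
  have \<tau>_range: "\<tau> j \<in> {1..n}" if "j < N" for j
    using that elA[of "a + j"] elB[of "j - N1"] ab N by (cases "j < N1") (simp_all add: \<tau>_def)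
  have \<tau>_large: "x < \<tau> j" if "j < N1" for j
    using that nth_elem_le_iff[OF fA(3), of "a + j" x] fA(2) N by (simp add: \<tau>_def a_def)
  have \<tau>_small: "\<tau> j \<le> x" if "N1 \<le> j" "j < N" for j
    using that nth_elem_le_iff[OF fB(3), of "j - N1" x] fB(2) N ab by (simp add: \<tau>_def b_def)
  have \<sigma>_lt: "\<sigma> j < N" if "\<sigma> \<in> ?P" "j < N" for \<sigma> j
    using that permutes_in_image[of \<sigma> "{0..<N}" j] by simp
  have I_range: "I \<sigma> j \<in> {1..n}" if "\<sigma> \<in> ?P" "j < p" for \<sigma> j
    unfolding I_def using that elA[of j] \<tau>_range[OF \<sigma>_lt[OF that(1), of "j - a"]] N by auto
  have J_range: "J \<sigma> j \<in> {1..n}" if "\<sigma> \<in> ?P" "j < p" for \<sigma> j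
    unfolding J_def using that elB[of j] \<tau>_range[OF \<sigma>_lt[OF that(1), of "p - a + j"]] N ab
    by (auto simp: N1_def)

  \<comment> \<open>Incomparability at \<open>x\<close> means b - a > l - k, hence N = p + (b - a)
    exceeds p by more than the number of operators, as \<open>minor_exchange\<close>
    requires.\<close>
  have "length cs = l - k"
    by (simp add: cs_def del: upt_Suc)
  then have "length cs + p < N"
    using ab N by simp
  then have "(\<Sum>\<sigma>\<in>?P. signof \<sigma> * (theta_shift cs (?m (I \<sigma>)) * ?m (J \<sigma>))) = 0"
    unfolding I_def J_def using ab by (intro minor_exchange) (auto simp: N_def)
  then have "fps_nth (\<Sum>\<sigma>\<in>?P. signof \<sigma> * (theta_shift cs (?m (I \<sigma>)) * ?m (J \<sigma>))) K = 0"
    by simp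
  moreover have "fps_nth (signof \<sigma> * (theta_shift cs (?m (I \<sigma>)) * ?m (J \<sigma>))) K = (\<Sum>k'=0..K. T \<sigma> k')" for \<sigma>
    by (simp only: fps_nth_of_int_mult)
      (simp add: fps_mult_nth theta_shift_nth T_def wt_def sum_distrib_left mult.assoc)
  ultimately have "(\<Sum>\<sigma>\<in>?P. \<Sum>k'=0..K. T \<sigma> k') = 0"
    by (simp only: fps_sum_nth)
  then have sum0: "(\<Sum>(\<sigma>, k')\<in>?P \<times> {0..K}. T \<sigma> k') = 0"
    by (simp add: sum.cartesian_product)

  have wt_zero: "wt k' = 0" if "k < k'" "k' \<le> l" for k'
    using that by (force simp: wt_def cs_def prod_list_zero_iff)
  have wt_k: "wt k \<noteq> 0"
    by (auto simp: wt_def cs_def prod_list_zero_iff)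

  \<comment> \<open>Each block sign occurs twice, once in the relation and once when the columns of
    a minor are put back in order. So the terms from \<open>Stab\<close> all have the same sign and
    cannot cancel each other.\<close>
  have main: "T \<sigma> k = of_int (wt k) * (sorted_D p (A, k) * sorted_D p (B, l))" if \<sigma>: "\<sigma> \<in> Stab" for \<sigma>
  proof -
    obtain \<sigma>1 \<sigma>2 where s: "\<sigma>1 permutes {0..<N1}" "\<sigma>2 permutes {N1..<N}" "sign \<sigma> = sign \<sigma>1 * sign \<sigma>2"
      "\<And>j. j < N1 \<Longrightarrow> \<sigma> j = \<sigma>1 j" "\<And>j. N1 \<le> j \<Longrightarrow> j < N \<Longrightarrow> \<sigma> j = \<sigma>2 j"
      using \<sigma> N(1) permutes_split[of \<sigma> N N1] by (auto simp: Stab_def)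
    have lt1: "\<sigma>1 j < N1" if "j < N1" for j
      using permutes_in_image[OF s(1), of j] that by simp
    have lt2: "N1 \<le> \<sigma>2 j \<and> \<sigma>2 j < N" if "N1 \<le> j" "j < N" for j
      using permutes_in_image[OF s(2), of j] that by simp
    have mI: "?m (I \<sigma>) = signof \<sigma>1 * ?m (nth_elem A)"
    proof (rule minor_permute_on[where f = "\<lambda>j. a + j" and S = "{0..<N1}"])
      fix j
      assume "j < p" "j \<notin> (\<lambda>j. a + j) ` {0..<N1}"
      then have "j < a"
        using N(4) by (force simp: image_iff dest: spec[of _ "j - a"])
      then show "I \<sigma> j = nth_elem A j"
        by (simp add: I_def)
    qed (use s(1) N lt1 in \<open>auto simp: I_def \<tau>_def s(4)\<close>)
    have mJ: "?m (J \<sigma>) = signof \<sigma>2 * ?m (nth_elem B)"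
    proof (rule minor_permute_on[where f = "\<lambda>j. j - N1" and S = "{N1..<N}"])
      show "inj_on (\<lambda>j. j - N1) {N1..<N}"
        by (auto simp: inj_on_def)
      show "(\<lambda>j. j - N1) ` {N1..<N} \<subseteq> {0..<p}"
        using N ab by auto
      show "J \<sigma> (j - N1) = nth_elem B (\<sigma>2 j - N1)" if "j \<in> {N1..<N}" for j
        using that N lt2[of j] s(5)[of j] by (auto simp: J_def \<tau>_def N1_def[symmetric])
      fix j
      assume "j < p" "j \<notin> (\<lambda>j. j - N1) ` {N1..<N}"
      then have "\<not> j < b"
        using N(3) by (auto simp: image_iff dest: bspec[of _ _ "N1 + j"])
      then show "J \<sigma> j = nth_elem B j"
        by (simp add: J_def)
    qed (use s(2) in auto)
    have sq: "of_int (sign \<rho>) * (of_int (sign \<rho>) * y) = y" for \<rho> :: "nat \<Rightarrow> nat" and y :: "zindex cpoly"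
      by (simp only: mult.assoc[symmetric] of_int_mult[symmetric] sign_idempotent) simp
    show ?thesis
      by (simp add: T_def mI mJ s(3) fps_nth_of_int_mult sorted_D_def K_def mult_ac sq)
  qed

  have sums: "(\<Sum>j=0..<p. I \<sigma> j) = (\<Sum>j=0..<a. nth_elem A j) + (\<Sum>j=0..<N1. \<tau> (\<sigma> j))"
    "(\<Sum>j=0..<p. J \<sigma> j) = (\<Sum>j=N1..<N. \<tau> (\<sigma> j)) + (\<Sum>j=b..<p. nth_elem B j)" for \<sigma>
  proof -
    have "(\<Sum>j=0..<p. I \<sigma> j) = (\<Sum>j=0..<a. I \<sigma> j) + (\<Sum>j=a..<p. I \<sigma> j)"
      by (rule sum.atLeastLessThan_concat[symmetric]) (use ab in auto)
    also have "(\<Sum>j=0..<a. I \<sigma> j) = (\<Sum>j=0..<a. nth_elem A j)"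
      by (rule sum.cong) (auto simp: I_def)
    also have "(\<Sum>j=a..<p. I \<sigma> j) = (\<Sum>j=0..<N1. \<tau> (\<sigma> j))"
      by (rule sum.reindex_bij_witness[of _ "\<lambda>j. a + j" "\<lambda>j. j - a"]) (use N in \<open>auto simp: I_def\<close>)
    finally show "(\<Sum>j=0..<p. I \<sigma> j) = (\<Sum>j=0..<a. nth_elem A j) + (\<Sum>j=0..<N1. \<tau> (\<sigma> j))" .
    have "(\<Sum>j=0..<p. J \<sigma> j) = (\<Sum>j=0..<b. J \<sigma> j) + (\<Sum>j=b..<p. J \<sigma> j)"
      by (rule sum.atLeastLessThan_concat[symmetric]) (use ab in auto)
    also have "(\<Sum>j=b..<p. J \<sigma> j) = (\<Sum>j=b..<p. nth_elem B j)"
      by (rule sum.cong) (auto simp: J_def)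
    also have "(\<Sum>j=0..<b. J \<sigma> j) = (\<Sum>j=N1..<N. \<tau> (\<sigma> j))"
      by (rule sum.reindex_bij_witness[of _ "\<lambda>j. j - N1" "\<lambda>j. N1 + j"])
        (use N in \<open>auto simp: J_def N1_def[symmetric]\<close>)
    finally show "(\<Sum>j=0..<p. J \<sigma> j) = (\<Sum>j=N1..<N. \<tau> (\<sigma> j)) + (\<Sum>j=b..<p. nth_elem B j)" .
  qed
  have sums_id: "(\<Sum>j=0..<p. I id j) = \<Sum>A" "(\<Sum>j=0..<p. J id j) = \<Sum>B"
  proof -
    have "(\<Sum>j=0..<p. I id j) = (\<Sum>j=0..<p. nth_elem A j)"
      by (rule sum.cong) (use N in \<open>auto simp: I_def \<tau>_def\<close>)
    then show "(\<Sum>j=0..<p. I id j) = \<Sum>A"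
      using sum_nth_elem[OF fA(3)] fA(2) by simp
    have "(\<Sum>j=0..<p. J id j) = (\<Sum>j=0..<p. nth_elem B j)"
      by (rule sum.cong) (auto simp: J_def \<tau>_def N1_def[symmetric])
    then show "(\<Sum>j=0..<p. J id j) = \<Sum>B"
      using sum_nth_elem[OF fB(3)] fB(2) by simp
  qed
  have total: "(\<Sum>j=0..<N1. \<tau> (\<sigma> j)) + (\<Sum>j=N1..<N. \<tau> (\<sigma> j)) = (\<Sum>j=0..<N. \<tau> j)" if "\<sigma> \<in> ?P" for \<sigma>
  proof -
    have "(\<Sum>j=0..<N. \<tau> (\<sigma> j)) = (\<Sum>j=0..<N. \<tau> j)"
      using that by (intro sum.reindex_bij_betw permutes_imp_bij) simp
    then show ?thesis
      using sum.atLeastLessThan_concat[of 0 N1 N "\<lambda>j. \<tau> (\<sigma> j)"] N(1) by simp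
  qed
  have sum_IJ: "(\<Sum>j=0..<p. I \<sigma> j) + (\<Sum>j=0..<p. J \<sigma> j) = \<Sum>A + \<Sum>B" if "\<sigma> \<in> ?P" for \<sigma>
  proof -
    have "(\<Sum>j=0..<p. I \<sigma> j) + (\<Sum>j=0..<p. J \<sigma> j) = (\<Sum>j=0..<p. I id j) + (\<Sum>j=0..<p. J id j)"
      using sums total[OF that] total[of id] permutes_id[of "{0..<N}"] by simp
    then show ?thesis
      by (simp add: sums_id)
  qed
  have sum_I: "(\<Sum>j=0..<p. I \<sigma> j) < \<Sum>A" if \<sigma>: "\<sigma> \<in> ?P - Stab" for \<sigma>
  proof -
    obtain i where "i < N1" "\<not> \<sigma> i < N1"
      using \<sigma> by (auto simp: Stab_def)
    then have "(\<Sum>j=0..<N1. \<tau> (\<sigma> j)) < (\<Sum>j=0..<N1. \<tau> j)"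
      using \<sigma> N(1) \<tau>_large \<tau>_small by (intro sum_permuted_less[of \<sigma> N N1 x]) auto
    then show ?thesis
      using sums(1)[of \<sigma>] sums(1)[of id] sums_id(1) by simp
  qed

  have rest: "T \<sigma> k' \<in> cpoly.span ?V" if \<sigma>: "\<sigma> \<in> ?P" and k': "k' \<le> K" and ne: "\<not> (\<sigma> \<in> Stab \<and> k' = k)" for \<sigma> k'
  proof (cases "k < k' \<and> k' \<le> l")
    case True
    then show ?thesis
      using wt_zero by (simp add: T_def cpoly.span_zero)
  next
    case False
    note I = I_range[OF \<sigma>] and J = J_range[OF \<sigma>]
    let ?A = "I \<sigma> ` {0..<p}" and ?B = "J \<sigma> ` {0..<p}"
    show ?thesis
    proof (rule minor_coeff_cases[of p "I \<sigma>", OF I], assumption)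
      assume "?m (I \<sigma>) = 0"
      then show ?thesis
        by (simp add: T_def cpoly.span_zero)
    next
      fix \<rho>1
      assume inj1: "inj_on (I \<sigma>) {0..<p}" and A': "?A \<in> psubsets p n"
        and eq1: "\<And>k. fps_nth (?m (I \<sigma>)) k = of_int (sign \<rho>1) * sorted_D p (?A, k)"
      show ?thesis
      proof (rule minor_coeff_cases[of p "J \<sigma>", OF J], assumption)
        assume "?m (J \<sigma>) = 0"
        then show ?thesis
          by (simp add: T_def cpoly.span_zero)
      next
        fix \<rho>2
        assume inj2: "inj_on (J \<sigma>) {0..<p}" and B': "?B \<in> psubsets p n"
          and eq2: "\<And>k. fps_nth (?m (J \<sigma>)) k = of_int (sign \<rho>2) * sorted_D p (?B, k)"
        have sA: "\<Sum>?A = (\<Sum>j=0..<p. I \<sigma> j)" and sB: "\<Sum>?B = (\<Sum>j=0..<p. J \<sigma> j)"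
          using sum.reindex[OF inj1, of "\<lambda>a. a"] sum.reindex[OF inj2, of "\<lambda>a. a"] by simp_all
        define W where "W s = int ((p * n + 1) * snd s + \<Sum>(fst s))" for s
        have "q * k' + q * (K - k') = q * k + q * l" for q
          using k' by (simp add: K_def flip: distrib_left)
        from this[of "p * n + 1"]
        have "(p * n + 1) * k' + \<Sum>?A + ((p * n + 1) * (K - k') + \<Sum>?B)
            = (p * n + 1) * k + \<Sum>A + ((p * n + 1) * l + \<Sum>B)"
          using sum_IJ[OF \<sigma>] sA sB by linarith
        then have W_sum: "W (?A, k') + W (?B, K - k') = W (A, k) + W (B, l)"
          unfolding W_def fst_conv snd_conv of_nat_add[symmetric] by (simp only:)
        note le = sum_psubset_le[OF A] sum_psubset_le[OF B] sum_psubset_le[OF A'] sum_psubset_le[OF B']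
        consider "k' = k" | "k' < k" | "l < k'"
          using False by linarith
        then have "potential p n (A, k) + potential p n (B, l)
            < potential p n (?A, k') + potential p n (?B, K - k')"
        proof cases
          case 1
          then have "\<Sum>?A < \<Sum>A"
            using sum_I[of \<sigma>] \<sigma> ne sA by auto
          then have "\<Sum>B < \<Sum>?B"
            using sum_IJ[OF \<sigma>] sA sB by linarith
          moreover have "K - k' = l"
            using 1 by (simp add: K_def)
          ultimately have "W (B, l) < W (?B, K - k')"
            unfolding W_def fst_conv snd_conv of_nat_less_iff by simp
          \<comment> \<open>The new weight has to exceed both old ones. Here \<open>kl\<close> and
            \<open>tie\<close> make the second factor the heavier one.\<close>
          moreover have "W (A, k) \<le> W (B, l)"
            using tie kl weight_less[OF _ le(1), of k l B] by (cases "k = l") (auto simp: W_def simp del: of_nat_add of_nat_sum of_nat_mult)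
          ultimately show ?thesis
            using sum_squares_less[OF W_sum] by (simp add: potential_def W_def)
        next
          case 2
          then have "W (B, l) < W (?B, K - k')" "W (A, k) < W (?B, K - k')"
            unfolding W_def fst_conv snd_conv using kl le
            by (intro weight_less; simp add: K_def)+
          then show ?thesis
            using sum_squares_less[OF W_sum] by (simp add: potential_def W_def)
        next
          case 3
          then have "W (B, l) < W (?A, k')" "W (A, k) < W (?A, k')"
            unfolding W_def fst_conv snd_conv using kl le
            by (intro weight_less; simp add: K_def)+
          then show ?thesis
            using sum_squares_less[of "W (?B, K - k')" "W (?A, k')" "W (A, k)" "W (B, l)"] W_sum
            by (simp add: potential_def W_def)
        qed
        then have "sorted_D p (?A, k') * sorted_D p (?B, K - k') \<in> ?V"
          using A' B' k' by (intro CollectI exI[of _ "(?A, k')"] exI[of _ "(?B, K - k')"]) (simp add: K_def)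
        then have "of_int (sign \<sigma> * wt k' * sign \<rho>1 * sign \<rho>2) *
            (sorted_D p (?A, k') * sorted_D p (?B, K - k')) \<in> cpoly.span ?V"
          by (intro span_of_int_mult cpoly.span_base)
        then show ?thesis
          by (simp add: T_def eq1 eq2 mult_ac)
      qed
    qed
  qed

  have fin: "finite (?P \<times> {0..K})"
    by (simp add: finite_permutations)
  have sub: "Stab \<times> {k} \<subseteq> ?P \<times> {0..K}"
    by (auto simp: Stab_def K_def)
  have Stab: "finite Stab" "id \<in> Stab"
    using finite_permutations[of "{0..<N}"] by (auto simp: Stab_def permutes_id)
  \<comment> \<open>The coefficient with which the given product occurs: one copy of
    \<open>wt k\<close> for each element of \<open>Stab\<close>. It is a nonzero integer, hence
    invertible in the complex numbers.\<close>
  define c where "c = int (card Stab) * wt k"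
  have "c \<noteq> 0"
    using Stab wt_k by (auto simp: c_def)
  have "(\<Sum>(\<sigma>, k')\<in>Stab \<times> {k}. T \<sigma> k') = (\<Sum>\<sigma>\<in>Stab. T \<sigma> k)"
    by (simp flip: sum.cartesian_product)
  also have "\<dots> = of_int c * (sorted_D p (A, k) * sorted_D p (B, l))"
    by (simp add: main c_def)
  finally have "of_int c * (sorted_D p (A, k) * sorted_D p (B, l))
      = - (\<Sum>(\<sigma>, k')\<in>?P \<times> {0..K} - Stab \<times> {k}. T \<sigma> k')"
    using sum.subset_diff[OF sub fin, of "\<lambda>(\<sigma>, k'). T \<sigma> k'"] sum0
    by (simp add: eq_neg_iff_add_eq_0 add.commute)
  moreover have "(\<Sum>(\<sigma>, k')\<in>?P \<times> {0..K} - Stab \<times> {k}. T \<sigma> k') \<in> cpoly.span ?V"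
  proof (rule cpoly.span_sum)
    fix y
    assume y: "y \<in> ?P \<times> {0..K} - Stab \<times> {k}"
    obtain \<sigma> k' where "y = (\<sigma>, k')"
      by (cases y)
    then show "(case y of (\<sigma>, k') \<Rightarrow> T \<sigma> k') \<in> cpoly.span ?V"
      using rest[of \<sigma> k'] y by simp
  qed
  ultimately have "cpoly_scale (of_int c) (sorted_D p (A, k) * sorted_D p (B, l)) \<in> cpoly.span ?V"
    using cpoly.span_neg by (simp add: cpoly_scale_of_int)
  then have "cpoly_scale (1 / of_int c) (cpoly_scale (of_int c) (sorted_D p (A, k) * sorted_D p (B, l))) \<in> cpoly.span ?V"
    by (rule cpoly.span_scale)
  then show ?thesis
    using \<open>c \<noteq> 0\<close> by simp
qed

text \<open>The pointwise order a(i + k) \<le> b(i + l) of the periodic enumerations, in counting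
  form: if the j-th element of the second subset is at most x, then so is element number j - (l - k)
  of the first. A violation directly supplies the cut \<open>x\<close> at which columns are
  exchanged.\<close>

definition symbol_le :: "nat set \<times> nat \<Rightarrow> nat set \<times> nat \<Rightarrow> bool" where
  "symbol_le s t \<longleftrightarrow> snd s \<le> snd t \<and> (\<forall>x. count_le (fst t) x \<le> count_le (fst s) x + (snd t - snd s))"

definition standard :: "nat \<Rightarrow> nat \<Rightarrow> nat \<Rightarrow> nat \<Rightarrow> (nat set \<times> nat) multiset set" where
  "standard p n m K = {w. set_mset w \<subseteq> psubsets p n \<times> UNIV \<and> size w = m \<and> (\<Sum>s\<in>#w. snd s) = K \<and>
    (\<forall>s\<in>#w. \<forall>t\<in>#w. symbol_le s t \<or> symbol_le t s)}"

text \<open>The factors are ordered by level and, at equal levels, by column sum. Failure of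
  \<open>symbol_le\<close> in that direction provides the hypotheses of
  \<open>straighten_pair\<close>.\<close>

lemma straighten_incomparable:
  assumes "s \<in> psubsets p n \<times> UNIV" "t \<in> psubsets p n \<times> UNIV" "\<not> symbol_le s t" "\<not> symbol_le t s"
  shows "sorted_D p s * sorted_D p t \<in> cpoly.span {sorted_D p s' * sorted_D p t' | s' t'.
    fst s' \<in> psubsets p n \<and> fst t' \<in> psubsets p n \<and> snd s' + snd t' = snd s + snd t \<and>
    potential p n s + potential p n t < potential p n s' + potential p n t'}"
proof -
  have one: "sorted_D p s * sorted_D p t \<in> cpoly.span {sorted_D p s' * sorted_D p t' | s' t'.
    fst s' \<in> psubsets p n \<and> fst t' \<in> psubsets p n \<and> snd s' + snd t' = snd s + snd t \<and>
    potential p n s + potential p n t < potential p n s' + potential p n t'}"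
    if st: "s \<in> psubsets p n \<times> UNIV" "t \<in> psubsets p n \<times> UNIV" "\<not> symbol_le s t" "snd s \<le> snd t"
      "snd s = snd t \<Longrightarrow> \<Sum>(fst s) \<le> \<Sum>(fst t)" for s t
  proof -
    obtain x where "count_le (fst s) x + (snd t - snd s) < count_le (fst t) x"
      using st(3,4) unfolding symbol_le_def not_le[symmetric] by blast
    then show ?thesis
      using straighten_pair[of "fst s" p n "fst t" "snd s" "snd t" x] st
      by (simp add: mem_Times_iff)
  qed
  show ?thesis
  proof (cases "snd s < snd t \<or> snd s = snd t \<and> \<Sum>(fst s) \<le> \<Sum>(fst t)")
    case True
    then show ?thesis
      using one[of s t] assms by auto
  next
    case False
    then show ?thesis
      using one[of t s] assms by (auto simp: mult.commute add.commute)
  qed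
qed

text \<open>Rewriting an incomparable pair preserves the size and the total level, and these bound
  the potential. Since the potential strictly grows, rewriting ends at chains.\<close>

lemma straightening:
  assumes "set_mset w \<subseteq> psubsets p n \<times> UNIV"
  shows "(\<Prod>s\<in>#w. sorted_D p s) \<in>
    cpoly.span ((\<lambda>w. \<Prod>s\<in>#w. sorted_D p s) ` standard p n (size w) (\<Sum>s\<in>#w. snd s))"
proof -
  \<comment> \<open>At total level K each factor has level at most K and column sum at most p *
    n.\<close>
  define bound where "bound m K = int m * (int ((p * n + 1) * K + p * n))\<^sup>2" for m K :: nat
  define pot where "pot w = (\<Sum>s\<in>#w. potential p n s)" for w :: "(nat set \<times> nat) multiset"
  have bound: "pot w \<le> bound (size w) (\<Sum>s\<in>#w. snd s)" if "set_mset w \<subseteq> psubsets p n \<times> UNIV" for w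
  proof -
    have le: "potential p n s \<le> (int ((p * n + 1) * K + p * n))\<^sup>2"
      if "fst s \<in> psubsets p n" "snd s \<le> K" for s K
      unfolding potential_def using that(2) sum_psubset_le[OF that(1)]
      by (intro power_mono) (auto simp flip: of_nat_add of_nat_mult intro!: add_mono mult_le_mono)
    have "pot v \<le> int (size v) * (int ((p * n + 1) * K + p * n))\<^sup>2"
      if "set_mset v \<subseteq> psubsets p n \<times> UNIV" "(\<Sum>s\<in>#v. snd s) \<le> K" for v K
      using that
    proof (induction v)
      case (add s v)
      then show ?case
        using le[of s K] by (auto simp: pot_def algebra_simps)
    qed (simp add: pot_def)
    from this[OF that order_refl] show ?thesis
      by (simp only: bound_def)
  qed
  show ?thesis
    using assms
  proof (induction "nat (bound (size w) (\<Sum>s\<in>#w. snd s) - pot w)" arbitrary: w rule: less_induct)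
    case (less w)
    let ?S = "cpoly.span ((\<lambda>w. \<Prod>s\<in>#w. sorted_D p s) ` standard p n (size w) (\<Sum>s\<in>#w. snd s))"
    show ?case
    proof (cases "\<forall>s\<in>#w. \<forall>t\<in>#w. symbol_le s t \<or> symbol_le t s")
      case True
      then show ?thesis
        using less.prems by (auto simp: standard_def intro!: cpoly.span_base)
    next
      case False
      then obtain s t where st: "s \<in># w" "t \<in># w" "\<not> symbol_le s t" "\<not> symbol_le t s"
        by blast
      then have "s \<noteq> t"
        by (auto simp: symbol_le_def)
      then have "t \<in># w - {#s#}"
        using st by (simp add: in_diff_count)
      then obtain w0 where w: "w = {#s, t#} + w0"
        using st(1) by (metis add_mset_add_single insert_DiffM union_mset_add_mset_left add_0)
      define R where "R = (\<Prod>s\<in>#w0. sorted_D p s)"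
      have "sorted_D p s * sorted_D p t * R \<in> ?S"
      proof (rule cpoly_span_mult[OF straighten_incomparable[of s p n t] cpoly.span_base[of R "{R}"]])
        fix x y
        assume "x \<in> {sorted_D p s' * sorted_D p t' | s' t'.
          fst s' \<in> psubsets p n \<and> fst t' \<in> psubsets p n \<and> snd s' + snd t' = snd s + snd t \<and>
          potential p n s + potential p n t < potential p n s' + potential p n t'}" "y \<in> {R}"
        then obtain s' t' where s't': "x * y = sorted_D p s' * sorted_D p t' * R"
          "fst s' \<in> psubsets p n" "fst t' \<in> psubsets p n" "snd s' + snd t' = snd s + snd t"
          "potential p n s + potential p n t < potential p n s' + potential p n t'"
          by auto
        define w' where "w' = {#s', t'#} + w0"
        have w': "set_mset w' \<subseteq> psubsets p n \<times> UNIV" "size w' = size w"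
          "(\<Sum>s\<in>#w'. snd s) = (\<Sum>s\<in>#w. snd s)" "pot w < pot w'"
          using less.prems s't' by (auto simp: w w'_def pot_def mem_Times_iff)
        have "(\<Prod>s\<in>#w'. sorted_D p s) \<in> ?S"
          using less.hyps[OF _ w'(1)] bound[OF w'(1)] w' by simp
        then show "x * y \<in> ?S"
          by (simp add: s't'(1) w'_def R_def mult.assoc)
      qed (use st less.prems in auto)
      then show ?thesis
        by (simp add: w R_def mult.assoc)
    qed
  qed
qed

section \<open>Recovering a chain from its monomial\<close>

lemma int_mod1: "n > 0 \<Longrightarrow> int (mod1 a n) = (a - 1) mod int n + 1"
  by (simp add: mod1_def)

lemma mod1_range: "n > 0 \<Longrightarrow> mod1 a n \<in> {1..n}"
proof -
  assume n: "n > 0"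
  then have "(a - 1) mod int n < int n"
    by simp
  then have "int (mod1 a n) \<le> int n"
    using int_mod1[OF n, of a] by linarith
  then have "mod1 a n \<le> n"
    by (simp only: of_nat_le_iff)
  then show ?thesis
    by (simp add: mod1_def)
qed

lemma int_mod1_mod: "n > 0 \<Longrightarrow> (int (mod1 a n) + b) mod int n = (a + b) mod int n"
proof -
  assume n: "n > 0"
  have "((a - 1) mod int n + (1 + b)) mod int n = (a - 1 + (1 + b)) mod int n"
    by (rule mod_add_left_eq)
  then show ?thesis
    using int_mod1[OF n, of a] by (simp add: algebra_simps)
qed

lemma mod1_eq_self:
  assumes "1 \<le> a" "a \<le> n"
  shows "mod1 (int a) n = a"
  using assms by (simp add: mod1_def nat_mod_distrib nat_diff_distrib)

lemma mod1_cong: "a mod int n = b mod int n \<Longrightarrow> mod1 a n = mod1 b n"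
  unfolding mod1_def by (metis mod_diff_left_eq)

text \<open>Inverse to (i, k) |-> k * p + i with i between 1 and p; the shift by 1 keeps the
  remainder in that range.\<close>

definition row_var :: "nat \<Rightarrow> nat \<Rightarrow> nat \<Rightarrow> zindex" where
  "row_var p r c = ((r - 1) mod p + 1, c, (r - 1) div p)"

text \<open>
  \<open>point_var p n (r, d)\<close> is the variable at the \<open>d\<close>-th place (counted from 0) among the
  variables of row \<open>r = k * p + i\<close> in the order of the variables.
\<close>

definition point_var :: "nat \<Rightarrow> nat \<Rightarrow> nat \<times> nat \<Rightarrow> zindex" where
  "point_var p n x = row_var p (fst x) (mod1 (int (fst x + snd x)) n)"

lemma row_var_row_eq:
  assumes "row_var p r c = row_var p r' c'" "1 \<le> r" "1 \<le> r'"
  shows "r = r'"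
proof -
  have "r - 1 = r' - 1"
    using assms(1) unfolding row_var_def by (metis add_right_cancel div_mult_mod_eq prod.inject)
  then show ?thesis
    using assms(2,3) by linarith
qed

lemma inj_on_point_var:
  assumes "n > 0"
  shows "inj_on (point_var p n) {x. 1 \<le> fst x \<and> snd x < n}"
proof (rule inj_onI, clarsimp)
  fix r d r' d'
  assume a: "point_var p n (r, d) = point_var p n (r', d')" "Suc 0 \<le> r" "d < n" "Suc 0 \<le> r'" "d' < n"
  then have r: "r = r'"
    by (auto simp: point_var_def intro: row_var_row_eq)
  then have "mod1 (int (r + d)) n = mod1 (int (r + d')) n"
    using a(1) by (simp add: point_var_def row_var_def)
  then have "(int (r + d) + - int r) mod int n = (int (r + d') + - int r) mod int n"
    using int_mod1_mod[OF assms] by metis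
  then show "r = r' \<and> d = d'"
    using r a by simp
qed

text \<open>An element that continues a run gives no maximal element. It gets offset 0, the first
  variable of its row, so that every row still contributes one variable. The element 1 gets offset 0
  as well.\<close>

definition column_offset :: "nat set \<Rightarrow> nat \<Rightarrow> nat" where
  "column_offset A a = (if a - 1 \<in> A then 0 else a - 1)"

text \<open>Elements are taken from the largest one (j = 1) downwards: just before the element with
  index p - j, counted from 0, the staircase has height \<open>snd s + j\<close>.\<close>

definition symbol_point :: "nat \<Rightarrow> nat set \<times> nat \<Rightarrow> nat \<Rightarrow> nat \<times> nat" where
  "symbol_point p s j = (snd s + j, column_offset (fst s) (nth_elem (fst s) (p - j)))"

definition symbol_monom :: "nat \<Rightarrow> nat \<Rightarrow> nat set \<times> nat \<Rightarrow> zindex monom" where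
  "symbol_monom p n s = (\<Sum>j=1..p. Poly_Mapping.single (point_var p n (symbol_point p s j)) 1)"

section \<open>Corners of staircases\<close>

lemma nth_elem_mem: "finite A \<Longrightarrow> j < card A \<Longrightarrow> nth_elem A j \<in> A"
  using bij_betw_apply[OF bij_betw_nth_elem, of A j] by simp

lemma count_le_nth_elem:
  assumes "finite A" "j < card A"
  shows "count_le A (nth_elem A j) = j + 1"
proof -
  have "j < count_le A (nth_elem A j)"
    using nth_elem_le_iff[OF assms, of "nth_elem A j"] by simp
  moreover have "count_le A (nth_elem A j) \<le> j + 1"
  proof (cases "j + 1 < card A")
    case True
    then show ?thesis
      using nth_elem_le_iff[OF assms(1) True, of "nth_elem A j"] nth_elem_less[OF assms(1), of j "j + 1"]
      by simp
  next
    case False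
    then show ?thesis
      using count_le_le_card[OF assms(1), of "nth_elem A j"] by simp
  qed
  ultimately show ?thesis
    by simp
qed

lemma ex_nth_elem:
  assumes "finite A" "a \<in> A"
  obtains j where "j < card A" "a = nth_elem A j"
proof -
  have "a \<in> nth_elem A ` {0..<card A}"
    using assms by (simp only: bij_betw_imp_surj_on[OF bij_betw_nth_elem])
  then show ?thesis
    using that by auto
qed

lemma count_le_Suc:
  assumes "finite A"
  shows "count_le A (Suc x) = count_le A x + (if Suc x \<in> A then 1 else 0)"
proof -
  have "{a\<in>A. a \<le> Suc x} = (if Suc x \<in> A then insert (Suc x) {a\<in>A. a \<le> x} else {a\<in>A. a \<le> x})"
    by (auto simp: le_Suc_eq)
  then show ?thesis
    using assms by (simp add: count_le_def)
qed

lemma count_le_mono: "finite A \<Longrightarrow> x \<le> y \<Longrightarrow> count_le A x \<le> count_le A y"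
  unfolding count_le_def by (rule card_mono) auto

lemma psubset_zero:
  assumes "A \<in> psubsets p n"
  shows "0 \<notin> A" "count_le A 0 = 0"
  using psubsetsD(1)[OF assms] by (auto simp: count_le_def)

lemma count_le_eq_imp_eq:
  assumes "A \<in> psubsets p n" "B \<in> psubsets p n" "\<And>x. count_le A x = count_le B x"
  shows "A = B"
proof -
  have "a \<in> A \<longleftrightarrow> a \<in> B" for a
  proof (cases a)
    case 0
    then show ?thesis
      using psubset_zero(1) assms(1,2) by auto
  next
    case (Suc x)
    then show ?thesis
      using count_le_Suc[of A x] count_le_Suc[of B x] assms psubsetsD(3) by (auto split: if_splits)
  qed
  then show ?thesis
    by blast
qed

lemma symbol_le_refl: "symbol_le s s"
  by (simp add: symbol_le_def)

lemma symbol_le_trans: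
  assumes "symbol_le s t" "symbol_le t u"
  shows "symbol_le s u"
  unfolding symbol_le_def
proof (intro conjI allI)
  show "snd s \<le> snd u"
    using assms by (simp add: symbol_le_def)
  fix x
  have "count_le (fst u) x \<le> count_le (fst t) x + (snd u - snd t)"
    "count_le (fst t) x \<le> count_le (fst s) x + (snd t - snd s)" "snd s \<le> snd t" "snd t \<le> snd u"
    using assms by (auto simp: symbol_le_def)
  then show "count_le (fst u) x \<le> count_le (fst s) x + (snd u - snd s)"
    by linarith
qed

lemma ex_top:
  assumes "w \<noteq> {#}" "\<forall>s\<in>#w. \<forall>t\<in>#w. symbol_le s t \<or> symbol_le t s"
  shows "\<exists>t\<in>#w. \<forall>s\<in>#w. symbol_le s t"
  using assms
proof (induction w)
  case (add x w)
  show ?case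
  proof (cases "w = {#}")
    case True
    then show ?thesis
      by (simp add: symbol_le_refl)
  next
    case False
    then obtain t where t: "t \<in># w" "\<forall>s\<in>#w. symbol_le s t"
      using add by auto
    have "symbol_le x t \<or> symbol_le t x"
      using add.prems(2) t(1) by simp
    then show ?thesis
    proof
      assume "symbol_le x t"
      then show ?thesis
        using t by (intro bexI[of _ t]) auto
    next
      assume tx: "symbol_le t x"
      have "symbol_le s x" if "s \<in># w" for s
        using t(2) that tx by (blast intro: symbol_le_trans)
      then show ?thesis
        using symbol_le_refl[of x] by (intro bexI[of _ x]) auto
    qed
  qed
qed simp

text \<open>
  Up to coordinates, the points of a symbol are the maximal elements of its order ideal, together
  with dummy points of offset 0 in the rows without such an element. The inequality below says that
  the order ideal of \<open>t\<close> contains the point.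
\<close>

lemma symbol_point_bound:
  assumes s: "fst s \<in> psubsets p n" and t: "fst t \<in> psubsets p n" and le: "symbol_le s t"
    and j: "j \<in> {1..p}"
  shows "count_le (fst t) (snd (symbol_point p s j)) + fst (symbol_point p s j) \<le> snd t + p"
proof -
  define a where "a = nth_elem (fst s) (p - j)"
  have lt: "p - j < card (fst s)"
    using j psubsetsD(2)[OF s] by auto
  have a: "a \<in> fst s" "count_le (fst s) a = p - j + 1"
    using nth_elem_mem[OF psubsetsD(3)[OF s] lt] count_le_nth_elem[OF psubsetsD(3)[OF s] lt]
    by (simp_all add: a_def)
  have k: "snd s \<le> snd t"
    using le by (simp add: symbol_le_def)
  show ?thesis
  proof (cases "a - 1 \<in> fst s")
    case True
    then show ?thesis
      using j k psubset_zero(2)[OF t] by (simp add: symbol_point_def column_offset_def a_def[symmetric])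
  next
    case False
    have "a \<noteq> 0"
      using a(1) psubset_zero(1)[OF s] by metis
    then have "count_le (fst s) a = count_le (fst s) (a - 1) + 1"
      using count_le_Suc[OF psubsetsD(3)[OF s], of "a - 1"] a(1) by simp
    moreover have "count_le (fst t) (a - 1) \<le> count_le (fst s) (a - 1) + (snd t - snd s)"
      using le unfolding symbol_le_def by blast
    moreover have "symbol_point p s j = (snd s + j, a - 1)"
      using False by (simp add: symbol_point_def column_offset_def a_def[symmetric])
    moreover have "1 \<le> j" "j \<le> p"
      using j by auto
    ultimately show ?thesis
      unfolding fst_conv snd_conv using a(2) k by simp
  qed
qed

text \<open>A staircase is bounded by its corners. If x + 1 lies in \<open>A\<close>, the bound at x
  carries over. Otherwise it is read off at the next element a of \<open>A\<close>: the predecessor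
  of a is not in \<open>A\<close>, and \<open>count_le A\<close> is constant from x + 1 to a - 1.
  Beyond the last element both counts are at most p.\<close>

lemma count_le_determined:
  assumes A: "A \<in> psubsets p n" and B: "B \<in> psubsets p n"
    and bound: "\<And>j. j \<in> {1..p} \<Longrightarrow>
      count_le B (snd (symbol_point p (A, k) j)) + fst (symbol_point p (A, k) j) \<le> k + p"
  shows "count_le B x \<le> count_le A x"
proof (induction x)
  case 0
  then show ?case
    using psubset_zero(2)[OF B] by simp
next
  case (Suc x)
  note fin = psubsetsD(3)[OF A] psubsetsD(3)[OF B]
  show ?case
  proof (cases "Suc x \<in> A")
    case True
    then show ?thesis
      using Suc count_le_Suc[OF fin(1), of x] count_le_Suc[OF fin(2), of x] by simp
  next
    case notin: False
    show ?thesis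
    proof (cases "\<exists>a\<in>A. Suc x < a")
      case False
      then have "{a\<in>A. a \<le> Suc x} = A"
        by (auto simp: not_less)
      then show ?thesis
        using count_le_le_card[OF fin(2), of "Suc x"] psubsetsD(2)[OF A] psubsetsD(2)[OF B]
        by (simp add: count_le_def)
    next
      case True
      define a where "a = (LEAST a. a \<in> A \<and> Suc x < a)"
      have a: "a \<in> A" "Suc x < a"
        using LeastI_ex[of "\<lambda>a. a \<in> A \<and> Suc x < a"] True unfolding a_def by blast+
      have least: "b \<le> Suc x \<or> a \<le> b" if "b \<in> A" for b
        using that not_le Least_le[of "\<lambda>a. a \<in> A \<and> Suc x < a" b] unfolding a_def by blast
      have pred: "a - 1 \<notin> A"
        using least[of "a - 1"] a notin by (cases "a - 1 = Suc x") auto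
      have "{b\<in>A. b \<le> a} = insert a {b\<in>A. b \<le> Suc x}"
        using a least by force
      then have ca: "count_le A a = count_le A (Suc x) + 1"
        using fin(1) a(2) by (simp add: count_le_def)
      obtain i where i: "i < card A" "a = nth_elem A i"
        using ex_nth_elem[OF fin(1) a(1)] .
      have ci: "count_le A a = i + 1"
        using count_le_nth_elem[OF fin(1) i(1)] i(2) by simp
      have ip: "i < p"
        using i(1) psubsetsD(2)[OF A] by simp
      have "symbol_point p (A, k) (p - i) = (k + (p - i), a - 1)"
        using ip pred i(2) by (simp add: symbol_point_def column_offset_def)
      then have "count_le B (a - 1) + (k + (p - i)) \<le> k + p"
        using bound[of "p - i"] ip by simp
      moreover have "count_le B (Suc x) \<le> count_le B (a - 1)"
        using count_le_mono[OF fin(2)] a(2) by simp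
      ultimately show ?thesis
        using ca ci ip by linarith
    qed
  qed
qed

section \<open>Supports of products of symbol monomials\<close>

lemma keys_sum_single: 
  "finite J \<Longrightarrow> Poly_Mapping.keys (\<Sum>j\<in>J. Poly_Mapping.single (f j) (1::nat)) = f ` J"
  by (auto simp: in_keys_iff lookup_sum lookup_single when_def split: if_splits)

lemma keys_sum_mset:
  "Poly_Mapping.keys (\<Sum>s\<in>#w. F s) = (\<Union>s\<in>set_mset w. Poly_Mapping.keys (F s))" for F :: "_ \<Rightarrow> 'v monom"
proof (induction w)
  case (add s w)
  have "Poly_Mapping.keys (F s + (\<Sum>s\<in>#w. F s)) = Poly_Mapping.keys (F s) \<union> Poly_Mapping.keys (\<Sum>s\<in>#w. F s)"
    by (auto simp: in_keys_iff lookup_add)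
  then show ?case
    using add by simp
qed simp

definition points :: "nat \<Rightarrow> (nat set \<times> nat) multiset \<Rightarrow> (nat \<times> nat) set" where
  "points p w = (\<Union>s\<in>set_mset w. symbol_point p s ` {1..p})"

lemma keys_symbol_monoms:
  "Poly_Mapping.keys (\<Sum>s\<in>#w. symbol_monom p n s) = point_var p n ` points p w"
  unfolding keys_sum_mset symbol_monom_def keys_sum_single[OF finite_atLeastAtMost] points_def
  by blast

lemma points_range:
  assumes "set_mset w \<subseteq> psubsets p n \<times> UNIV" "p < n"
  shows "points p w \<subseteq> {x. 1 \<le> fst x \<and> snd x < n}"
proof
  fix x
  assume "x \<in> points p w"
  then obtain s j where s: "s \<in># w" "j \<in> {1..p}" "x = symbol_point p s j"
    by (auto simp: points_def)
  then have A: "fst s \<in> psubsets p n"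
    using assms(1) by auto
  then have "nth_elem (fst s) (p - j) \<in> fst s"
    using s(2) psubsetsD[OF A] by (intro nth_elem_mem) auto
  then have "nth_elem (fst s) (p - j) \<le> n"
    using psubsetsD(1)[OF A] by auto
  then show "x \<in> {x. 1 \<le> fst x \<and> snd x < n}"
    using s assms(2) by (auto simp: symbol_point_def column_offset_def)
qed

text \<open>Each top lies above all common points, in particular above the corners of the other top.
  The points in the rows \<open>snd t + p\<close> and \<open>snd t' + p\<close> compare the levels;
  \<open>count_le_determined\<close> then compares the subsets both ways.\<close>

lemma top_determined:
  assumes w: "set_mset w \<subseteq> psubsets p n \<times> UNIV" "set_mset w' \<subseteq> psubsets p n \<times> UNIV"
    and pts: "points p w = points p w'" and p: "1 \<le> p"
    and t: "t \<in># w" "\<forall>s\<in>#w. symbol_le s t" and t': "t' \<in># w'" "\<forall>s\<in>#w'. symbol_le s t'"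
  shows "t = t'"
proof -
  have ps: "fst t \<in> psubsets p n" "fst t' \<in> psubsets p n"
    using w t(1) t'(1) by auto
  have bound: "count_le (fst t) (snd x) + fst x \<le> snd t + p"
    "count_le (fst t') (snd x) + fst x \<le> snd t' + p" if x: "x \<in> points p w" for x
  proof -
    obtain s j where "s \<in># w" "j \<in> {1..p}" "x = symbol_point p s j"
      using x by (auto simp: points_def)
    then show "count_le (fst t) (snd x) + fst x \<le> snd t + p"
      using symbol_point_bound[OF _ ps(1), of s j] t(2) w(1) by auto
    have "x \<in> points p w'"
      using x pts by simp
    then obtain s j where "s \<in># w'" "j \<in> {1..p}" "x = symbol_point p s j"
      by (auto simp: points_def)
    then show "count_le (fst t') (snd x) + fst x \<le> snd t' + p"
      using symbol_point_bound[OF _ ps(2), of s j] t'(2) w(2) by auto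
  qed
  have mem: "symbol_point p t j \<in> points p w" "symbol_point p t' j \<in> points p w" if "j \<in> {1..p}" for j
  proof -
    show "symbol_point p t j \<in> points p w"
      using that t(1) unfolding points_def by blast
    have "symbol_point p t' j \<in> points p w'"
      using that t'(1) unfolding points_def by blast
    then show "symbol_point p t' j \<in> points p w"
      by (simp add: pts)
  qed
  have "fst (symbol_point p t p) = snd t + p" "fst (symbol_point p t' p) = snd t' + p"
    by (simp_all add: symbol_point_def)
  then have k: "snd t = snd t'"
    using bound(2)[OF mem(1), of p] bound(1)[OF mem(2), of p] p by simp
  have "count_le (fst t') x \<le> count_le (fst t) x" for x
    by (rule count_le_determined[OF ps, of "snd t"])
      (unfold prod.collapse, simp only: k bound(2)[OF mem(1)])
  moreover have "count_le (fst t) x \<le> count_le (fst t') x" for x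
    by (rule count_le_determined[OF ps(2,1), of "snd t'"])
      (unfold prod.collapse, simp only: k[symmetric] bound(1)[OF mem(2)])
  ultimately have "fst t = fst t'"
    by (intro count_le_eq_imp_eq[OF ps] antisym)
  then show ?thesis
    using k by (simp add: prod_eq_iff)
qed

lemma points_eq_if_monoms_eq:
  assumes "p < n" "set_mset w \<subseteq> psubsets p n \<times> UNIV" "set_mset w' \<subseteq> psubsets p n \<times> UNIV"
    and "(\<Sum>s\<in>#w. symbol_monom p n s) = (\<Sum>s\<in>#w'. symbol_monom p n s)"
  shows "points p w = points p w'"
proof -
  have n: "n > 0"
    using assms(1) by simp
  have "point_var p n ` points p w = point_var p n ` points p w'"
    using keys_symbol_monoms[of p n w] keys_symbol_monoms[of p n w'] assms(4) by simp
  then show ?thesis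
    by (simp only: inj_on_image_eq_iff[OF inj_on_point_var[OF n]
          points_range[OF assms(2,1)] points_range[OF assms(3,1)]])
qed

lemma points_eq_empty_iff:
  assumes "1 \<le> p"
  shows "points p w = {} \<longleftrightarrow> w = {#}"
proof
  assume e: "points p w = {}"
  show "w = {#}"
  proof (rule ccontr)
    assume "w \<noteq> {#}"
    then obtain s where "s \<in># w"
      by (rule multiset_nonemptyE)
    moreover have "p \<in> {1..p}"
      using assms by simp
    ultimately have "symbol_point p s p \<in> points p w"
      unfolding points_def by blast
    then show False
      using e by simp
  qed
qed (simp add: points_def)

text \<open>The support alone reveals the top. Multiplicities are accounted for because one copy of
  the monomial of the top is cancelled on both sides before the next round.\<close>

lemma symbol_monoms_inj:
  assumes "1 \<le> p" "p < n"
    and "set_mset w \<subseteq> psubsets p n \<times> UNIV" "\<forall>s\<in>#w. \<forall>t\<in>#w. symbol_le s t \<or> symbol_le t s"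
    and "set_mset w' \<subseteq> psubsets p n \<times> UNIV" "\<forall>s\<in>#w'. \<forall>t\<in>#w'. symbol_le s t \<or> symbol_le t s"
    and "(\<Sum>s\<in>#w. symbol_monom p n s) = (\<Sum>s\<in>#w'. symbol_monom p n s)"
  shows "w = w'"
  using assms(3-7)
proof (induction "size w" arbitrary: w w')
  case 0
  have "points p w = points p w'"
    by (rule points_eq_if_monoms_eq[OF assms(2) 0(2,4,6)])
  moreover have w: "w = {#}"
    using 0(1) by simp
  ultimately have "points p w' = {}"
    using points_eq_empty_iff[OF assms(1), of w] by metis
  then show ?case
    using points_eq_empty_iff[OF assms(1), of w'] w by metis
next
  case (Suc m)
  have pw: "points p w = points p w'"
    by (rule points_eq_if_monoms_eq[OF assms(2) Suc.prems(1,3,5)])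
  have ne: "w \<noteq> {#}"
    using Suc.hyps(2) by auto
  then have ne': "w' \<noteq> {#}"
    using points_eq_empty_iff[OF assms(1)] pw by metis
  obtain t where t: "t \<in># w" "\<forall>s\<in>#w. symbol_le s t"
    using ex_top[OF ne Suc.prems(2)] by blast
  obtain t' where t': "t' \<in># w'" "\<forall>s\<in>#w'. symbol_le s t'"
    using ex_top[OF ne' Suc.prems(4)] by blast
  have tt: "t = t'"
    by (rule top_determined[OF Suc.prems(1,3) pw assms(1) t t'])
  obtain v v' where v: "w = add_mset t v" "w' = add_mset t v'"
    using t(1) t'(1) tt by (metis insert_DiffM)
  have "v = v'"
    by (rule Suc.hyps(1)) (use Suc v in auto)
  then show ?case
    using v by simp
qed

section \<open>Leading monomials for the PBW order\<close>

lemma monom_degree_eq: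
  assumes "finite S" "Poly_Mapping.keys m \<subseteq> S"
  shows "monom_degree m = (\<Sum>v\<in>S. Poly_Mapping.lookup m v)"
  unfolding monom_degree_def
  by (rule sum.mono_neutral_left) (use assms in \<open>auto simp: in_keys_iff\<close>)

lemma monom_degree_add: "monom_degree (a + b) = monom_degree a + monom_degree b"
proof -
  let ?S = "Poly_Mapping.keys a \<union> Poly_Mapping.keys b"
  have "monom_degree (a + b) = (\<Sum>v\<in>?S. Poly_Mapping.lookup (a + b) v)"
    by (rule monom_degree_eq[OF _ Poly_Mapping.keys_add]) simp
  also have "\<dots> = monom_degree a + monom_degree b"
    using monom_degree_eq[of ?S a] monom_degree_eq[of ?S b] by (simp add: lookup_add sum.distrib)
  finally show ?thesis .
qed

lemma monom_degree_sum_single: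
  "finite J \<Longrightarrow> monom_degree (\<Sum>j\<in>J. Poly_Mapping.single (f j) 1) = card J"
proof (induction J rule: finite_induct)
  case empty
  then show ?case
    by (simp add: monom_degree_def)
next
  case (insert x J)
  have "monom_degree (Poly_Mapping.single (f x) (1::nat)) = 1"
    by (simp add: monom_degree_def)
  then show ?case
    using insert by (simp add: monom_degree_add)
qed

lemma ex_last:
  assumes "finite S" "S \<noteq> {}" "\<And>v. \<not> before v v"
    and "\<And>u v w. u \<in> S \<Longrightarrow> v \<in> S \<Longrightarrow> w \<in> S \<Longrightarrow> before u v \<Longrightarrow> before v w \<Longrightarrow> before u w"
  shows "\<exists>v\<in>S. \<forall>w\<in>S. \<not> before v w"
  using assms(1,2,4)
proof (induction S rule: finite_ne_induct)
  case (singleton x)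
  then show ?case
    using assms(3) by simp
next
  case (insert x S)
  have "\<exists>v\<in>S. \<forall>w\<in>S. \<not> before v w"
    by (rule insert.IH) (meson insert.prems insertI2)
  then obtain v where v: "v \<in> S" "\<forall>w\<in>S. \<not> before v w"
    by auto
  show ?case
  proof (cases "before v x")
    case True
    have "\<not> before x w" if "w \<in> S" for w
      using v that True insert.prems[of v x w] by auto
    then show ?thesis
      using assms(3)[of x] by auto
  qed (use v in auto)
qed

definition monoms_in :: "'v set \<Rightarrow> 'v monom set" where
  "monoms_in V = {m. Poly_Mapping.keys m \<subseteq> V}"

lemma degrevlex_monomial_order:
  assumes irrefl: "\<And>v. \<not> before v v"
    and trans: "\<And>u v w. u \<in> V \<Longrightarrow> v \<in> V \<Longrightarrow> w \<in> V \<Longrightarrow> before u v \<Longrightarrow> before v w \<Longrightarrow> before u w"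
    and total: "\<And>v w. v \<in> V \<Longrightarrow> w \<in> V \<Longrightarrow> v \<noteq> w \<Longrightarrow> before v w \<or> before w v"
  shows "monomial_order (degrevlex before) (monoms_in V)"
proof
  have outside: "Poly_Mapping.lookup a v = 0" if "a \<in> monoms_in V" "v \<notin> V" for a v
    using that by (metis (mono_tags, lifting) in_keys_iff mem_Collect_eq monoms_in_def subsetD)
  have inside: "v \<in> V" if "a \<in> monoms_in V" "Poly_Mapping.lookup a v > Poly_Mapping.lookup b v" for a b v
    using outside[OF that(1)] that(2) by fastforce
  fix a b c :: "'a monom"
  show "\<not> degrevlex before a a"
    by (simp add: degrevlex_def)
  show "0 \<in> monoms_in V"
    by (simp add: monoms_in_def)
  show "a + b \<in> monoms_in V" if "a \<in> monoms_in V" "b \<in> monoms_in V"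
    using that Poly_Mapping.keys_add[of a b] by (auto simp: monoms_in_def)
  show "degrevlex before (a + c) (b + c)" if "degrevlex before a b"
    using that by (auto simp: degrevlex_def monom_degree_add lookup_add)
  show "degrevlex before a c"
    if M: "a \<in> monoms_in V" "b \<in> monoms_in V" "c \<in> monoms_in V"
      and ab: "degrevlex before a b" and bc: "degrevlex before b c"
  proof (cases "monom_degree a < monom_degree c")
    case True
    then show ?thesis
      by (simp add: degrevlex_def)
  next
    case False
    then have deg: "monom_degree a = monom_degree b" "monom_degree b = monom_degree c"
      using ab bc by (auto simp: degrevlex_def)
    obtain u where u: "Poly_Mapping.lookup a u > Poly_Mapping.lookup b u"
      "\<And>w. before u w \<Longrightarrow> Poly_Mapping.lookup a w = Poly_Mapping.lookup b w"
      using ab deg by (auto simp: degrevlex_def)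
    obtain v where v: "Poly_Mapping.lookup b v > Poly_Mapping.lookup c v"
      "\<And>w. before v w \<Longrightarrow> Poly_Mapping.lookup b w = Poly_Mapping.lookup c w"
      using bc deg by (auto simp: degrevlex_def)
    have V: "u \<in> V" "v \<in> V"
      using inside M u(1) v(1) by blast+
    have eq: "Poly_Mapping.lookup a w = Poly_Mapping.lookup c w" if "before u w" "before v w" for w
      using u(2)[OF that(1)] v(2)[OF that(2)] by simp
    \<comment> \<open>\<open>degrevlex\<close> quantifies over all later variables, including those
      outside \<open>V\<close>, where \<open>before\<close> is not controlled. There both exponents
      vanish.\<close>
    have outV: "Poly_Mapping.lookup a w = Poly_Mapping.lookup c w" if "w \<notin> V" for w
      using outside M that by simp
    \<comment> \<open>The later of the two deciding variables decides between a and c.\<close>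
    consider "u = v" | "before u v" | "before v u"
      using total V by blast
    then obtain x where "Poly_Mapping.lookup a x > Poly_Mapping.lookup c x"
      "\<And>w. w \<in> V \<Longrightarrow> before x w \<Longrightarrow> before u w \<and> before v w"
    proof cases
      case 1
      then show ?thesis
        using that[of u] u(1) v(1) by simp
    next
      case 2
      then show ?thesis
        using that[of v] u(2)[OF 2] v(1) trans[OF V] by simp
    next
      case 3
      then show ?thesis
        using that[of u] v(2)[OF 3] u(1) trans[OF V(2,1)] by simp
    qed
    then show ?thesis
      unfolding degrevlex_def using deg eq outV by metis
  qed
  show "degrevlex before a b \<or> degrevlex before b a"
    if M: "a \<in> monoms_in V" "b \<in> monoms_in V" and ne: "a \<noteq> b"
  proof (cases "monom_degree a = monom_degree b")
    case True
    define S where "S = {v. Poly_Mapping.lookup a v \<noteq> Poly_Mapping.lookup b v}"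
    have "S \<subseteq> Poly_Mapping.keys a \<union> Poly_Mapping.keys b"
      by (auto simp: S_def in_keys_iff)
    then have fin: "finite S" "S \<subseteq> V"
      using M finite_subset[of S "Poly_Mapping.keys a \<union> Poly_Mapping.keys b"] by (auto simp: monoms_in_def)
    have "S \<noteq> {}"
      using ne by (auto simp: S_def poly_mapping_eq_iff fun_eq_iff)
    then have "\<exists>v\<in>S. \<forall>w\<in>S. \<not> before v w"
    proof (intro ex_last[OF fin(1) _ irrefl])
      fix u v w
      assume "u \<in> S" "v \<in> S" "w \<in> S" "before u v" "before v w"
      then show "before u w"
        using trans[of u v w] fin(2) by blast
    qed
    then obtain v where v: "Poly_Mapping.lookup a v \<noteq> Poly_Mapping.lookup b v"
      "\<And>w. before v w \<Longrightarrow> Poly_Mapping.lookup a w = Poly_Mapping.lookup b w"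
      by (auto simp: S_def)
    then show ?thesis
      unfolding degrevlex_def using True by (metis nat_neq_iff)
  qed (auto simp: degrevlex_def)
qed

lemma int_cyclic_pos:
  assumes "n > 0" "j \<in> {1..n}"
  shows "int (cyclic_pos n (mod1 a n) j) = (int j - a) mod int n"
proof -
  let ?c = "mod1 a n"
  have c: "?c \<in> {1..n}"
    by (rule mod1_range[OF assms(1)])
  have "(int (mod1 a n) + - (int j)) mod int n = (a + - (int j)) mod int n"
    by (rule int_mod1_mod[OF assms(1)])
  then have "(int j - int ?c) mod int n = (int j - a) mod int n"
    by (metis diff_conv_add_uminus minus_diff_eq mod_minus_cong)
  moreover have "int (cyclic_pos n ?c j) = (int j - int ?c) mod int n"
  proof (cases "?c \<le> j")
    case True
    then have "(int j - int ?c) mod int n = int j - int ?c"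
      using c assms by (intro mod_pos_pos_trivial) auto
    then show ?thesis
      using True by (simp add: cyclic_pos_def)
  next
    case False
    have "(int j - int ?c) mod int n = (int j - int ?c + int n) mod int n"
      by simp
    also have "\<dots> = int j - int ?c + int n"
      using False c assms by (intro mod_pos_pos_trivial) auto
    finally show ?thesis
      using False c by (simp add: cyclic_pos_def)
  qed
  ultimately show ?thesis
    by simp
qed

section \<open>The PBW order in terms of rows and offsets\<close>

definition grid_vars :: "nat \<Rightarrow> nat \<Rightarrow> zindex set" where
  "grid_vars p n = {row_var p r c | r c. 1 \<le> r \<and> c \<in> {1..n}}"

lemma less_iff_div_mod:
  "x < y \<longleftrightarrow> x div p < y div p \<or> x div p = y div p \<and> x mod p < y mod (p::nat)"
proof (cases "x div p" "y div p" rule: linorder_cases)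
  case less
  then show ?thesis
    using div_le_mono[of y x p] by (auto simp: not_less[symmetric])
next
  case equal
  have "p * (x div p) + x mod p = x" "p * (y div p) + y mod p = y"
    by simp_all
  then show ?thesis
    using equal by (metis less_irrefl nat_add_left_cancel_less)
next
  case greater
  then show ?thesis
    using div_le_mono[of x y p] by (auto simp: not_less[symmetric])
qed

text \<open>Comparing quotient and remainder by p lexicographically is comparing row numbers, and
  the cyclic order of row r starts at the column congruent to r.\<close>

lemma pbw_before_row_var:
  assumes "1 \<le> p" "n > 0" "1 \<le> r" "1 \<le> r'" "c \<in> {1..n}" "c' \<in> {1..n}"
  shows "pbw_before p n (row_var p r c) (row_var p r' c') \<longleftrightarrow>
    r < r' \<or> r = r' \<and> (int c - int r) mod int n < (int c' - int r) mod int n"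
proof -
  have row: "(r - 1) div p * p + ((r - 1) mod p + 1) = r"
    using assms(3) div_mult_mod_eq[of "r - 1" p] by linarith
  let ?C = "mod1 (int r) n"
  have cyc: "cyclic_pos n ?C c < cyclic_pos n ?C c' \<longleftrightarrow>
      (int c - int r) mod int n < (int c' - int r) mod int n"
    using int_cyclic_pos[OF assms(2,5), of "int r"] int_cyclic_pos[OF assms(2,6), of "int r"] by linarith
  have "pbw_before p n (row_var p r c) (row_var p r' c') \<longleftrightarrow>
    (r - 1) div p < (r' - 1) div p \<or> (r - 1) div p = (r' - 1) div p \<and>
     ((r - 1) mod p < (r' - 1) mod p \<or> (r - 1) mod p = (r' - 1) mod p \<and>
      cyclic_pos n ?C c < cyclic_pos n ?C c')"
    unfolding pbw_before_def row_var_def prod.case Let_def row by simp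
  also have "\<dots> \<longleftrightarrow> r - 1 < r' - 1 \<or> r - 1 = r' - 1 \<and> cyclic_pos n ?C c < cyclic_pos n ?C c'"
    using less_iff_div_mod[of "r - 1" "r' - 1" p] div_mult_mod_eq by metis
  finally show ?thesis
    using cyc assms(3,4) by auto
qed

lemma pbw_before_irrefl: "\<not> pbw_before p n v v"
  by (cases v) (simp add: pbw_before_def Let_def)

lemma pbw_monomial_order:
  assumes "1 \<le> p" "n > 0"
  shows "monomial_order (pbw_less p n) (monoms_in (grid_vars p n))"
  unfolding pbw_less_def
proof (rule degrevlex_monomial_order[OF pbw_before_irrefl])
  fix u v w
  assume "u \<in> grid_vars p n" "v \<in> grid_vars p n" "w \<in> grid_vars p n"
    and before: "pbw_before p n u v" "pbw_before p n v w"
  then obtain r c r' c' r'' c'' where "u = row_var p r c" "v = row_var p r' c'" "w = row_var p r'' c''"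
    "1 \<le> r" "1 \<le> r'" "1 \<le> r''" "c \<in> {1..n}" "c' \<in> {1..n}" "c'' \<in> {1..n}"
    unfolding grid_vars_def by blast
  then show "pbw_before p n u w"
    using before by (auto simp: pbw_before_row_var[OF assms])
next
  fix v w
  assume "v \<in> grid_vars p n" "w \<in> grid_vars p n" and ne: "v \<noteq> w"
  then obtain r c r' c' where *: "v = row_var p r c" "w = row_var p r' c'"
    "1 \<le> r" "1 \<le> r'" "c \<in> {1..n}" "c' \<in> {1..n}"
    unfolding grid_vars_def by blast
  have "c = c'" if "(int c - int r) mod int n = (int c' - int r) mod int n"
  proof -
    have "int n dvd int c - int c'"
      using that by (simp add: mod_eq_dvd_iff)
    then show ?thesis
      using * dvd_imp_le_int[of "int c - int c'" "int n"] by (cases "c = c'") auto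
  qed
  moreover have "r \<noteq> r' \<or> c \<noteq> c'"
    using * ne by auto
  ultimately have "r < r' \<or> r' < r \<or> r = r' \<and>
      ((int c - int r) mod int n < (int c' - int r) mod int n \<or>
       (int c' - int r) mod int n < (int c - int r) mod int n)"
    by linarith
  then show "pbw_before p n v w \<or> pbw_before p n w v"
    using * by (auto simp: pbw_before_row_var[OF assms])
qed

section \<open>The leading monomial of a PBW generator\<close>

lemma (in monomial_order) lead_sum_single:
  assumes "finite I" "i0 \<in> I" "c i0 \<noteq> 0" "\<And>i. i \<in> I \<Longrightarrow> m i \<in> M"
    "\<And>i. i \<in> I \<Longrightarrow> i \<noteq> i0 \<Longrightarrow> lt (m i) (m i0)"
  shows "lead (\<Sum>i\<in>I. Poly_Mapping.single (m i) (c i)) (m i0)" (is "lead ?f _")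
proof -
  have sub: "Poly_Mapping.keys ?f \<subseteq> m ` I"
  proof
    fix a
    assume a: "a \<in> Poly_Mapping.keys ?f"
    show "a \<in> m ` I"
    proof (rule ccontr)
      assume "a \<notin> m ` I"
      then have "Poly_Mapping.lookup ?f a = 0"
        unfolding lookup_sum by (intro sum.neutral) (auto simp: lookup_single when_def)
      then show False
        using a by (simp add: in_keys_iff)
    qed
  qed
  have "Poly_Mapping.lookup ?f (m i0) = (\<Sum>i\<in>I. if i = i0 then c i else 0)"
    unfolding lookup_sum
  proof (rule sum.cong[OF refl])
    fix i
    assume "i \<in> I"
    then show "Poly_Mapping.lookup (Poly_Mapping.single (m i) (c i)) (m i0) = (if i = i0 then c i else 0)"
      using assms(5)[of i] irrefl[of "m i0"] by (cases "m i = m i0") (auto simp: lookup_single when_def)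
  qed
  then have "Poly_Mapping.lookup ?f (m i0) = c i0"
    using assms(1,2) by simp
  then show ?thesis
    unfolding lead_def using sub assms by (auto simp: in_keys_iff)
qed

text \<open>\<open>count X j\<close> is the power of t taken from factor j, so multisets of size k
  enumerate the ways to distribute k over the factors.\<close>

lemma fps_nth_prod_column_series:
  fixes p :: nat
  shows "fps_nth (\<Prod>j=0..<p. column_series (\<pi> j) (J j)) k =
    (\<Sum>X\<in>multisets_of_size {0..<p} k.
      Poly_Mapping.single (\<Sum>j=0..<p. Poly_Mapping.single (\<pi> j + 1, J j, count X j) 1) 1)"
proof -
  have prod: "(\<Prod>j\<in>A. Poly_Mapping.single (f j) (1::complex)) = Poly_Mapping.single (\<Sum>j\<in>A. f j) 1"
    if "finite A" for A :: "nat set" and f :: "nat \<Rightarrow> zindex monom"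
    using that by (induction A) (simp_all add: mult_single)
  show ?thesis
    by (subst fps_prod_nth', simp)
      (simp only: column_series_def fps_nth_Abs_fps pvar_def prod[OF finite_atLeastLessThan])
qed

lemma D_expand:
  assumes "I \<in> tuples p n"
  shows "D p n I k = (\<Sum>(\<pi>, X)\<in>{\<pi>. \<pi> permutes {0..<p}} \<times> multisets_of_size {0..<p} k.
    Poly_Mapping.single (\<Sum>j=0..<p. Poly_Mapping.single (\<pi> j + 1, I (j + 1), count X j) 1) (of_int (sign \<pi>)))"
proof -
  have int: "of_int z * Poly_Mapping.single m (1::complex) = Poly_Mapping.single m (of_int z)" for z and m :: "zindex monom"
    using cpoly_scale_of_int[of z "Poly_Mapping.single m 1"] by (simp add: cpoly_scale_single)
  have "D p n I k = (\<Sum>\<pi> | \<pi> permutes {0..<p}. of_int (sign \<pi>) *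
      fps_nth (\<Prod>j=0..<p. column_series (\<pi> j) (I (j + 1))) k)"
    by (simp only: D_eq_minor[OF assms] minor_eq_sum fps_sum_nth fps_nth_of_int_mult)
  then show ?thesis
    by (simp only: fps_nth_prod_column_series sum_distrib_left int sum.cartesian_product)
qed

definition row_monom :: "nat \<Rightarrow> (nat \<Rightarrow> nat) \<Rightarrow> nat \<Rightarrow> zindex monom" where
  "row_monom p I k = (\<Sum>j=1..p. Poly_Mapping.single (row_var p (k + j) (I j)) 1)"

text \<open>Shifting the window by one replaces \<open>k div p\<close> by
  \<open>(k + p) div p\<close>, so the sum grows by 1. This shows that the variables in the rows k +
  1, ..., k + p have total level k.\<close>

lemma sum_div_consecutive:
  assumes "1 \<le> p"
  shows "(\<Sum>j=0..<p. (k + j) div p) = (k::nat)"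
proof (induction k)
  case 0
  then show ?case
    by (simp add: sum.neutral)
next
  case (Suc k)
  have "(\<Sum>j=0..<p. (Suc k + j) div p) + k div p = (\<Sum>j=0..<Suc p. (k + j) div p)"
    using sum.atLeast0_lessThan_Suc_shift[of "\<lambda>j. (k + j) div p" p] by simp
  also have "\<dots> = k + (k + p) div p"
    using Suc by simp
  finally show ?case
    using assms by simp
qed

lemma lookup_sum_single:
  "finite A \<Longrightarrow> Poly_Mapping.lookup (\<Sum>j\<in>A. Poly_Mapping.single (f j) (1::nat)) v = card {j\<in>A. f j = v}"
proof -
  assume "finite A"
  have "Poly_Mapping.lookup (\<Sum>j\<in>A. Poly_Mapping.single (f j) (1::nat)) v = (\<Sum>j\<in>A. if f j = v then 1 else 0)"
    by (simp only: lookup_sum lookup_single when_def)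
  also have "\<dots> = card {j\<in>A. f j = v}"
    using \<open>finite A\<close> by (simp add: sum.If_cases Int_def)
  finally show ?thesis .
qed

text \<open>
  The rows \<open>\<rho> j\<close> of a monomial of \<open>D_I^(k)\<close> are pairwise incongruent modulo \<open>p\<close> and have a
  prescribed sum. If none of them exceeds \<open>k + p\<close>, they are the numbers \<open>k + 1, \<dots>, k + p\<close>.
\<close>

lemma rows_in_window:
  fixes \<rho> :: "nat \<Rightarrow> nat"
  assumes p: "1 \<le> p"
    and incong: "\<And>i j. i < p \<Longrightarrow> j < p \<Longrightarrow> int (\<rho> i) mod int p = int (\<rho> j) mod int p \<Longrightarrow> i = j"
    and sum: "(\<Sum>j=0..<p. \<rho> j) = (\<Sum>j=0..<p. k + j + 1)"
    and le: "\<And>j. j < p \<Longrightarrow> \<rho> j \<le> k + p"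
    and j: "j < p"
  shows "k + 1 \<le> \<rho> j"
proof -
  define x where "x j = k + p - \<rho> j" for j
  have inj: "inj_on (\<lambda>j. x j mod p) {0..<p}"
  proof (rule inj_onI)
    fix i j
    assume ij: "i \<in> {0..<p}" "j \<in> {0..<p}" and eq: "x i mod p = x j mod p"
    have x: "int (x l) = int (k + p) - int (\<rho> l)" if "l < p" for l
      using le[OF that] by (simp add: x_def)
    have "int (x i) mod int p = int (x j) mod int p"
      using eq by (metis of_nat_mod)
    then have "(int (k + p) - int (x i)) mod int p = (int (k + p) - int (x j)) mod int p"
      by (metis mod_diff_right_eq)
    then have "int (\<rho> i) mod int p = int (\<rho> j) mod int p"
      using x ij by simp
    then show "i = j"
      using incong ij by simp
  qed
  have "(\<lambda>j. x j mod p) ` {0..<p} = {0..<p}"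
    by (rule endo_inj_surj[OF _ _ inj]) (use p in auto)
  then have "(\<Sum>j=0..<p. x j mod p) = \<Sum>{0..<p}"
    using sum.reindex[OF inj, of "\<lambda>x. x"] by simp
  moreover have "(\<Sum>j=0..<p. x j) = \<Sum>{0..<p}"
  proof -
    have "(\<Sum>j=0..<p. x j) + (\<Sum>j=0..<p. \<rho> j) = (\<Sum>j=0..<p. k + p)"
      unfolding sum.distrib[symmetric] by (rule sum.cong) (use le in \<open>auto simp: x_def\<close>)
    also have "\<dots> = (\<Sum>j=0..<p. p - Suc j) + (\<Sum>j=0..<p. k + j + 1)"
      unfolding sum.distrib[symmetric] by (rule sum.cong) auto
    also have "(\<Sum>j=0..<p. p - Suc j) = \<Sum>{0..<p}"
      using sum.nat_diff_reindex[of "\<lambda>j. j" p] by (simp add: atLeast0LessThan)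
    finally show ?thesis
      using sum by linarith
  qed
  ultimately have "(\<Sum>j=0..<p. x j mod p) = (\<Sum>j=0..<p. x j)"
    by simp
  then have "x j mod p = x j"
    by (rule sum_mono_inv) (use j in auto)
  moreover have "x j mod p < p"
    using p by simp
  ultimately have "x j < p"
    by (simp only:)
  then show ?thesis
    using le[OF j] by (simp add: x_def)
qed

text \<open>After rotation by k, the order of row k + t starts at column t, and the entry at t is at
  least t. An entry at t' < t is either t', reached only after wrapping around, or above p. In the
  latter case it exceeds the entry at t by the descending condition, or because that entry is
  t.\<close>

lemma pbw_column_first:
  assumes n: "n > 0" and \<alpha>: "pbw_tuple p n (\<lambda>j. mod1 (int (I j) - int k) n)"
    and t: "t \<in> {1..p}" "t' \<in> {1..p}" "t' < t" and pn: "p < n"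
  shows "(int (I t) - int (k + t)) mod int n < (int (I t') - int (k + t)) mod int n"
proof -
  define a where "a j = mod1 (int (I j) - int k) n" for j
  have eq: "(int (I j) - int (k + t)) mod int n = (int (a j) - int t) mod int n" for j
    using int_mod1_mod[OF n, of "int (I j) - int k" "- int t"] by (simp add: a_def algebra_simps)
  have range: "1 \<le> a j" "a j \<le> n" for j
    using mod1_range[OF n, of "int (I j) - int k"] by (simp_all add: a_def)
  have tt: "1 \<le> t" "t \<le> p" "1 \<le> t'" "t' \<le> p"
    using t by auto
  have ne: "a t \<noteq> a t'"
    using \<alpha> t unfolding pbw_tuple_def a_def inj_on_def by (metis less_irrefl)
  have fix1: "a j = j" if "j \<in> {1..p}" "a j \<le> p" for j
    using \<alpha> that unfolding pbw_tuple_def a_def by blast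
  have desc: "a t < a t'" if "p < a t" "p < a t'"
  proof (rule ccontr)
    assume "\<not> a t < a t'"
    then have "a t' < a t"
      using ne by simp
    then have "t < t'"
      using \<alpha> t that(2) unfolding pbw_tuple_def a_def by blast
    then show False
      using t(3) by simp
  qed
  have pos: "(int (a j) - int t) mod int n = int (a j) - int t" if "t \<le> a j" for j
    using that range[of j] tt by (intro mod_pos_pos_trivial) auto
  have neg: "(int (a j) - int t) mod int n = int (a j) - int t + int n" if "a j < t" for j
  proof -
    have "(int (a j) - int t) mod int n = (int (a j) - int t + int n) mod int n"
      by simp
    also have "\<dots> = int (a j) - int t + int n"
      using that range[of j] tt pn by (intro mod_pos_pos_trivial) auto
    finally show ?thesis .
  qed
  have at: "t \<le> a t"
    using fix1[OF t(1)] tt by (cases "a t \<le> p") auto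
  show ?thesis
  proof (cases "a t' \<le> p")
    case True
    then have "a t' = t'"
      using fix1[OF t(2)] by simp
    then show ?thesis
      using eq pos[OF at] neg[of t'] t(3) range[of t] tt by simp
  next
    case False
    have "a t < a t'"
      using False desc fix1[OF t(1)] tt by (cases "a t \<le> p") auto
    then show ?thesis
      using eq pos[OF at] pos[of t'] at by simp
  qed
qed

text \<open>A reverse lexicographic order penalises late variables. A competing monomial either
  reaches a row beyond k + p or permutes the rows k + 1, ..., k + p. In the second case, the last
  row where it deviates holds the column of a tuple entry with smaller index, which comes later in
  that row by \<open>pbw_column_first\<close>.\<close>

lemma lead_D_pbw:
  assumes p: "1 \<le> p" and pn: "p < n" and sym: "(I, k) \<in> pbw_symbols p n"
  shows "monomial_order.lead (pbw_less p n) (monoms_in (grid_vars p n)) (D p n I k) (row_monom p I k)"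
proof -
  have n: "n > 0"
    using pn by simp
  interpret monomial_order "pbw_less p n" "monoms_in (grid_vars p n)"
    by (rule pbw_monomial_order[OF p n])
  define J where "J j = I (j + 1)" for j
  have I: "I \<in> tuples p n" and \<alpha>: "pbw_tuple p n (\<lambda>j. mod1 (int (I j) - int k) n)"
    using sym by (auto simp: pbw_symbols_def)
  have Jr: "J j \<in> {1..n}" if "j < p" for j
    using I that PiE_mem[of I "{1..p}" "\<lambda>_. {1..n}" "j + 1"] by (auto simp: tuples_def J_def)
  have first: "(int (J i) - int (k + i + 1)) mod int n < (int (J i') - int (k + i + 1)) mod int n"
    if "i < p" "i' < i" for i i'
    using pbw_column_first[OF n \<alpha>, of "i + 1" "i' + 1"] that pn by (simp add: J_def)
  have Jinj: "i = i'" if "i < p" "i' < p" "J i = J i'" for i i'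
    using first[of i i'] first[of i' i] that by (cases i i' rule: linorder_cases) auto
  \<comment> \<open>A term is given by a permutation and a distribution of the level;
    \<open>\<rho> x j\<close> is the resulting row number of its j-th variable.\<close>
  define Idx where "Idx = {\<pi>. \<pi> permutes {0..<p}} \<times> multisets_of_size {0..<p} k"
  define \<rho> where "\<rho> x j = count (snd x) j * p + fst x j + 1" for x :: "(nat \<Rightarrow> nat) \<times> nat multiset" and j
  define m where "m x = (\<Sum>j=0..<p. Poly_Mapping.single (row_var p (\<rho> x j) (J j)) (1::nat))" for x
  have perm: "\<pi> j < p" if "\<pi> permutes {0..<p}" "j < p" for \<pi> j
    using permutes_in_image[OF that(1), of j] that(2) by simp
  have var: "row_var p (\<rho> x j) (J j) = (fst x j + 1, J j, count (snd x) j)" if "x \<in> Idx" "j < p" for x j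
    using that perm[of "fst x" j] by (auto simp: row_var_def \<rho>_def Idx_def)
  have D: "D p n I k = (\<Sum>x\<in>Idx. Poly_Mapping.single (m x) (of_int (sign (fst x))))"
    unfolding D_expand[OF I] Idx_def[symmetric] case_prod_unfold
  proof (rule sum.cong[OF refl])
    fix x
    assume x: "x \<in> Idx"
    have "(\<Sum>j=0..<p. Poly_Mapping.single (fst x j + 1, I (j + 1), count (snd x) j) 1) = m x"
      unfolding m_def by (rule sum.cong) (use var[OF x] in \<open>auto simp: J_def\<close>)
    then show "Poly_Mapping.single (\<Sum>j=0..<p. Poly_Mapping.single (fst x j + 1, I (j + 1), count (snd x) j) 1)
        (of_int (sign (fst x))) = Poly_Mapping.single (m x) (of_int (sign (fst x)))"
      by simp
  qed
  have fin: "finite Idx"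
    by (auto simp: Idx_def finite_permutations)
  have mono: "m x \<in> monoms_in (grid_vars p n)" for x
  proof -
    have "Poly_Mapping.keys (m x) = (\<lambda>j. row_var p (\<rho> x j) (J j)) ` {0..<p}"
      unfolding m_def by (rule keys_sum_single) simp
    then show ?thesis
      using Jr unfolding monoms_in_def grid_vars_def \<rho>_def by force
  qed
  have m_row: "m x = row_monom p I k" if "\<And>j. j < p \<Longrightarrow> \<rho> x j = k + j + 1" for x
  proof -
    have "m x = (\<Sum>j=0..<p. Poly_Mapping.single (row_var p (k + Suc j) (I (Suc j))) 1)"
      unfolding m_def by (rule sum.cong) (auto simp: that J_def)
    also have "\<dots> = row_monom p I k"
      unfolding row_monom_def One_nat_def
      by (subst sum.shift_bounds_Suc_ivl[symmetric]) (simp add: atLeastLessThanSuc_atLeastAtMost)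
    finally show ?thesis .
  qed

  \<comment> \<open>The index of the expected leading monomial. Row k + j + 1 has level
    \<open>(k + j) div p\<close> and, counted from 0, matrix row
    \<open>(k + j) mod p\<close>.\<close>
  define \<pi>0 where "\<pi>0 j = (if j < p then (k + j) mod p else j)" for j
  define X0 where "X0 = (\<Sum>j=0..<p. replicate_mset ((k + j) div p) j)"
  define x0 where "x0 = (\<pi>0, X0)"
  have count0: "count X0 j = (k + j) div p" if "j < p" for j
    using that by (simp add: X0_def count_sum)
  have inj0: "inj_on (\<lambda>j. (k + j) mod p) {0..<p}"
  proof (rule inj_onI)
    fix i j
    assume ij: "i \<in> {0..<p}" "j \<in> {0..<p}" and eq: "(k + i) mod p = (k + j) mod p"
    have "int (k + i) mod int p = int (k + j) mod int p"
      using eq by (simp only: of_nat_mod[symmetric])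
    then have "(int (k + i) - int k) mod int p = (int (k + j) - int k) mod int p"
      by (rule mod_diff_cong) simp
    then have "int i mod int p = int j mod int p"
      by simp
    then show "i = j"
      using ij by simp
  qed
  moreover have "(\<lambda>j. (k + j) mod p) ` {0..<p} = {0..<p}"
    by (rule endo_inj_surj[OF _ _ inj0]) (use p in auto)
  ultimately have "bij_betw (\<lambda>j. (k + j) mod p) {0..<p} {0..<p}"
    by (simp add: bij_betw_def)
  then have "bij_betw \<pi>0 {0..<p} {0..<p}"
    by (rule bij_betw_cong[THEN iffD1, rotated]) (simp add: \<pi>0_def)
  then have "\<pi>0 permutes {0..<p}"
    by (rule bij_imp_permutes) (simp add: \<pi>0_def)
  moreover have "X0 \<in> multisets_of_size {0..<p} k"
    using sum_div_consecutive[OF p, of k] by (auto simp: X0_def multisets_of_size_def set_mset_sum)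
  ultimately have x0: "x0 \<in> Idx"
    by (simp add: x0_def Idx_def)
  have \<rho>0: "\<rho> x0 j = k + j + 1" if "j < p" for j
    using that count0[OF that] by (simp add: \<rho>_def x0_def \<pi>0_def)
  have m0: "m x0 = row_monom p I k"
    by (rule m_row[OF \<rho>0])

  have less: "pbw_less p n (m x) (m x0)" if x: "x \<in> Idx" and ne: "x \<noteq> x0" for x
  proof -
    define V where "V y j = row_var p (\<rho> y j) (J j)" for y j
    have \<pi>: "fst x permutes {0..<p}" and X: "set_mset (snd x) \<subseteq> {0..<p}" "size (snd x) = k"
      using x by (auto simp: Idx_def multisets_of_size_def)
    have mod_\<rho>: "(\<rho> x j - 1) mod p = fst x j" if "j < p" for j
      using perm[OF \<pi> that] by (simp add: \<rho>_def)
    have incong: "i = j" if "i < p" "j < p" "int (\<rho> x i) mod int p = int (\<rho> x j) mod int p" for i j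
    proof -
      have "(int (\<rho> x i) - 1) mod int p = (int (\<rho> x j) - 1) mod int p"
        using that(3) by (rule mod_diff_cong) simp
      moreover have "int (\<rho> x l) - 1 = int (\<rho> x l - 1)" for l
        by (simp add: \<rho>_def)
      ultimately have "int ((\<rho> x i - 1) mod p) = int ((\<rho> x j - 1) mod p)"
        by (simp only: of_nat_mod)
      then have "fst x i = fst x j"
        using mod_\<rho> that by simp
      then show ?thesis
        using permutes_inj[OF \<pi>] by (simp add: inj_eq)
    qed
    have sum: "(\<Sum>j=0..<p. \<rho> x j) = (\<Sum>j=0..<p. k + j + 1)"
    proof -
      have "(\<Sum>j=0..<p. fst x j) = (\<Sum>j=0..<p. j)"
        using sum.permute[OF \<pi>, of "\<lambda>j. j"] by (simp add: comp_def)
      moreover have "(\<Sum>j=0..<p. count (snd x) j) = k"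
        using X sum.mono_neutral_right[of "{0..<p}" "set_mset (snd x)" "count (snd x)"]
        by (simp add: size_multiset_overloaded_eq not_in_iff)
      moreover have "(\<Sum>j=0..<p. \<rho> x j) = (\<Sum>j=0..<p. count (snd x) j) * p + (\<Sum>j=0..<p. fst x j) + p"
        unfolding \<rho>_def sum.distrib sum_distrib_right by simp
      moreover have "(\<Sum>j=0..<p. k + j + 1) = p * k + (\<Sum>j=0..<p. j) + p"
        unfolding sum.distrib by simp
      ultimately show ?thesis
        by (simp only: mult.commute)
    qed
    have before: "pbw_before p n (V y i) (V z j) \<longleftrightarrow> \<rho> y i < \<rho> z j \<or> \<rho> y i = \<rho> z j \<and>
        (int (J i) - int (\<rho> y i)) mod int n < (int (J j) - int (\<rho> y i)) mod int n"
      if "i < p" "j < p" for y z i j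
      unfolding V_def by (rule pbw_before_row_var[OF p n _ _ Jr[OF that(1)] Jr[OF that(2)]]) (simp_all add: \<rho>_def)
    have V_row: "\<rho> y i = \<rho> z j" "J i = J j" if "V y i = V z j" for y z i j
    proof -
      show "\<rho> y i = \<rho> z j"
        using that unfolding V_def by (rule row_var_row_eq) (simp_all add: \<rho>_def)
      show "J i = J j"
        using that by (simp add: V_def row_var_def)
    qed
    \<comment> \<open>A deciding variable \<open>V x i\<close>: it occurs for x but not for x0, and
      all occurrences of later variables coincide.\<close>
    have "\<exists>i<p. (\<forall>j<p. V x0 j \<noteq> V x i) \<and>
      (\<forall>j<p. pbw_before p n (V x i) (V x j) \<or> pbw_before p n (V x i) (V x0 j) \<longrightarrow> V x j = V x0 j)"
    proof (cases "\<exists>j<p. k + p < \<rho> x j")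
      case True
      \<comment> \<open>All variables of x0 lie in rows up to k + p, hence before the variable of x
        in its largest row.\<close>
      define r where "r = Max (\<rho> x ` {0..<p})"
      have "r \<in> \<rho> x ` {0..<p}"
        unfolding r_def using p by (intro Max_in) auto
      then obtain i where i: "i < p" "\<rho> x i = r"
        by auto
      have max: "\<rho> x j \<le> r" if "j < p" for j
        unfolding r_def using that by (intro Max_ge) auto
      have "k + p < r"
        using True max by (meson less_le_trans)
      then have big: "\<rho> x0 j < r" if "j < p" for j
        using \<rho>0[OF that] that by simp
      show ?thesis
      proof (intro exI[of _ i] conjI allI impI)
        fix j
        assume j: "j < p"
        show "V x0 j \<noteq> V x i"
          using big[OF j] V_row(1)[of x0 j x i] i by auto
        assume "pbw_before p n (V x i) (V x j) \<or> pbw_before p n (V x i) (V x0 j)"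
        then have "\<rho> x i = \<rho> x j" "(int (J i) - int (\<rho> x i)) mod int n < (int (J j) - int (\<rho> x i)) mod int n"
          using before[OF i(1) j, of x x] before[OF i(1) j, of x x0] max[OF j] big[OF j] i by auto
        moreover from this(1) have "i = j"
          using incong[OF i(1) j] by simp
        ultimately show "V x j = V x0 j"
          by simp
      qed (rule i(1))
    next
      case False
      then have le: "\<rho> x j \<le> k + p" if "j < p" for j
        using that not_less by blast
      have ge: "k + 1 \<le> \<rho> x j" if "j < p" for j
        by (rule rows_in_window[of p "\<rho> x", OF p incong sum le that])
      define S where "S = {j\<in>{0..<p}. \<rho> x j \<noteq> k + j + 1}"
      have "S \<noteq> {}"
      proof
        assume "S = {}"
        then have eq: "\<rho> x j = k + j + 1" if "j < p" for j
          using that by (auto simp: S_def)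
        have "fst x j = \<pi>0 j" for j
          using mod_\<rho>[of j] eq[of j] permutes_not_in[OF \<pi>, of j] by (cases "j < p") (auto simp: \<pi>0_def)
        moreover have "count (snd x) j = count X0 j" for j
        proof (cases "j < p")
          case True
          have "\<rho> x j - 1 = count (snd x) j * p + fst x j"
            by (simp add: \<rho>_def)
          then have "(\<rho> x j - 1) div p = count (snd x) j"
            using perm[OF \<pi> True] by simp
          then show ?thesis
            using eq[OF True] count0[OF True] by simp
        next
          case False
          then have "j \<notin># snd x" "j \<notin># X0"
            using X by (auto simp: X0_def set_mset_sum)
          then show ?thesis
            by (simp add: not_in_iff)
        qed
        ultimately have "x = x0"
          by (simp add: x0_def prod_eq_iff fun_eq_iff multiset_eq_iff)
        then show False
          using ne by simp
      qed
      moreover have "finite S"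
        by (simp add: S_def)
      ultimately have S: "Max S \<in> S" "\<And>j. j \<in> S \<Longrightarrow> j \<le> Max S"
        by auto
      define i1 where "i1 = Max S"
      have i1: "i1 < p" "\<rho> x i1 \<noteq> k + i1 + 1" "\<And>j. j < p \<Longrightarrow> i1 < j \<Longrightarrow> \<rho> x j = k + j + 1"
        using S by (auto simp: S_def i1_def not_le[symmetric])
      \<comment> \<open>The rows of x fill the whole window, so row k + i1 + 1, which i1 misses, is
        taken by another index i. Indices above i1 already have their own rows, which forces i <
        i1.\<close>
      have "inj_on (\<rho> x) {0..<p}"
        using incong by (auto intro!: inj_onI)
      then have "\<rho> x ` {0..<p} = {k + 1..k + p}"
        using le ge by (intro card_subset_eq) (auto simp: card_image)
      moreover have "k + i1 + 1 \<in> {k + 1..k + p}"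
        using i1(1) by simp
      ultimately obtain i where i: "i < p" "\<rho> x i = k + i1 + 1"
        by (metis atLeastLessThan_iff imageE)
      have "i < i1"
        using i i1(2) i1(3)[of i] by (cases i i1 rule: linorder_cases) auto
      note fi = first[OF i1(1) this]
      show ?thesis
      proof (intro exI[of _ i] conjI allI impI)
        fix j
        assume j: "j < p"
        show "V x0 j \<noteq> V x i"
        proof
          assume eq: "V x0 j = V x i"
          have "j = i1"
            using V_row(1)[OF eq] \<rho>0[OF j] i(2) by simp
          then show False
            using V_row(2)[OF eq] fi by simp
        qed
        assume b: "pbw_before p n (V x i) (V x j) \<or> pbw_before p n (V x i) (V x0 j)"
        show "V x j = V x0 j"
        proof (cases "i1 < j")
          case True
          then show ?thesis
            using i1(3)[OF j] \<rho>0[OF j] by (simp add: V_def)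
        next
          case nj: False
          have "\<not> pbw_before p n (V x i) (V x0 j)"
            using before[OF i(1) j, of x x0] \<rho>0[OF j] i(2) nj fi by (cases "j = i1") auto
          moreover have "\<not> pbw_before p n (V x i) (V x j)"
          proof
            assume "pbw_before p n (V x i) (V x j)"
            then consider "\<rho> x i < \<rho> x j" | "\<rho> x i = \<rho> x j"
                "(int (J i) - int (\<rho> x i)) mod int n < (int (J j) - int (\<rho> x i)) mod int n"
              using before[OF i(1) j, of x x] by blast
            then show False
            proof cases
              case 1
              define l where "l = \<rho> x j - k - 1"
              have l: "l < p" "i1 < l" "\<rho> x j = k + l + 1"
                using 1 i(2) le[OF j] by (auto simp: l_def)
              then have "j = l"
                using i1(3)[OF l(1,2)] incong[OF j l(1)] by simp
              then show False
                using l(2) nj by simp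
            next
              case 2
              then have "i = j"
                using incong[OF i(1) j] by simp
              then show False
                using 2(2) by simp
            qed
          qed
          ultimately show ?thesis
            using b by blast
        qed
      qed (rule i(1))
    qed
    then obtain i where i: "i < p" "\<And>j. j < p \<Longrightarrow> V x0 j \<noteq> V x i"
      "\<And>j. j < p \<Longrightarrow> pbw_before p n (V x i) (V x j) \<or> pbw_before p n (V x i) (V x0 j) \<Longrightarrow> V x j = V x0 j"
      by blast
    have look: "Poly_Mapping.lookup (m y) w = card {j\<in>{0..<p}. V y j = w}" for y w
      unfolding m_def V_def by (rule lookup_sum_single) simp
    have "{j\<in>{0..<p}. V x0 j = V x i} = {}"
      using i(2) by auto
    then have "Poly_Mapping.lookup (m x0) (V x i) = 0"
      unfolding look by (simp only: card.empty)
    moreover have "i \<in> {j\<in>{0..<p}. V x j = V x i}"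
      using i(1) by simp
    then have "0 < Poly_Mapping.lookup (m x) (V x i)"
      unfolding look by (subst card_gt_0_iff) auto
    moreover have "Poly_Mapping.lookup (m x) w = Poly_Mapping.lookup (m x0) w"
      if w: "pbw_before p n (V x i) w" for w
    proof -
      have "V x j = w \<longleftrightarrow> V x0 j = w" if "j < p" for j
        using i(3)[OF that] w by auto
      then have "{j\<in>{0..<p}. V x j = w} = {j\<in>{0..<p}. V x0 j = w}"
        by auto
      then show ?thesis
        by (simp only: look)
    qed
    moreover have "monom_degree (m y) = p" for y
      unfolding m_def using monom_degree_sum_single[of "{0..<p}"] by simp
    ultimately show ?thesis
      unfolding pbw_less_def degrevlex_def
      by (intro disjI2 conjI exI[of _ "V x i"] allI impI) simp_all
  qed
  have "lead (\<Sum>x\<in>Idx. Poly_Mapping.single (m x) (of_int (sign (fst x)))) (m x0)"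
    by (rule lead_sum_single[OF fin x0]) (use mono less in auto)
  then show ?thesis
    by (simp only: D m0)
qed

section \<open>The sagbi basis\<close>

text \<open>The columns of the variables in \<open>symbol_monom\<close>, chosen so that the
  associated minor has this monomial as its leading one.\<close>

definition symbol_tuple :: "nat \<Rightarrow> nat \<Rightarrow> nat set \<times> nat \<Rightarrow> nat \<Rightarrow> nat" where
  "symbol_tuple p n s =
    (\<lambda>j\<in>{1..p}. mod1 (int (snd s + j + column_offset (fst s) (nth_elem (fst s) (p - j)))) n)"

lemma row_monom_symbol_tuple: "row_monom p (symbol_tuple p n s) (snd s) = symbol_monom p n s"
  unfolding row_monom_def symbol_monom_def
  by (rule sum.cong) (simp_all add: symbol_tuple_def point_var_def symbol_point_def)

lemma nth_elem_gap:
  assumes "finite A" "i \<le> j" "j < card A"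
  shows "nth_elem A i + (j - i) \<le> nth_elem A j"
  using assms(2,3)
proof (induction j rule: dec_induct)
  case (step j)
  then show ?case
    using nth_elem_less[OF assms(1), of j "Suc j"] by simp
qed simp

lemma nth_elem_gap_strict:
  assumes "finite A" "i < j" "j < card A" "nth_elem A j - 1 \<notin> A"
  shows "nth_elem A i + (j - i) < nth_elem A j"
proof -
  have "nth_elem A (j - 1) < nth_elem A j"
    using nth_elem_less[OF assms(1), of "j - 1" j] assms by simp
  moreover have "nth_elem A (j - 1) \<in> A"
    by (rule nth_elem_mem[OF assms(1)]) (use assms in linarith)
  then have "nth_elem A (j - 1) \<noteq> nth_elem A j - 1"
    using assms(4) by metis
  moreover have "nth_elem A i + (j - 1 - i) \<le> nth_elem A (j - 1)"
    using assms by (intro nth_elem_gap) auto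
  ultimately show ?thesis
    using assms(2) by linarith
qed

text \<open>After rotation by k the entries are j + offset. Offset 0 gives the fixed entry j.
  Otherwise the element a has p - j smaller elements and the gap a - 1 below it, so j + a - 1 > p.
  The same gap makes these entries decrease in j: passing to a larger j lowers the element by more
  than the gain in j.\<close>

lemma symbol_tuple_pbw:
  assumes A: "fst s \<in> psubsets p n" and pn: "p < n"
  shows "(symbol_tuple p n s, snd s) \<in> pbw_symbols p n"
proof -
  have n: "n > 0"
    using pn by simp
  note fA = psubsetsD[OF A]
  define el where "el j = nth_elem (fst s) (p - j)" for j
  define off where "off j = column_offset (fst s) (el j)" for j
  define \<alpha> where "\<alpha> j = mod1 (int (symbol_tuple p n s j) - int (snd s)) n" for j
  have tup: "symbol_tuple p n s \<in> tuples p n"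
    using mod1_range[OF n] by (auto simp: tuples_def symbol_tuple_def)
  have el_mem: "el j \<in> fst s" "1 \<le> el j" if "j \<in> {1..p}" for j
  proof -
    show "el j \<in> fst s"
      unfolding el_def using that fA by (intro nth_elem_mem) auto
    then show "1 \<le> el j"
      using fA(1) by auto
  qed
  have off_range: "j + off j \<le> n" if j: "j \<in> {1..p}" for j
  proof -
    have "el j + (p - 1 - (p - j)) \<le> nth_elem (fst s) (p - 1)"
      unfolding el_def using j fA by (intro nth_elem_gap) auto
    moreover have "nth_elem (fst s) (p - 1) \<le> n"
      using nth_elem_mem[OF fA(3), of "p - 1"] j fA by auto
    ultimately have "j + (el j - 1) \<le> n"
      using j el_mem(2)[OF j] by auto
    then show ?thesis
      using j pn by (auto simp: off_def column_offset_def)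
  qed
  have \<alpha>: "\<alpha> j = j + off j" if j: "j \<in> {1..p}" for j
  proof -
    have "symbol_tuple p n s j = mod1 (int (snd s + j + off j)) n"
      using j by (simp add: symbol_tuple_def off_def el_def)
    then have "(int (symbol_tuple p n s j) + - int (snd s)) mod int n
        = (int (snd s + j + off j) + - int (snd s)) mod int n"
      by (simp only: int_mod1_mod[OF n])
    then have "(int (symbol_tuple p n s j) - int (snd s)) mod int n = int (j + off j) mod int n"
      by simp
    then have "\<alpha> j = mod1 (int (j + off j)) n"
      unfolding \<alpha>_def by (rule mod1_cong)
    then show ?thesis
      using j off_range[OF j] by (subst mod1_eq_self[symmetric, of _ n]) auto
  qed
  have zero_or_large: "off j = 0 \<or> p < \<alpha> j" if j: "j \<in> {1..p}" for j
  proof (rule disjCI)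
    assume "\<not> p < \<alpha> j"
    then have small: "\<alpha> j \<le> p"
      by simp
    show "off j = 0"
    proof (rule ccontr)
      assume "off j \<noteq> 0"
      then have *: "off j = el j - 1" "el j - 1 \<notin> fst s" "el j \<noteq> 1"
        by (auto simp: off_def column_offset_def split: if_splits)
      show False
      proof (cases "j = p")
        case True
        then show False
          using \<alpha>[OF j] small \<open>off j \<noteq> 0\<close> by simp
      next
        case False
        then have "nth_elem (fst s) 0 + (p - j - 0) < el j"
          using j * fA unfolding el_def by (intro nth_elem_gap_strict) auto
        moreover have "1 \<le> nth_elem (fst s) 0"
          using nth_elem_mem[OF fA(3), of 0] j fA by auto
        ultimately show False
          using \<alpha>[OF j] small *(1) j by auto
      qed
    qed
  qed
  have desc: "\<alpha> j < \<alpha> j'" if j: "j \<in> {1..p}" "j' \<in> {1..p}" "j' < j" "p < \<alpha> j" "p < \<alpha> j'" for j j'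
  proof -
    have "off j \<noteq> 0" "off j' \<noteq> 0"
      using \<alpha>[OF j(1)] \<alpha>[OF j(2)] j by auto
    then have *: "off j = el j - 1" "off j' = el j' - 1" "el j' - 1 \<notin> fst s"
      by (auto simp: off_def column_offset_def split: if_splits)
    have "el j + (p - j' - (p - j)) < el j'"
      unfolding el_def using j * fA unfolding el_def by (intro nth_elem_gap_strict) auto
    then show ?thesis
      using \<alpha>[OF j(1)] \<alpha>[OF j(2)] * j el_mem(2)[OF j(1)] el_mem(2)[OF j(2)] by auto
  qed
  have fix1: "\<alpha> j = j" if "j \<in> {1..p}" "\<alpha> j \<le> p" for j
    using zero_or_large[OF that(1)] \<alpha>[OF that(1)] that(2) by auto
  have "pbw_tuple p n \<alpha>"
    unfolding pbw_tuple_def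
  proof (intro conjI ballI impI)
    fix j
    assume j: "j \<in> {1..p}"
    show "\<alpha> j \<in> {1..n}"
      unfolding \<alpha>_def by (rule mod1_range[OF n])
    show "\<alpha> j = j" if "\<alpha> j \<le> p"
      by (rule fix1[OF j that])
    fix k
    assume k: "k \<in> {1..p}" and gt: "\<alpha> k < \<alpha> j \<and> p < \<alpha> k"
    show "j < k"
    proof (rule ccontr)
      assume "\<not> j < k"
      then consider "j = k" | "k < j"
        by linarith
      then show False
        using gt desc[OF j k] by cases auto
    qed
  next
    show "inj_on \<alpha> {1..p}"
    proof (rule inj_onI, rule ccontr)
      fix j k
      assume jk: "j \<in> {1..p}" "k \<in> {1..p}" and eq: "\<alpha> j = \<alpha> k" and "j \<noteq> k"
      then have "p < \<alpha> j"
        using fix1[of j] fix1[of k] by (cases "\<alpha> j \<le> p") auto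
      then show False
        using desc[of j k] desc[of k j] jk eq \<open>j \<noteq> k\<close> by (cases j k rule: linorder_cases) auto
    qed
  qed
  then show ?thesis
    using tup unfolding pbw_symbols_def \<alpha>_def by blast
qed

text \<open>A vanishing minor is written as 0 times a sorted one of the same level, so the number of
  factors and the total level of a product are always preserved.\<close>

lemma D_eq_sorted_D:
  assumes "I \<in> tuples p n" "p \<le> n"
  shows "\<exists>A\<in>psubsets p n. \<exists>z. D p n I k = of_int z * sorted_D p (A, k)"
proof -
  have I: "\<And>j. j < p \<Longrightarrow> I (j + 1) \<in> {1..n}"
    using assms(1) PiE_mem[of I "{1..p}" "\<lambda>_. {1..n}"] by (auto simp: tuples_def)
  show ?thesis
  proof (rule minor_coeff_cases[of p "\<lambda>j. I (j + 1)" n, OF I], assumption)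
    assume "minor p column_series (\<lambda>j. I (j + 1)) = 0"
    then have "D p n I k = of_int 0 * sorted_D p ({1..p}, k)"
      by (simp add: D_eq_minor[OF assms(1)])
    moreover have "{1..p} \<in> psubsets p n"
      using assms(2) by (auto simp: psubsets_def)
    ultimately show ?thesis
      by blast
  next
    fix \<sigma> :: "nat \<Rightarrow> nat"
    assume "(\<lambda>j. I (j + 1)) ` {0..<p} \<in> psubsets p n"
      "\<And>k. fps_nth (minor p column_series (\<lambda>j. I (j + 1))) k =
        of_int (sign \<sigma>) * sorted_D p ((\<lambda>j. I (j + 1)) ` {0..<p}, k)"
    then show ?thesis
      unfolding D_eq_minor[OF assms(1)] by blast
  qed
qed

section \<open>Passage between PBW products and standard products\<close>

lemma prod_D_eq_prod_sorted_D:
  assumes "\<And>x. x \<in># w \<Longrightarrow> fst x \<in> tuples p n" "p \<le> n"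
  shows "\<exists>w' z. set_mset w' \<subseteq> psubsets p n \<times> UNIV \<and> size w' = size w \<and>
    (\<Sum>s\<in>#w'. snd s) = (\<Sum>x\<in>#w. snd x) \<and>
    (\<Prod>x\<in>#w. D p n (fst x) (snd x)) = of_int z * (\<Prod>s\<in>#w'. sorted_D p s)"
  using assms(1)
proof (induction w)
  case empty
  show ?case
    by (intro exI[of _ "{#}"] exI[of _ 1]) simp
next
  case (add x w)
  have "fst y \<in> tuples p n" if "y \<in># w" for y
    using add.prems that by simp
  from add.IH[OF this] obtain w' z where w': "set_mset w' \<subseteq> psubsets p n \<times> UNIV" "size w' = size w"
    "(\<Sum>s\<in>#w'. snd s) = (\<Sum>x\<in>#w. snd x)"
    "(\<Prod>x\<in>#w. D p n (fst x) (snd x)) = of_int z * (\<Prod>s\<in>#w'. sorted_D p s)"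
    by blast
  obtain A y where A: "A \<in> psubsets p n" "D p n (fst x) (snd x) = of_int y * sorted_D p (A, snd x)"
    using D_eq_sorted_D[of "fst x" p n "snd x"] add.prems assms(2) by auto
  show ?case
    by (intro exI[of _ "add_mset (A, snd x) w'"] exI[of _ "y * z"]) (use w' A in \<open>simp add: mult_ac\<close>)
qed

text \<open>The total level bounds each single level. Fixing it together with the size leaves a
  finite index set, on which cardinalities can be compared.\<close>

lemma finite_standard: "finite (standard p n m K)"
proof (rule finite_subset)
  show "standard p n m K \<subseteq> multisets_of_size (psubsets p n \<times> {..K}) m"
  proof
    fix w
    assume w: "w \<in> standard p n m K"
    have "snd s \<le> K" if s: "s \<in># w" for s
    proof -
      obtain v where "w = add_mset s v"
        using s by (metis insert_DiffM)
      then show ?thesis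
        using w by (auto simp: standard_def)
    qed
    then show "w \<in> multisets_of_size (psubsets p n \<times> {..K}) m"
      using w by (auto simp: standard_def multisets_of_size_def)
  qed
  have "finite (psubsets p n)"
    by (rule finite_subset[of _ "Pow {1..n}"]) (auto simp: psubsets_def)
  then show "finite (multisets_of_size (psubsets p n \<times> {..K}) m)"
    by (intro finite_multisets_of_size) simp
qed

theorem theorem5p4:
  fixes p n :: nat
  assumes "1 \<le> p" and "p < n"
  shows "sagbi_basis (pbw_less p n) (pluecker_algebra p n)
           {D p n I k | I k. (I, k) \<in> pbw_symbols p n}"
proof -
  have n: "n > 0"
    using assms by simp
  interpret monomial_order "pbw_less p n" "monoms_in (grid_vars p n)"
    by (rule pbw_monomial_order[OF assms(1) n])
  define G where "G x = D p n (fst x) (snd x)" for x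
  define \<gamma> where "\<gamma> x = row_monom p (fst x) (snd x)" for x
  define \<Phi> where "\<Phi> s = (symbol_tuple p n s, snd s)" for s
  define Std where "Std = (\<Union>m K. standard p n m K)"
  define P where "P w = (\<Prod>s\<in>#w. sorted_D p s)" for w
  define E where "E w = (\<Prod>s\<in>#w. G (\<Phi> s))" for w
  define \<mu> where "\<mu> w = (\<Sum>s\<in>#w. symbol_monom p n s)" for w
  have \<gamma>\<Phi>: "\<gamma> (\<Phi> s) = symbol_monom p n s" for s
    by (simp add: \<gamma>_def \<Phi>_def row_monom_symbol_tuple)
  have StdD: "set_mset w \<subseteq> psubsets p n \<times> UNIV" "\<forall>s\<in>#w. \<forall>t\<in>#w. symbol_le s t \<or> symbol_le t s"
    if "w \<in> Std" for w
    using that by (auto simp: Std_def standard_def)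
  have \<Phi>: "\<Phi> s \<in> pbw_symbols p n" if "s \<in> psubsets p n \<times> UNIV" for s
    unfolding \<Phi>_def using that symbol_tuple_pbw[OF _ assms(2)] by auto
  have lead_G: "lead (G x) (\<gamma> x)" if "x \<in> pbw_symbols p n" for x
    unfolding G_def \<gamma>_def using that by (intro lead_D_pbw[OF assms]) simp
  have lead_E: "lead (E w) (\<mu> w)" if "w \<in> Std" for w
    unfolding E_def \<mu>_def
  proof (rule lead_prod_mset)
    fix s
    assume "s \<in># w"
    then show "lead (G (\<Phi> s)) (symbol_monom p n s)"
      using StdD(1)[OF that] lead_G[OF \<Phi>, of s] by (auto simp: \<gamma>\<Phi>)
  qed
  have inj: "inj_on \<mu> Std"
  proof (rule inj_onI)
    fix w w'
    assume "w \<in> Std" "w' \<in> Std" "\<mu> w = \<mu> w'"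
    then show "w = w'"
      using StdD unfolding \<mu>_def by (intro symbol_monoms_inj[OF assms]) auto
  qed

  \<comment> \<open>Straightening keeps size and total level, so a PBW product stays in the span of
    the standard products of its own bidegree.\<close>
  have E_span: "E w \<in> cpoly.span (P ` standard p n (size w) (\<Sum>s\<in>#w. snd s))" if "w \<in> Std" for w
  proof -
    have "fst x \<in> tuples p n" if x: "x \<in># image_mset \<Phi> w" for x
    proof -
      obtain s where "s \<in># w" "x = \<Phi> s"
        using x by auto
      then have "x \<in> pbw_symbols p n"
        using StdD(1)[OF \<open>w \<in> Std\<close>] \<Phi>[of s] by auto
      then show ?thesis
        by (auto simp: pbw_symbols_def)
    qed
    then obtain w' z where w': "set_mset w' \<subseteq> psubsets p n \<times> UNIV" "size w' = size w"
      "(\<Sum>s\<in>#w'. snd s) = (\<Sum>s\<in>#w. snd s)" "E w = of_int z * P w'"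
      using prod_D_eq_prod_sorted_D[of "image_mset \<Phi> w" p n] assms(2)
      by (auto simp: E_def P_def G_def image_mset.compositionality comp_def \<Phi>_def)
    then show ?thesis
      using straightening[OF w'(1)] by (auto simp: P_def[abs_def] intro: span_of_int_mult)
  qed
  have P_span: "P w \<in> cpoly.span (E ` Std)" if "w \<in> standard p n m K" for w m K
  proof -
    let ?S = "standard p n m K"
    have sub: "?S \<subseteq> Std"
      by (auto simp: Std_def)
    have S: "size w = m" "(\<Sum>s\<in>#w. snd s) = K" if "w \<in> ?S" for w
      using that by (auto simp: standard_def)
    have indep: "inj_on E ?S" "cpoly.independent (E ` ?S)"
      using independent_if_distinct_leads[OF finite_standard inj_on_subset[OF inj sub] lead_E] sub by blast+
    \<comment> \<open>The PBW products are independent and at least as many as the standard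
      products, both families being indexed by the same chains. Hence the inclusion from
      \<open>E_span\<close> can be reversed.\<close>
    have "P ` ?S \<subseteq> cpoly.span (E ` ?S)"
    proof (rule span_eq_if_independent_card[OF _ indep(2)])
      show "finite (P ` ?S)"
        by (simp add: finite_standard)
      show "E ` ?S \<subseteq> cpoly.span (P ` ?S)"
        using E_span S sub by fastforce
      show "card (P ` ?S) \<le> card (E ` ?S)"
        using card_image_le[OF finite_standard] card_image[OF indep(1)] by metis
    qed
    then have "P w \<in> cpoly.span (E ` ?S)"
      using that by blast
    then show ?thesis
      using cpoly.span_mono[OF image_mono[OF sub]] by blast
  qed

  let ?A = "pluecker_algebra p n"
  have alg: "is_subalgebra ?A"
    unfolding pluecker_algebra_def by (rule is_subalgebra_generated)
  have span: "?A \<subseteq> cpoly.span (E ` Std)"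
  proof -
    let ?T = "psubsets p n \<times> (UNIV :: nat set)"
    have "D p n I k \<in> generated_algebra (sorted_D p ` ?T)" if I: "I \<in> tuples p n" for I k
    proof -
      obtain B z where B: "B \<in> psubsets p n" "D p n I k = cpoly_scale (of_int z) (sorted_D p (B, k))"
        using D_eq_sorted_D[OF I, of k] assms(2) by (auto simp: cpoly_scale_of_int)
      have "sorted_D p (B, k) \<in> generated_algebra (sorted_D p ` ?T)"
        using B(1) by (intro subsetD[OF subset_generated]) auto
      then show ?thesis
        using is_subalgebra_generated[of "sorted_D p ` ?T"] unfolding B(2) is_subalgebra_def
        by (intro cpoly.subspace_scale) auto
    qed
    then have "?A \<subseteq> generated_algebra (sorted_D p ` ?T)"
      unfolding pluecker_algebra_def by (intro generated_subset is_subalgebra_generated) auto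
    also have "\<dots> = cpoly.span (P ` {w. set_mset w \<subseteq> ?T})"
      unfolding generated_algebra_eq_span P_def[abs_def] ..
    also have "\<dots> \<subseteq> cpoly.span (E ` Std)"
    proof (rule cpoly.span_minimal)
      show "P ` {w. set_mset w \<subseteq> ?T} \<subseteq> cpoly.span (E ` Std)"
      proof clarify
        fix w :: "(nat set \<times> nat) multiset"
        assume "set_mset w \<subseteq> ?T"
        then have "P w \<in> cpoly.span (P ` standard p n (size w) (\<Sum>s\<in>#w. snd s))"
          using straightening[of w p n] by (simp add: P_def[abs_def])
        also have "\<dots> \<subseteq> cpoly.span (E ` Std)"
          using P_span by (intro cpoly.span_minimal) auto
        finally show "P w \<in> cpoly.span (E ` Std)" .
      qed
    qed simp
    finally show ?thesis .
  qed

  have "sagbi_basis (pbw_less p n) ?A (G ` pbw_symbols p n)"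
  proof (rule sagbi_basis_if_spanning_leads[OF lead_G _ alg])
    show "G ` pbw_symbols p n \<subseteq> ?A"
      unfolding pluecker_algebra_def
      by (rule order_trans[OF _ subset_generated]) (auto simp: G_def pbw_symbols_def)
    show "set_mset w \<subseteq> pbw_symbols p n" if "w \<in> image_mset \<Phi> ` Std" for w
      using that StdD(1) \<Phi> by fastforce
    \<comment> \<open>Injectivity is inherited from \<mu>, since \<gamma> after \<Phi> is the
      monomial of the symbol.\<close>
    show "inj_on (\<lambda>w. \<Sum>x\<in>#w. \<gamma> x) (image_mset \<Phi> ` Std)"
    proof (rule inj_onI)
      fix v v'
      assume "v \<in> image_mset \<Phi> ` Std" "v' \<in> image_mset \<Phi> ` Std" and eq: "(\<Sum>x\<in>#v. \<gamma> x) = (\<Sum>x\<in>#v'. \<gamma> x)"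
      then obtain w w' where w: "w \<in> Std" "w' \<in> Std" "v = image_mset \<Phi> w" "v' = image_mset \<Phi> w'"
        by auto
      then have "\<mu> w = \<mu> w'"
        using eq by (simp add: \<mu>_def image_mset.compositionality comp_def \<gamma>\<Phi>)
      then show "v = v'"
        using inj_onD[OF inj] w by metis
    qed
    have "(\<lambda>w. \<Prod>x\<in>#w. G x) ` image_mset \<Phi> ` Std = E ` Std"
      by (simp add: image_image E_def[abs_def] image_mset.compositionality comp_def)
    then show "?A \<subseteq> cpoly.span ((\<lambda>w. \<Prod>x\<in>#w. G x) ` image_mset \<Phi> ` Std)"
      using span by (simp only:)
  qed
  moreover have "G ` pbw_symbols p n = {D p n I k | I k. (I, k) \<in> pbw_symbols p n}"
    by (force simp: G_def)
  ultimately show ?thesis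
    by simp
qed

end
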